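(* Let $0<\alpha<1$, $0<\beta<\alpha$, $R>0$, and let $S=S_{\mathbb C}$. (i) If $a\in C^\alpha(\mathbb C)$, then the commutator $[S,a]$ is a bounded operator $L^\infty_R\to C^\beta(\mathbb C)$ and a bounded operator $C^\beta_R\to C^\alpha(\mathbb C)$. (ii) If $a\in C^{k+1,\alpha}(\mathbb C)$, where $k\ge 0$ is an integer, then $[S,a]$ is a bounded operator $C^{k,\alpha}_R\to C^{k+1,\alpha}(\mathbb C)$.
   Context: Notation: $d^2t=(2\pi i)^{-1}\,dt\wedge d\bar t$ (so $d^2t=-\frac1\pi$ times Lebesgue area measure). For a domain $\Omega\subset\mathbb C$, the Calderón–Zygmund operator is $S_\Omega u(z)=\mathrm{p.v.}\int_\Omega \frac{u(t)\,d^2t}{(t-z)^2}$. For a function $a$, the same letter denotes the operator of multiplication by $a$, and the commutator is $[S_\Omega,a]u(z)=S_\Omega(au)(z)-a(z)S_\Omega u(z)=\int_\Omega\frac{a(t)-a(z)}{(t-z)^2}u(t)\,d^2t$. $C^{k,\alpha}(\Omega)$ ($k\ge0$ an integer, $0<\alpha<1$) is the space of functions whose derivatives up to order $k$ satisfy a Lipschitz (Hölder) condition with exponent $\alpha$, with the usual norm; $C^\alpha(\Omega)=C^{0,\alpha}(\Omega)$. $L^p_R$ and $C^{k,\alpha}_R$ (and $C^\beta_R=C^{0,\beta}_R$) denote the spaces of functions in $L^p(\mathbb C)$, respectively $C^{k,\alpha}(\mathbb C)$, with support in the disc $|z|\le R$. *)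

theory Defs
  imports "HOL-Probability.Essential_Supremum"
begin

section \<open>The spaces $C^{k,\alpha}$ and $L^\infty_R$\<close>

text \<open>Differentiability and partial derivatives are real, in the variables $x = \mathrm{Re}\,z$,
  $y = \mathrm{Im}\,z$.\<close>

definition dx :: "(complex \<Rightarrow> complex) \<Rightarrow> complex \<Rightarrow> complex" where
  "dx f z = frechet_derivative f (at z) 1"

definition dy :: "(complex \<Rightarrow> complex) \<Rightarrow> complex \<Rightarrow> complex" where
  "dy f z = frechet_derivative f (at z) \<i>"

primrec Ck :: "nat \<Rightarrow> (complex \<Rightarrow> complex) \<Rightarrow> bool" where
  "Ck 0 f \<longleftrightarrow> continuous_on UNIV f"
| "Ck (Suc k) f \<longleftrightarrow> (\<forall>z. f differentiable (at z)) \<and> Ck k (dx f) \<and> Ck k (dy f)"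

definition partial :: "nat \<Rightarrow> nat \<Rightarrow> (complex \<Rightarrow> complex) \<Rightarrow> complex \<Rightarrow> complex" where
  "partial i j f = (dx ^^ i) ((dy ^^ j) f)"

definition holder_cond :: "real \<Rightarrow> (complex \<Rightarrow> complex) \<Rightarrow> bool" where
  "holder_cond \<alpha> f \<longleftrightarrow> (\<exists>C. \<forall>z w. cmod (f z - f w) \<le> C * cmod (z - w) powr \<alpha>)"

definition holder_seminorm :: "real \<Rightarrow> (complex \<Rightarrow> complex) \<Rightarrow> real" where
  "holder_seminorm \<alpha> f = (SUP (z, w)\<in>{(z, w). z \<noteq> w}. cmod (f z - f w) / cmod (z - w) powr \<alpha>)"

definition sup_norm :: "(complex \<Rightarrow> complex) \<Rightarrow> real" where
  "sup_norm f = (SUP z. cmod (f z))"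

definition holder_space :: "nat \<Rightarrow> real \<Rightarrow> (complex \<Rightarrow> complex) set" where
  "holder_space k \<alpha> = {f. Ck k f \<and>
     (\<forall>i j. i + j \<le> k \<longrightarrow> bounded (range (partial i j f)) \<and> holder_cond \<alpha> (partial i j f))}"

definition holder_norm :: "nat \<Rightarrow> real \<Rightarrow> (complex \<Rightarrow> complex) \<Rightarrow> real" where
  "holder_norm k \<alpha> f = (\<Sum>(i, j)\<in>{(i, j). i + j \<le> k}.
     sup_norm (partial i j f) + holder_seminorm \<alpha> (partial i j f))"

definition holder_space_R :: "real \<Rightarrow> nat \<Rightarrow> real \<Rightarrow> (complex \<Rightarrow> complex) set" where
  "holder_space_R R k \<alpha> = {f \<in> holder_space k \<alpha>. closure {z. f z \<noteq> 0} \<subseteq> cball 0 R}"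

text \<open>Elements of $L^\infty$ are represented by functions; accordingly the support condition is
  required almost everywhere.\<close>

definition Linf_norm :: "(complex \<Rightarrow> complex) \<Rightarrow> real" where
  "Linf_norm u = real_of_ereal (esssup lebesgue (\<lambda>z. ereal (cmod (u z))))"

definition Linf_space_R :: "real \<Rightarrow> (complex \<Rightarrow> complex) set" where
  "Linf_space_R R = {u. u \<in> borel_measurable lebesgue \<and>
     (\<exists>C. AE z in lebesgue. cmod (u z) \<le> C) \<and>
     (AE z in lebesgue. z \<notin> cball 0 R \<longrightarrow> u z = 0)}"

definition bounded_operator ::
  "(complex \<Rightarrow> complex) set \<Rightarrow> ((complex \<Rightarrow> complex) \<Rightarrow> real) \<Rightarrow>
   (complex \<Rightarrow> complex) set \<Rightarrow> ((complex \<Rightarrow> complex) \<Rightarrow> real) \<Rightarrow>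
   ((complex \<Rightarrow> complex) \<Rightarrow> complex \<Rightarrow> complex) \<Rightarrow> bool" where
  "bounded_operator X nX Y nY T \<longleftrightarrow>
     (\<forall>u\<in>X. \<forall>v\<in>X. T (\<lambda>z. u z + v z) = (\<lambda>z. T u z + T v z)) \<and>
     (\<forall>c. \<forall>u\<in>X. T (\<lambda>z. c * u z) = (\<lambda>z. c * T u z)) \<and>
     (\<forall>u\<in>X. T u \<in> Y) \<and>
     (\<exists>C. \<forall>u\<in>X. nY (T u) \<le> C * nX u)"

section \<open>The operator $S_\Omega$ and its commutators\<close>

text \<open>The factor $-1/\pi$ comes from
  $d^2t = (2\pi i)^{-1}\,dt\wedge d\bar t = -\frac1\pi\,d\lambda(t)$.\<close>

definition CZ_trunc :: "complex set \<Rightarrow> (complex \<Rightarrow> complex) \<Rightarrow> complex \<Rightarrow> real \<Rightarrow> complex" where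
  "CZ_trunc \<Omega> u z \<epsilon> =
     - (1 / of_real pi) * (LINT t:{t \<in> \<Omega>. \<epsilon> < cmod (t - z)}|lebesgue. u t / (t - z)\<^sup>2)"

definition CZ_exists :: "complex set \<Rightarrow> (complex \<Rightarrow> complex) \<Rightarrow> complex \<Rightarrow> bool" where
  "CZ_exists \<Omega> u z \<longleftrightarrow> (\<exists>l. (CZ_trunc \<Omega> u z \<longlongrightarrow> l) (at_right 0))"

definition CZ :: "complex set \<Rightarrow> (complex \<Rightarrow> complex) \<Rightarrow> complex \<Rightarrow> complex" where
  "CZ \<Omega> u z = Lim (at_right 0) (CZ_trunc \<Omega> u z)"

text \<open>The commutator $[S_\Omega, a]$ is given by its integral formula, because for $u \in L^\infty$
  the principal values $S_\Omega(au)(z)$ and $S_\Omega u(z)$ need not exist at every point \<open>z\<close>.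
  That it is $S_\Omega(au)(z) - a(z)\,S_\Omega u(z)$ is shown in \<open>CZ_commutator_eq\<close> and
  \<open>CZ_commutator_eq_holder\<close> below.\<close>

definition CZ_commutator ::
  "complex set \<Rightarrow> (complex \<Rightarrow> complex) \<Rightarrow> (complex \<Rightarrow> complex) \<Rightarrow> complex \<Rightarrow> complex" where
  "CZ_commutator \<Omega> a u z =
     - (1 / of_real pi) * (LINT t:\<Omega>|lebesgue. (a t - a z) / (t - z)\<^sup>2 * u t)"

section \<open>Well-definedness for $\Omega = \mathbb C$\<close>

lemma nn_integral_powr_cball_finite:
  fixes \<alpha> \<rho> :: real
  assumes \<alpha>: "0 < \<alpha>" "\<alpha> < 2" and \<rho>: "0 < \<rho>"
  shows "(\<integral>\<^sup>+ w. ennreal (indicator (cball 0 \<rho>) w * cmod w powr (\<alpha> - 2)) \<partial>lebesgue) < \<infinity>"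
proof -
  define c where "c n = (\<rho> / 2 ^ Suc n) powr (\<alpha> - 2)" for n
  define q where "q = 2 powr (- \<alpha>)"
  have q: "0 < q" "q < 1" using \<alpha> by (auto simp: q_def powr_less_one)
  have cm: "ennreal (c n) * emeasure lebesgue (cball (0::complex) (\<rho> / 2 ^ n))
      = ennreal (pi * \<rho>\<^sup>2 * (\<rho> / 2) powr (\<alpha> - 2) * q ^ n)" for n
  proof -
    have "emeasure lebesgue (cball (0::complex) (\<rho> / 2 ^ n)) = ennreal (pi * (\<rho> / 2 ^ n)\<^sup>2)"
      using emeasure_cball[of "\<rho> / 2 ^ n" "0::complex"] \<rho>
      by (simp add: unit_ball_vol_2[simplified])
    moreover have "c n * (pi * (\<rho> / 2 ^ n)\<^sup>2) = pi * \<rho>\<^sup>2 * (\<rho> / 2) powr (\<alpha> - 2) * q ^ n"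
    proof -
      have "c n = (\<rho> / 2 * (1 / 2 ^ n)) powr (\<alpha> - 2)"
        by (simp add: c_def field_simps)
      also have "\<dots> = (\<rho> / 2) powr (\<alpha> - 2) * (1 / 2 ^ n) powr (\<alpha> - 2)"
        using \<rho> by (subst powr_mult) auto
      also have "(1 / 2 ^ n :: real) = 2 powr (- real n)"
        by (simp add: powr_minus powr_realpow field_simps)
      also have "(2 powr (- real n)) powr (\<alpha> - 2) = q ^ n * 2 powr (2 * real n)"
      proof -
        have "q ^ n = 2 powr (- \<alpha> * n)"
          by (simp add: q_def powr_powr flip: powr_realpow)
        then show ?thesis by (simp add: powr_powr powr_add[symmetric] algebra_simps)
      qed
      also have "2 powr (2 * real n) = (2 ^ n)\<^sup>2"
      proof -
        have "2 powr (2 * real n) = 2 powr (real (n * 2))" by (simp add: mult.commute)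
        also have "\<dots> = 2 ^ (n * 2)" by (rule powr_realpow) simp
        finally show ?thesis by (simp only: power_mult)
      qed
      finally have "c n = (\<rho> / 2) powr (\<alpha> - 2) * (q ^ n * (2 ^ n)\<^sup>2)" .
      then show ?thesis by (simp add: power_divide field_simps)
    qed
    moreover have "ennreal (c n * (pi * (\<rho> / 2 ^ n)\<^sup>2))
        = ennreal (c n) * ennreal (pi * (\<rho> / 2 ^ n)\<^sup>2)"
      by (rule ennreal_mult) (auto simp: c_def)
    ultimately show ?thesis by metis
  qed
  have "(\<integral>\<^sup>+ w. ennreal (indicator (cball 0 \<rho>) w * cmod w powr (\<alpha> - 2)) \<partial>lebesgue)
      \<le> (\<integral>\<^sup>+ w. (\<Sum>n. ennreal (c n) * indicator (cball 0 (\<rho> / 2 ^ n)) w) \<partial>(lebesgue :: complex measure))"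
  proof (rule nn_integral_mono)
    fix w :: complex
    show "ennreal (indicator (cball 0 \<rho>) w * cmod w powr (\<alpha> - 2))
        \<le> (\<Sum>n. ennreal (c n) * indicator (cball 0 (\<rho> / 2 ^ n)) w)"
    proof (cases "w \<noteq> 0 \<and> cmod w \<le> \<rho>")
      case True
      have "(\<lambda>n. \<rho> / 2 ^ n) \<longlonglongrightarrow> 0" by (rule LIMSEQ_divide_realpow_zero) simp
      then have "eventually (\<lambda>n. \<rho> / 2 ^ n < cmod w) sequentially"
        by (rule order_tendstoD(2)) (use True in simp)
      then obtain n where "\<rho> / 2 ^ n < cmod w" by (auto simp: eventually_sequentially)
      then have ex: "\<exists>n. \<rho> / 2 ^ n < cmod w" by blast
      define m where "m = (LEAST n. \<rho> / 2 ^ n < cmod w)"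
      have m: "\<rho> / 2 ^ m < cmod w" unfolding m_def using ex by (rule LeastI_ex)
      have "m \<noteq> 0" using m True by (intro notI) auto
      then obtain n where n: "m = Suc n" by (cases m) auto
      have "\<not> \<rho> / 2 ^ n < cmod w" using not_less_Least[of n "\<lambda>n. \<rho> / 2 ^ n < cmod w"] n
        by (auto simp: m_def)
      moreover have "cmod w powr (\<alpha> - 2) \<le> c n"
        unfolding c_def using m n \<alpha> \<rho> by (intro powr_mono2') auto
      ultimately have "ennreal (indicator (cball 0 \<rho>) w * cmod w powr (\<alpha> - 2))
          \<le> ennreal (c n) * indicator (cball 0 (\<rho> / 2 ^ n)) w"
        using True by (auto intro: ennreal_leI)
      also have "\<dots> = (\<Sum>i\<in>{n}. ennreal (c i) * indicator (cball 0 (\<rho> / 2 ^ i)) w)"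
        by (simp del: indicator_simps sum_mult_indicator add: sum.insert)
      also have "\<dots> \<le> (\<Sum>n. ennreal (c n) * indicator (cball 0 (\<rho> / 2 ^ n)) w)"
        by (rule sum_le_suminf) auto
      finally show ?thesis .
    qed (auto split: split_indicator)
  qed
  also have "\<dots> = (\<Sum>n. \<integral>\<^sup>+ w. ennreal (c n) * indicator (cball 0 (\<rho> / 2 ^ n)) w \<partial>(lebesgue :: complex measure))"
    by (rule nn_integral_suminf)
       (simp add: measurable_completion borel_measurable_times_ennreal borel_measurable_indicator)
  also have "\<dots> = (\<Sum>n. ennreal (pi * \<rho>\<^sup>2 * (\<rho> / 2) powr (\<alpha> - 2) * q ^ n))"
  proof (rule arg_cong[where f = suminf], rule ext)
    fix n
    have "cball (0::complex) (\<rho> / 2 ^ n) \<in> sets lebesgue" by simp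
    from nn_integral_cmult_indicator[OF this, of "ennreal (c n)"] cm[of n]
    show "(\<integral>\<^sup>+ w. ennreal (c n) * indicator (cball 0 (\<rho> / 2 ^ n)) w \<partial>(lebesgue :: complex measure))
        = ennreal (pi * \<rho>\<^sup>2 * (\<rho> / 2) powr (\<alpha> - 2) * q ^ n)" by (rule trans)
  qed
  also have "\<dots> < \<infinity>"
    using q by (subst suminf_ennreal_eq[OF _ sums_mult[OF geometric_sums]]) auto
  finally show ?thesis .
qed

lemma integrable_powr_cball:
  fixes \<alpha> \<rho> :: real and z :: complex
  assumes "0 < \<alpha>" "\<alpha> < 2" "0 < \<rho>"
  shows "integrable lebesgue (\<lambda>t. indicator (cball z \<rho>) t * cmod (t - z) powr (\<alpha> - 2))"
proof -
  define f where "f = (\<lambda>w::complex. indicator (cball 0 \<rho>) w * cmod w powr (\<alpha> - 2))"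
  have f: "f \<in> borel_measurable borel"
    unfolding f_def
    by (intro borel_measurable_times borel_measurable_indicator borel_closed closed_cball
        powr_real_measurable borel_measurable_norm borel_measurable_const measurable_ident_sets refl)
  have "integrable lebesgue f"
  proof (rule integrableI_nonneg)
    show "f \<in> borel_measurable lebesgue" using f by (intro measurable_completion) simp
    show "AE w in lebesgue. 0 \<le> f w" by (simp add: f_def)
    show "(\<integral>\<^sup>+ w. ennreal (f w) \<partial>lebesgue) < \<infinity>"
      using nn_integral_powr_cball_finite[OF assms] by (simp only: f_def)
  qed
  then have "integrable lborel f"
    using f by (simp add: integrable_completion)
  then have "integrable (distr lborel borel ((+) (- z))) f"
    by (simp add: lborel_distr_plus)
  then have "integrable lborel (\<lambda>t. f (- z + t))"
    using f by (subst (asm) integrable_distr_eq) simp_all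
  moreover have "(\<lambda>t. f (- z + t)) \<in> borel_measurable lborel"
    using f by (intro measurable_compose[OF _ f]) simp
  ultimately have "integrable lebesgue (\<lambda>t. f (- z + t))"
    by (simp add: integrable_completion)
  moreover have "f (- z + t) = indicator (cball z \<rho>) t * cmod (t - z) powr (\<alpha> - 2)" for t
    by (simp add: f_def indicator_def dist_norm norm_minus_commute)
  ultimately show ?thesis by simp
qed

lemma holder_space_0D:
  assumes "a \<in> holder_space 0 \<alpha>"
  shows "continuous_on UNIV a" "bounded (range a)" "holder_cond \<alpha> a"
  using assms by (auto simp: holder_space_def partial_def)

lemma holder_weak_kernel_integrable:
  assumes \<alpha>: "0 < \<alpha>" "\<alpha> < 2" and a: "continuous_on UNIV a" "holder_cond \<alpha> a"
    and v: "v \<in> Linf_space_R R"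
  shows "integrable lebesgue (\<lambda>t. (a t - a z) / (t - z)\<^sup>2 * v t)"
proof -
  obtain K where K: "\<And>z w. cmod (a z - a w) \<le> K * cmod (z - w) powr \<alpha>"
    using a(2) by (auto simp: holder_cond_def)
  obtain M where M: "AE t in lebesgue. cmod (v t) \<le> M"
    and supp: "AE t in lebesgue. t \<notin> cball 0 R \<longrightarrow> v t = 0"
    and v_meas: "v \<in> borel_measurable lebesgue"
    using v by (auto simp: Linf_space_R_def)
  have a_meas: "a \<in> borel_measurable lebesgue"
    using a(1) by (intro measurable_completion borel_measurable_continuous_onI)
       (simp add: borel_measurable_continuous_onI)
  have sq_meas: "(\<lambda>t. (t - z)\<^sup>2) \<in> borel_measurable lebesgue"
    by (intro measurable_completion) simp
  define \<rho> where "\<rho> = \<bar>R\<bar> + cmod z + 1"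
  have \<rho>: "0 < \<rho>" by (auto simp: \<rho>_def add_nonneg_pos)
  have "0 \<le> K" using K[of 0 1] by (metis dual_order.trans norm_ge_zero mult_1_right norm_minus_commute norm_one diff_zero powr_one_eq_one)
  show ?thesis
  proof (rule Bochner_Integration.integrable_bound)
    show "integrable lebesgue
        (\<lambda>t. K * M * (indicator (cball z \<rho>) t * cmod (t - z) powr (\<alpha> - 2)))"
      by (intro integrable_mult_right integrable_powr_cball \<alpha> \<rho>)
    show "AE t in lebesgue. norm ((a t - a z) / (t - z)\<^sup>2 * v t)
        \<le> norm (K * M * (indicator (cball z \<rho>) t * cmod (t - z) powr (\<alpha> - 2)))"
      using M supp
    proof eventually_elim
      case (elim t)
      show ?case
      proof (cases "t \<in> cball 0 R \<and> t \<noteq> z")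
        case True
        have "dist z t \<le> \<rho>"
          using True norm_triangle_ineq4[of z t] by (auto simp: \<rho>_def dist_norm)
        moreover have "cmod ((a t - a z) / (t - z)\<^sup>2 * v t)
            \<le> K * cmod (t - z) powr \<alpha> / (cmod (t - z))\<^sup>2 * M"
          unfolding norm_mult norm_divide norm_power using K[of t z] elim(1) \<open>0 \<le> K\<close>
          by (intro mult_mono divide_right_mono) auto
        moreover have "cmod (t - z) powr (\<alpha> - 2) = cmod (t - z) powr \<alpha> / (cmod (t - z))\<^sup>2"
          using True by (simp add: powr_diff)
        ultimately have "cmod ((a t - a z) / (t - z)\<^sup>2 * v t)
            \<le> K * cmod (t - z) powr (\<alpha> - 2) * M"
          and "indicator (cball z \<rho>) t = (1 :: real)"
          by auto
        then have "cmod ((a t - a z) / (t - z)\<^sup>2 * v t)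
            \<le> K * M * (indicator (cball z \<rho>) t * cmod (t - z) powr (\<alpha> - 2))"
          by (metis mult.assoc mult.commute mult_1)
        then show ?thesis unfolding real_norm_def by (rule order_trans[OF _ abs_ge_self])
      qed (use elim in auto)
    qed
  qed (intro borel_measurable_times borel_measurable_divide borel_measurable_diff
      borel_measurable_const a_meas sq_meas v_meas)
qed

lemma trunc_kernel_integrable:
  assumes "v \<in> Linf_space_R R" "0 < \<epsilon>"
  shows "set_integrable lebesgue {t \<in> UNIV. \<epsilon> < cmod (t - z)} (\<lambda>t. v t / (t - z)\<^sup>2)"
proof -
  obtain M where M: "AE t in lebesgue. cmod (v t) \<le> M"
    and supp: "AE t in lebesgue. t \<notin> cball 0 R \<longrightarrow> v t = 0"
    and v_meas: "v \<in> borel_measurable lebesgue"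
    using assms by (auto simp: Linf_space_R_def)
  have sq_meas: "(\<lambda>t. (t - z)\<^sup>2) \<in> borel_measurable lebesgue"
    by (intro measurable_completion) simp
  have E_meas: "{t \<in> UNIV. \<epsilon> < cmod (t - z)} \<in> sets lebesgue"
    by (intro sets_completionI_sets) measurable
  show ?thesis unfolding set_integrable_def
  proof (rule Bochner_Integration.integrable_bound)
    show "integrable lebesgue (\<lambda>t::complex. M / \<epsilon>\<^sup>2 * indicat_real (cball 0 R) t)"
      by (intro integrable_mult_right integrable_real_indicator)
         (use emeasure_lborel_cball_finite[of "0::complex" R] in auto)
    show "AE t in lebesgue. norm (indicat_real {t \<in> UNIV. \<epsilon> < cmod (t - z)} t *\<^sub>R (v t / (t - z)\<^sup>2))
      \<le> norm (M / \<epsilon>\<^sup>2 * indicat_real (cball 0 R) t)"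
      using M supp
    proof eventually_elim
      case (elim t)
      show ?case
      proof (cases "t \<in> cball 0 R \<and> \<epsilon> < cmod (t - z)")
        case True
        have "cmod (v t / (t - z)\<^sup>2) \<le> M / \<epsilon>\<^sup>2"
          unfolding norm_divide norm_power using True elim assms
          by (intro frac_le power_mono) (auto intro: order_trans[OF norm_ge_zero])
        also have "\<dots> \<le> \<bar>M\<bar> / \<epsilon>\<^sup>2" by (simp add: divide_right_mono)
        finally show ?thesis using True by simp
      qed (use elim in auto)
    qed
  qed (intro borel_measurable_scaleR borel_measurable_indicator borel_measurable_divide
      E_meas sq_meas v_meas)
qed

lemma trunc_integral_tendsto:
  fixes g :: "complex \<Rightarrow> complex"
  assumes g: "integrable lebesgue g" and gz: "g z = 0"
  shows "((\<lambda>\<epsilon>. LINT t:{t \<in> UNIV. \<epsilon> < cmod (t - z)}|lebesgue. g t) \<longlongrightarrow> (LINT t|lebesgue. g t)) (at_right 0)"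
proof (rule tendsto_at_right_sequentially[of 0 1])
  fix X :: "nat \<Rightarrow> real"
  assume X: "\<And>n. 0 < X n" "X \<longlonglongrightarrow> 0"
  note [measurable] = borel_measurable_integrable[OF g]
  have [measurable]: "{t. e < cmod (t - z)} \<in> sets lebesgue" for e
    by (intro sets_completionI_sets) measurable
  show "(\<lambda>n. LINT t:{t \<in> UNIV. X n < cmod (t - z)}|lebesgue. g t) \<longlonglongrightarrow> (LINT t|lebesgue. g t)"
    unfolding set_lebesgue_integral_def
  proof (rule integral_dominated_convergence[where w = "\<lambda>t. norm (g t)"])
    show "AE t in lebesgue. (\<lambda>n. indicat_real {t \<in> UNIV. X n < cmod (t - z)} t *\<^sub>R g t) \<longlonglongrightarrow> g t"
    proof (intro AE_I2)
      fix t
      show "(\<lambda>n. indicat_real {t \<in> UNIV. X n < cmod (t - z)} t *\<^sub>R g t) \<longlonglongrightarrow> g t"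
      proof (cases "t = z")
        case False
        then have "eventually (\<lambda>n. X n < cmod (t - z)) sequentially"
          by (intro order_tendstoD(2)[OF X(2)]) auto
        then show ?thesis
          by (intro tendsto_eventually) (auto elim!: eventually_mono)
      qed (simp add: gz)
    qed
  qed (use g in \<open>auto split: split_indicator\<close>)
qed simp

lemma annulus_integral_eq_0:
  fixes z :: complex
  shows "(LINT t|lebesgue. indicat_real {t. \<epsilon> < cmod (t - z) \<and> cmod (t - z) \<le> \<rho>} t *\<^sub>R (1 / (t - z)\<^sup>2)) = 0"
proof -
  have rot: "distr lborel borel (\<lambda>w. \<i> * w) = (lborel :: complex measure)"
  proof (rule lborel_eqI[symmetric])
    fix l u :: complex
    assume lu: "\<And>b. b \<in> Basis \<Longrightarrow> l \<bullet> b \<le> u \<bullet> b"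
    have eq: "(\<lambda>w. \<i> * w) -` box l u = box (Complex (Im l) (- Re u)) (Complex (Im u) (- Re l))"
      by (auto simp: box_def Basis_complex_def)
    have "emeasure (distr lborel borel (\<lambda>w. \<i> * w)) (box l u) =
        emeasure lborel (box (Complex (Im l) (- Re u)) (Complex (Im u) (- Re l)))"
      by (subst emeasure_distr) (auto simp: eq)
    also have "\<dots> = (\<Prod>b\<in>Basis. (u - l) \<bullet> b)"
      using lu[of 1] lu[of \<i>]
      by (subst emeasure_lborel_box) (auto simp: Basis_complex_def mult.commute)
    finally show "emeasure (distr lborel borel (\<lambda>w. \<i> * w)) (box l u) = (\<Prod>b\<in>Basis. (u - l) \<bullet> b)" .
  qed simp
  let ?h = "\<lambda>w::complex. indicat_real {w. \<epsilon> < cmod w \<and> cmod w \<le> \<rho>} w *\<^sub>R (1 / w\<^sup>2)"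
  have "(LINT w|lborel. ?h w) = (LINT w|distr lborel borel (\<lambda>w. \<i> * w). ?h w)"
    by (simp add: rot)
  also have "\<dots> = (LINT w|lborel. ?h (\<i> * w))"
    by (rule integral_distr) measurable
  also have "(\<lambda>w. ?h (\<i> * w)) = (\<lambda>w. - ?h w)"
    by (auto simp: norm_mult power_mult_distrib split: split_indicator)
  finally have 0: "(LINT w|lborel. ?h w) = 0" by simp
  have "(LINT t|lebesgue. indicat_real {t. \<epsilon> < cmod (t - z) \<and> cmod (t - z) \<le> \<rho>} t *\<^sub>R (1 / (t - z)\<^sup>2))
      = (LINT t|lborel. ?h (- z + t))"
    by (subst integral_completion) (auto simp: indicator_def)
  also have "\<dots> = (LINT t|distr lborel borel ((+) (- z)). ?h t)"
    by (rule integral_distr[symmetric]) measurable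
  finally show ?thesis by (simp add: lborel_distr_plus 0)
qed

lemma Linf_mult_holder:
  assumes a: "a \<in> holder_space 0 \<alpha>" and u: "u \<in> Linf_space_R R"
  shows "(\<lambda>t. a t * u t) \<in> Linf_space_R R"
proof -
  obtain M where M: "AE t in lebesgue. cmod (u t) \<le> M"
    and supp: "AE t in lebesgue. t \<notin> cball 0 R \<longrightarrow> u t = 0"
    and [measurable]: "u \<in> borel_measurable lebesgue"
    using u by (auto simp: Linf_space_R_def)
  obtain A where A: "\<And>t. cmod (a t) \<le> A"
    using holder_space_0D(2)[OF a] by (auto simp: bounded_iff)
  have [measurable]: "a \<in> borel_measurable lebesgue"
    using holder_space_0D(1)[OF a]
    by (intro measurable_completion) (simp add: borel_measurable_continuous_onI)
  have "AE t in lebesgue. cmod (a t * u t) \<le> A * M"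
    using M
    by eventually_elim
       (use A in \<open>auto simp: norm_mult intro!: mult_mono intro: order_trans[OF norm_ge_zero]\<close>)
  moreover have "AE t in lebesgue. t \<notin> cball 0 R \<longrightarrow> a t * u t = 0"
    using supp by eventually_elim auto
  ultimately show ?thesis by (auto simp: Linf_space_R_def)
qed

lemma holder_space_R_subset_Linf:
  assumes "u \<in> holder_space_R R 0 \<beta>"
  shows "u \<in> Linf_space_R R"
proof -
  have u: "u \<in> holder_space 0 \<beta>" and s: "closure {z. u z \<noteq> 0} \<subseteq> cball 0 R"
    using assms by (auto simp: holder_space_R_def)
  have "u \<in> borel_measurable lebesgue"
    using holder_space_0D(1)[OF u]
    by (intro measurable_completion) (simp add: borel_measurable_continuous_onI)
  moreover have "\<exists>C. AE z in lebesgue. cmod (u z) \<le> C"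
    using holder_space_0D(2)[OF u] by (auto simp: bounded_iff intro!: AE_I2)
  moreover have "AE z in lebesgue. z \<notin> cball 0 R \<longrightarrow> u z = 0"
    using s closure_subset[of "{z. u z \<noteq> 0}"] by (intro AE_I2) auto
  ultimately show ?thesis by (simp add: Linf_space_R_def)
qed

lemma CZ_commutator_integrable:
  assumes "0 < \<alpha>" "\<alpha> < 1" "a \<in> holder_space 0 \<alpha>" "u \<in> Linf_space_R R"
  shows "set_integrable lebesgue UNIV (\<lambda>t. (a t - a z) / (t - z)\<^sup>2 * u t)"
  using holder_weak_kernel_integrable[of \<alpha> a u R z] holder_space_0D[OF assms(3)] assms
  by (simp add: set_integrable_def)

lemma CZ_trunc_commutator_tendsto:
  assumes "0 < \<alpha>" "\<alpha> < 1" "a \<in> holder_space 0 \<alpha>" "u \<in> Linf_space_R R"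
  shows "((\<lambda>\<epsilon>. CZ_trunc UNIV (\<lambda>t. a t * u t) z \<epsilon> - a z * CZ_trunc UNIV u z \<epsilon>)
           \<longlongrightarrow> CZ_commutator UNIV a u z) (at_right 0)"
proof -
  let ?g = "\<lambda>t. (a t - a z) / (t - z)\<^sup>2 * u t"
  have "((\<lambda>\<epsilon>. - (1 / of_real pi) * (LINT t:{t \<in> UNIV. \<epsilon> < cmod (t - z)}|lebesgue. ?g t))
      \<longlongrightarrow> CZ_commutator UNIV a u z) (at_right 0)"
    unfolding CZ_commutator_def
    using trunc_integral_tendsto[of ?g z] CZ_commutator_integrable[OF assms, of z]
    by (intro tendsto_mult tendsto_const) (simp add: set_integrable_def set_lebesgue_integral_def)
  moreover have "\<forall>\<^sub>F \<epsilon> in at_right 0.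
      - (1 / of_real pi) * (LINT t:{t \<in> UNIV. \<epsilon> < cmod (t - z)}|lebesgue. ?g t)
      = CZ_trunc UNIV (\<lambda>t. a t * u t) z \<epsilon> - a z * CZ_trunc UNIV u z \<epsilon>"
    using eventually_at_right_less[of "0::real"]
  proof eventually_elim
    case (elim \<epsilon>)
    let ?E = "{t \<in> UNIV. \<epsilon> < cmod (t - z)}"
    have "(LINT t:?E|lebesgue. ?g t) =
       (LINT t:?E|lebesgue. (a t * u t) / (t - z)\<^sup>2 - a z * (u t / (t - z)\<^sup>2))"
      by (rule arg_cong[where f = "\<lambda>g. set_lebesgue_integral lebesgue ?E g"])
         (auto simp: diff_divide_distrib algebra_simps)
    also have "\<dots> = (LINT t:?E|lebesgue. (a t * u t) / (t - z)\<^sup>2)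
        - a z * (LINT t:?E|lebesgue. u t / (t - z)\<^sup>2)"
      using trunc_kernel_integrable[OF Linf_mult_holder[OF assms(3,4)] elim]
        trunc_kernel_integrable[OF assms(4) elim]
      by (subst set_integral_diff(2)) (auto simp del: times_divide_eq_right intro!: set_integrable_mult_right)
    finally show ?case by (simp only: CZ_trunc_def right_diff_distrib mult.left_commute)
  qed
  ultimately show ?thesis by (rule Lim_transform_eventually)
qed

theorem CZ_commutator_eq:
  assumes "0 < \<alpha>" "\<alpha> < 1" "a \<in> holder_space 0 \<alpha>" "u \<in> Linf_space_R R"
    and ex: "CZ_exists UNIV u z"
  shows "CZ_exists UNIV (\<lambda>t. a t * u t) z"
    and "CZ_commutator UNIV a u z = CZ UNIV (\<lambda>t. a t * u t) z - a z * CZ UNIV u z"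
proof -
  obtain l where l: "(CZ_trunc UNIV u z \<longlongrightarrow> l) (at_right 0)"
    using ex by (auto simp: CZ_exists_def)
  have lim: "(CZ_trunc UNIV (\<lambda>t. a t * u t) z \<longlongrightarrow> CZ_commutator UNIV a u z + a z * l) (at_right 0)"
    using tendsto_add[OF CZ_trunc_commutator_tendsto[OF assms(1-4), of z]
        tendsto_mult[OF tendsto_const[of "a z"] l]] by simp
  then show "CZ_exists UNIV (\<lambda>t. a t * u t) z" by (auto simp: CZ_exists_def)
  show "CZ_commutator UNIV a u z = CZ UNIV (\<lambda>t. a t * u t) z - a z * CZ UNIV u z"
    using tendsto_Lim[OF _ l] tendsto_Lim[OF _ lim] by (simp add: CZ_def)
qed

lemma CZ_exists_holder:
  assumes \<beta>: "0 < \<beta>" "\<beta> < 1" and u: "u \<in> holder_space_R R 0 \<beta>"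
  shows "CZ_exists UNIV u z"
proof -
  have uh: "u \<in> holder_space 0 \<beta>" and s: "{t. u t \<noteq> 0} \<subseteq> cball 0 R"
    using u closure_subset[of "{z. u z \<noteq> 0}"] by (auto simp: holder_space_R_def)
  define \<rho> where "\<rho> = \<bar>R\<bar> + cmod z + 1"
  have \<rho>: "0 < \<rho>" by (auto simp: \<rho>_def add_nonneg_pos)
  define v :: "complex \<Rightarrow> complex" where "v = indicator (cball z \<rho>)"
  have vL: "v \<in> Linf_space_R (\<rho> + cmod z)"
  proof -
    have "v \<in> borel_measurable lebesgue"
      unfolding v_def by (intro borel_measurable_indicator) auto
    moreover have "t \<notin> cball 0 (\<rho> + cmod z) \<longrightarrow> v t = 0" for t
      using norm_triangle_sub[of t z] by (auto simp: v_def indicator_def dist_norm norm_minus_commute)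
    ultimately show ?thesis
      unfolding Linf_space_R_def
      by (auto simp: v_def indicator_def intro!: exI[of _ 1])
  qed
  let ?g = "\<lambda>t. (u t - u z) / (t - z)\<^sup>2 * v t"
  have g: "integrable lebesgue ?g"
    using holder_weak_kernel_integrable[OF _ _ holder_space_0D(1,3)[OF uh] vL] \<beta> by auto
  have "((\<lambda>\<epsilon>. - (1 / of_real pi) * (LINT t:{t \<in> UNIV. \<epsilon> < cmod (t - z)}|lebesgue. ?g t))
      \<longlongrightarrow> - (1 / of_real pi) * (LINT t|lebesgue. ?g t)) (at_right 0)"
    by (intro tendsto_mult tendsto_const trunc_integral_tendsto g) simp
  moreover have "\<forall>\<^sub>F \<epsilon> in at_right 0.
      - (1 / of_real pi) * (LINT t:{t \<in> UNIV. \<epsilon> < cmod (t - z)}|lebesgue. ?g t) = CZ_trunc UNIV u z \<epsilon>"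
    using eventually_at_right_less[of "0::real"]
  proof eventually_elim
    case (elim \<epsilon>)
    let ?E = "{t \<in> UNIV. \<epsilon> < cmod (t - z)}"
    have uv: "u t * v t = u t" for t
    proof (cases "u t = 0")
      case False
      then have "cmod t \<le> R" using s by auto
      then have "dist z t \<le> \<rho>" using norm_triangle_ineq4[of z t] by (auto simp: \<rho>_def dist_norm)
      then show ?thesis by (simp add: v_def)
    qed simp
    have "(u t - u z) / (t - z)\<^sup>2 * v t = u t / (t - z)\<^sup>2 - u z * (v t / (t - z)\<^sup>2)" for t
      using uv[of t] by (simp add: diff_divide_distrib left_diff_distrib)
    then have "(LINT t:?E|lebesgue. ?g t) =
       (LINT t:?E|lebesgue. u t / (t - z)\<^sup>2 - u z * (v t / (t - z)\<^sup>2))" by simp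
    also have "\<dots> = (LINT t:?E|lebesgue. u t / (t - z)\<^sup>2)
        - u z * (LINT t:?E|lebesgue. v t / (t - z)\<^sup>2)"
      using trunc_kernel_integrable[OF holder_space_R_subset_Linf[OF u] elim]
        trunc_kernel_integrable[OF vL elim]
      by (subst set_integral_diff(2)) (auto simp del: times_divide_eq_right intro!: set_integrable_mult_right)
    also have "(LINT t:?E|lebesgue. v t / (t - z)\<^sup>2) = 0"
    proof -
      have "(\<lambda>t. indicat_real ?E t *\<^sub>R (v t / (t - z)\<^sup>2)) =
        (\<lambda>t. indicat_real {t. \<epsilon> < cmod (t - z) \<and> cmod (t - z) \<le> \<rho>} t *\<^sub>R (1 / (t - z)\<^sup>2))"
        by (auto simp: v_def indicator_def dist_norm norm_minus_commute)
      then show ?thesis using annulus_integral_eq_0 by (simp add: set_lebesgue_integral_def)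
    qed
    finally show ?case by (simp add: CZ_trunc_def)
  qed
  ultimately have "(CZ_trunc UNIV u z \<longlongrightarrow> - (1 / of_real pi) * (LINT t|lebesgue. ?g t)) (at_right 0)"
    by (rule Lim_transform_eventually)
  then show ?thesis by (auto simp: CZ_exists_def)
qed

theorem CZ_commutator_eq_holder:
  assumes "0 < \<alpha>" "\<alpha> < 1" "a \<in> holder_space 0 \<alpha>" "0 < \<beta>" "\<beta> < 1" "u \<in> holder_space_R R 0 \<beta>"
  shows "CZ_commutator UNIV a u = (\<lambda>z. CZ UNIV (\<lambda>t. a t * u t) z - a z * CZ UNIV u z)"
  using CZ_commutator_eq(2)[OF assms(1-3) holder_space_R_subset_Linf[OF assms(6)]
      CZ_exists_holder[OF assms(4-6)]] by blast

end

theory Submission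
  imports Defs
begin

text \<open>
  Put $k(z,t) = (a(t)-a(z))/(t-z)^2$, so that $-\pi\,[S,a]u(z) = \int k(z,t)u(t)\,dt$ with Lebesgue
  measure $dt$, and let $\delta = |z-w|$.

  Part (i). For $|t-w| \le 2\delta$ both kernels are $O(|t-z|^{\alpha-2} + |t-w|^{\alpha-2})$, which
  integrates to $O(\delta^\alpha)$. For $|t-w| > 2\delta$ the difference $k(z,t)-k(w,t)$ equals
  $(a(w)-a(z))/(t-w)^2$ up to $O(\delta|t-w|^{\alpha-3})$, and the remainder again integrates to
  $O(\delta^\alpha)$. The main term is the only obstacle to the exponent $\alpha$. For bounded $u$ it
  costs a logarithm, which $\beta < \alpha$ absorbs (\<open>comm_int_holder_of_bounded\<close>). For Hoelder
  continuous $u$ it is $a(w)-a(z)$ times a truncated singular integral of $u$, which is bounded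
  because $(t-w)^{-2}$ has mean zero over annuli (\<open>comm_int_holder_of_holder\<close>).

  Part (ii). The substitution $t = z+s$ makes the commutator a convolution-like integral whose
  integrand depends on $z$ only through $a$ and $u$. This gives the product rule
  $D[S,a]u = [S,a]Du + [S,Da]u$ for continuously differentiable $u$
  (\<open>comm_int_has_derivative_translation\<close>), and with it an induction on $k$.

  What remains is $k = 0$, where $u$ cannot be differentiated. The $z$-derivative $K(z,t)$ of the
  kernel has size $|t-z|^{-2}$, so it can be integrated against functions that are
  $O(|t-z|^\alpha)$ (\<open>comm_int_has_derivative_vanishing\<close>). With a cut-off $\kappa$ that is $1$ around
  the support of $u$,
  \[ D\Big(\int k(\cdot,t)u(t)\,dt\Big)(z) = \int K(z,t)\,(u(t)-u(z)\kappa(t))\,dt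
      + u(z)\,D\Big(\int k(\cdot,t)\kappa(t)\,dt\Big)(z), \]
  and the product rule and part (i) apply to the last derivative. In the Hoelder estimate of the
  first integral the far zone leaves $u(w)-u(z)$ times a truncated integral of $K(w,\cdot)\kappa$,
  which has to be bounded independently of $\delta$. The truncation is made by another cut-off $\eta$
  of radius $\delta$ about $w$. Since $\kappa-\eta$ vanishes at $w$, the derivative of
  $\int k(\cdot,t)(\kappa-\eta)(t)\,dt$ at $w$ can be computed both as $\int K(w,t)(\kappa-\eta)(t)\,dt$
  and by the product rule, and the second expression is bounded uniformly in $\delta \le 1$
  (\<open>cutoff_product_rule_bounded\<close>).
\<close>

section \<open>Integrals of the weights\<close>

lemma nn_integral_affine:
  fixes f :: "complex \<Rightarrow> real"
  assumes f: "f \<in> borel_measurable borel" and d: "0 < \<delta>"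
  shows "(\<integral>\<^sup>+ t. ennreal (f t) \<partial>lborel) = ennreal (\<delta>\<^sup>2) * (\<integral>\<^sup>+ s. ennreal (f (z + \<delta> *\<^sub>R s)) \<partial>lborel)"
proof -
  have [measurable]: "(\<lambda>x. ennreal (f x)) \<in> borel_measurable borel" using f by measurable
  have "(\<integral>\<^sup>+ t. ennreal (f t) \<partial>lborel) =
     (\<integral>\<^sup>+ t. ennreal (f t) \<partial>density (distr lborel borel (\<lambda>x. z + \<delta> *\<^sub>R x)) (\<lambda>_. \<bar>\<delta>\<bar>^DIM(complex)))"
    using lborel_affine[of \<delta> z] d by simp
  also have "\<dots> = ennreal (\<delta>\<^sup>2) * (\<integral>\<^sup>+ s. ennreal (f (z + \<delta> *\<^sub>R s)) \<partial>lborel)"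
    using d by (simp add: nn_integral_density nn_integral_distr nn_integral_cmult)
  finally show ?thesis .
qed

text \<open>
  One weight serves the near and the far zone: it is $|s|^{\alpha-2}$ for $|s| \le \delta$ and
  $\delta|s|^{\alpha-3}$ beyond. Both branches are homogeneous of the same joint degree in $s$ and
  $\delta$, so the integral is a multiple of $\delta^\alpha$.
\<close>

definition weight :: "real \<Rightarrow> real \<Rightarrow> complex \<Rightarrow> real" where
  "weight \<alpha> \<delta> s = cmod s powr (\<alpha> - 2) * min 1 (\<delta> / cmod s)"

lemma weight_borel [measurable]: "weight \<alpha> \<delta> \<in> borel_measurable borel"
  unfolding weight_def by measurable

lemma weight_nonneg: "0 \<le> \<delta> \<Longrightarrow> 0 \<le> weight \<alpha> \<delta> s"
  by (simp add: weight_def)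

text \<open>
  Near the origin the weight is $|s|^{\alpha-2}$. On the shells $2^n \le |s| < 2^{n+1}$ it is at most
  $2^{n(\alpha-3)}$, and the areas of the shells grow like $4^n$, which leaves a geometric series of
  ratio $2^{\alpha-1} < 1$.
\<close>

lemma weight_finite:
  fixes \<alpha> :: real
  assumes \<alpha>: "0 < \<alpha>" "\<alpha> < 1"
  shows "(\<integral>\<^sup>+ s. ennreal (weight \<alpha> 1 s) \<partial>lborel) < \<infinity>"
proof -
  define c :: "nat \<Rightarrow> real" where "c n = (2 ^ n) powr (\<alpha> - 3)" for n
  define q where "q = 2 powr (\<alpha> - 1)"
  have q: "0 < q" "q < 1" using \<alpha> by (auto simp: q_def powr_less_one)
  have cm: "ennreal (c n) * emeasure lborel (cball (0::complex) (2 ^ Suc n)) = ennreal (4 * pi * q ^ n)" for n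
  proof -
    have "emeasure lborel (cball (0::complex) (2 ^ Suc n)) = ennreal (pi * (2 ^ Suc n)\<^sup>2)"
      using emeasure_cball[of "2 ^ Suc n" "0::complex"]
      by (simp add: unit_ball_vol_2[simplified])
    moreover have "c n * (pi * (2 ^ Suc n)\<^sup>2) = 4 * pi * q ^ n"
    proof -
      have 2: "(2 ^ n :: real) = 2 powr (real n)" by (simp add: powr_realpow)
      have "c n = 2 powr (n * (\<alpha> - 3))" by (simp add: c_def 2 powr_powr)
      moreover have "q ^ n = 2 powr (n * (\<alpha> - 1))"
        by (simp add: q_def powr_powr mult.commute flip: powr_realpow)
      moreover have "(2 ^ n :: real)\<^sup>2 = 2 powr (2 * n)"
        unfolding 2 by (simp add: power2_eq_square flip: powr_add)
      moreover have "2 powr (n * (\<alpha> - 3)) * 2 powr (2 * n) = 2 powr (n * (\<alpha> - 1))"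
        by (simp add: algebra_simps flip: powr_add)
      ultimately show ?thesis by (simp add: power_mult_distrib)
    qed
    moreover have "ennreal (c n * (pi * (2 ^ Suc n)\<^sup>2))
        = ennreal (c n) * ennreal (pi * (2 ^ Suc n)\<^sup>2)"
      by (rule ennreal_mult) (auto simp: c_def)
    ultimately show ?thesis by metis
  qed
  let ?F = "\<lambda>s::complex. ennreal (indicator (cball 0 1) s * cmod s powr (\<alpha> - 2))"
  let ?G = "\<lambda>s::complex. \<Sum>n. ennreal (c n) * indicator (cball 0 (2 ^ Suc n)) s"
  have "(\<integral>\<^sup>+ s. ennreal (weight \<alpha> 1 s) \<partial>lborel) \<le> (\<integral>\<^sup>+ s. ?F s + ?G s \<partial>lborel)"
  proof (rule nn_integral_mono)
    fix w :: complex
    show "ennreal (weight \<alpha> 1 w) \<le> ?F w + ?G w"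
    proof (cases "cmod w \<le> 1")
      case True
      then have "weight \<alpha> 1 w \<le> indicator (cball 0 1) w * cmod w powr (\<alpha> - 2)"
        by (auto simp: weight_def mult_left_le)
      then show ?thesis by (auto intro: order_trans[OF ennreal_leI] simp: add_increasing2)
    next
      case False
      have "\<exists>n. cmod w < 2 ^ n" by (rule real_arch_pow) simp
      define m where "m = (LEAST n. cmod w < 2 ^ n)"
      have m: "cmod w < 2 ^ m" unfolding m_def using \<open>\<exists>n. cmod w < 2 ^ n\<close> by (rule LeastI_ex)
      have "m \<noteq> 0" using m False by (intro notI) auto
      then obtain n where n: "m = Suc n" by (cases m) auto
      have l: "2 ^ n \<le> cmod w" using not_less_Least[of n "\<lambda>n. cmod w < 2 ^ n"] n
        by (auto simp: m_def)
      have "weight \<alpha> 1 w = cmod w powr (\<alpha> - 3)"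
        using False by (auto simp: weight_def min_def divide_simps powr_diff power3_eq_cube power2_eq_square)
      also have "\<dots> \<le> c n"
        unfolding c_def using l \<alpha> by (intro powr_mono2') auto
      finally have "ennreal (weight \<alpha> 1 w) \<le> ennreal (c n) * indicator (cball 0 (2 ^ Suc n)) w"
        using m n by (auto intro: ennreal_leI)
      also have "\<dots> = (\<Sum>i\<in>{n}. ennreal (c i) * indicator (cball 0 (2 ^ Suc i)) w)"
        by (simp del: indicator_simps sum_mult_indicator add: sum.insert)
      also have "\<dots> \<le> ?G w"
        by (rule sum_le_suminf) auto
      finally show ?thesis by (simp add: add_increasing)
    qed
  qed
  also have "\<dots> = (\<integral>\<^sup>+ s. ?F s \<partial>lborel) + (\<integral>\<^sup>+ s. ?G s \<partial>lborel)"
  proof (rule nn_integral_add)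
    show "?F \<in> borel_measurable lborel"
      by (intro measurable_compose[OF _ measurable_ennreal] borel_measurable_times borel_measurable_indicator
        powr_real_measurable) auto
    show "?G \<in> borel_measurable lborel"
      by (intro borel_measurable_suminf_order borel_measurable_times_ennreal borel_measurable_indicator) auto
  qed
  also have "(\<integral>\<^sup>+ s. ?G s \<partial>lborel) = (\<Sum>n. \<integral>\<^sup>+ w. ennreal (c n) * indicator (cball 0 (2 ^ Suc n)) w \<partial>(lborel :: complex measure))"
    by (rule nn_integral_suminf) (auto intro!: borel_measurable_times_ennreal borel_measurable_indicator)
  also have "\<dots> = (\<Sum>n. ennreal (4 * pi * q ^ n))"
  proof (rule arg_cong[where f = suminf], rule ext)
    fix n
    have "cball (0::complex) (2 ^ Suc n) \<in> sets lborel" by simp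
    from nn_integral_cmult_indicator[OF this, of "ennreal (c n)"] cm[of n]
    show "(\<integral>\<^sup>+ w. ennreal (c n) * indicator (cball 0 (2 ^ Suc n)) w \<partial>(lborel :: complex measure))
        = ennreal (4 * pi * q ^ n)" by (rule trans)
  qed
  finally have le: "(\<integral>\<^sup>+ s. ennreal (weight \<alpha> 1 s) \<partial>lborel) \<le>
      (\<integral>\<^sup>+ s. ?F s \<partial>lborel) + (\<Sum>n. ennreal (4 * pi * q ^ n))" .
  have "(\<integral>\<^sup>+ s. ?F s \<partial>lborel) < \<infinity>"
    using nn_integral_powr_cball_finite[of \<alpha> 1] \<alpha> by (simp add: nn_integral_completion)
  moreover have "(\<Sum>n. ennreal (4 * pi * q ^ n)) < \<infinity>"
    using q by (subst suminf_ennreal_eq[OF _ sums_mult[OF geometric_sums]]) auto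
  ultimately show ?thesis using le by (auto simp: less_top[symmetric] top_unique)
qed

lemma weight_scale:
  assumes "0 < \<delta>"
  shows "weight \<alpha> \<delta> (\<delta> *\<^sub>R s) = \<delta> powr (\<alpha> - 2) * weight \<alpha> 1 s"
  using assms by (simp add: weight_def powr_mult)

lemma weight_integral:
  assumes \<alpha>: "0 < \<alpha>" "\<alpha> < 1"
  obtains C where "0 < C"
    "\<And>\<delta> z. 0 < \<delta> \<Longrightarrow> integrable lebesgue (\<lambda>t. weight \<alpha> \<delta> (t - z))"
    "\<And>\<delta> z. 0 < \<delta> \<Longrightarrow> (LINT t|lebesgue. weight \<alpha> \<delta> (t - z)) \<le> C * \<delta> powr \<alpha>"
proof -
  define N where "N = enn2real (\<integral>\<^sup>+ s. ennreal (weight \<alpha> 1 s) \<partial>lborel)"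
  have N: "(\<integral>\<^sup>+ s. ennreal (weight \<alpha> 1 s) \<partial>lborel) = ennreal N"
    using weight_finite[OF \<alpha>] by (simp add: N_def)
  have N0: "0 \<le> N" by (simp add: N_def)
  have nn: "(\<integral>\<^sup>+ t. ennreal (weight \<alpha> \<delta> (t - z)) \<partial>lebesgue) = ennreal (\<delta> powr \<alpha> * N)" if d: "0 < \<delta>" for \<delta> z
  proof -
    have "(\<integral>\<^sup>+ t. ennreal (weight \<alpha> \<delta> (t - z)) \<partial>lebesgue) = (\<integral>\<^sup>+ t. ennreal (weight \<alpha> \<delta> (t - z)) \<partial>lborel)"
      by (simp add: nn_integral_completion)
    also have "\<dots> = ennreal (\<delta>\<^sup>2) * (\<integral>\<^sup>+ s. ennreal (weight \<alpha> \<delta> (\<delta> *\<^sub>R s)) \<partial>lborel)"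
      using d by (subst nn_integral_affine[of _ \<delta> z]) auto
    also have "\<dots> = ennreal (\<delta>\<^sup>2) * (ennreal (\<delta> powr (\<alpha> - 2)) * ennreal N)"
      using d by (simp only: weight_scale ennreal_mult[OF powr_ge_zero weight_nonneg[OF zero_le_one]])
        (subst nn_integral_cmult, auto simp: N)
    also have "\<dots> = ennreal (\<delta> powr \<alpha> * N)"
      using d N0 by (simp add: powr_diff flip: ennreal_mult)
    finally show ?thesis .
  qed
  have I: "integrable lebesgue (\<lambda>t. weight \<alpha> \<delta> (t - z))" if d: "0 < \<delta>" for \<delta> z
    using d nn[OF d, of z] by (intro integrableI_nonneg) (auto simp: weight_nonneg measurable_completion)
  have B: "(LINT t|lebesgue. weight \<alpha> \<delta> (t - z)) \<le> (N + 1) * \<delta> powr \<alpha>" if d: "0 < \<delta>" for \<delta> z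
  proof -
    have "(LINT t|lebesgue. weight \<alpha> \<delta> (t - z)) = \<delta> powr \<alpha> * N"
      using d N0 nn[OF d, of z]
      by (subst integral_eq_nn_integral) (auto simp: weight_nonneg measurable_completion)
    then show ?thesis by (simp add: algebra_simps)
  qed
  show ?thesis by (rule that[of "N + 1"]) (use I B N0 in auto)
qed

text \<open>
  The bound is uniform in $z$ because the singularity contributes at most its integral over a unit
  disc, wherever that disc lies, and the rest at most the area of the ball.
\<close>

lemma ball_weight_integral:
  assumes \<gamma>: "0 < \<gamma>" "\<gamma> < 1"
  obtains C where "0 < C"
    "\<And>z. integrable lebesgue (\<lambda>t. indicator (cball 0 \<rho>) t * cmod (t - z) powr (\<gamma> - 2))"
    "\<And>z. (LINT t|lebesgue. indicator (cball 0 \<rho>) t * cmod (t - z) powr (\<gamma> - 2)) \<le> C"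
proof -
  obtain C where C: "0 < C" "\<And>\<delta> z. 0 < \<delta> \<Longrightarrow> integrable lebesgue (\<lambda>t. weight \<gamma> \<delta> (t - z))"
    "\<And>\<delta> z. 0 < \<delta> \<Longrightarrow> (LINT t|lebesgue. weight \<gamma> \<delta> (t - z)) \<le> C * \<delta> powr \<gamma>"
    using weight_integral[OF \<gamma>] by metis
  let ?f = "\<lambda>z t. indicator (cball 0 \<rho>) t * cmod (t - z) powr (\<gamma> - 2) :: real"
  let ?i = "indicat_real (cball (0::complex) \<rho>)"
  have i: "integrable lebesgue ?i"
    by (intro integrable_real_indicator) (use emeasure_lborel_cball_finite[of "0::complex" \<rho>] in auto)
  have le: "?f z t \<le> weight \<gamma> 1 (t - z) + ?i t" for z t
  proof (cases "cmod (t - z) \<le> 1")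
    case True
    then have "t \<noteq> z \<Longrightarrow> min 1 (1 / cmod (t - z)) = 1" by auto
    then have "?f z t \<le> weight \<gamma> 1 (t - z)" by (cases "t = z") (auto simp: weight_def indicator_def)
    then show ?thesis by (simp add: add_increasing2)
  next
    case False
    then have "cmod (t - z) powr (\<gamma> - 2) \<le> 1 powr (\<gamma> - 2)"
      using \<gamma> by (intro powr_mono2') auto
    then have "?f z t \<le> ?i t" by (auto simp: indicator_def)
    then show ?thesis by (simp add: add_increasing weight_nonneg)
  qed
  have I0: "integrable lebesgue (\<lambda>t. weight \<gamma> 1 (t - z) + ?i t)" for z
    using C(2)[of 1 z] i by simp
  have I: "integrable lebesgue (?f z)" for z
  proof (rule Bochner_Integration.integrable_bound[OF I0[of z]])
    have "(\<lambda>t. cmod (t - z) powr (\<gamma> - 2)) \<in> borel_measurable lebesgue"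
      by (intro measurable_completion) simp
    then show "?f z \<in> borel_measurable lebesgue" by (intro borel_measurable_times borel_measurable_indicator) auto
    show "AE t in lebesgue. norm (?f z t) \<le> norm (weight \<gamma> 1 (t - z) + ?i t)"
      using le[of _ z] by (intro AE_I2) (auto simp: abs_mult weight_nonneg intro: order_trans)
  qed
  have "(LINT t|lebesgue. ?f z t) \<le> C + (LINT t|lebesgue. ?i t)" for z
  proof -
    have "(LINT t|lebesgue. ?f z t) \<le> (LINT t|lebesgue. weight \<gamma> 1 (t - z) + ?i t)"
      by (rule integral_mono[OF I I0 le])
    also have "\<dots> = (LINT t|lebesgue. weight \<gamma> 1 (t - z)) + (LINT t|lebesgue. ?i t)"
      using C(2)[of 1 z] i by (intro Bochner_Integration.integral_add) auto
    finally show ?thesis using C(3)[of 1 z] by simp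
  qed
  moreover have "0 \<le> (LINT t|lebesgue. ?i t)" by (intro Bochner_Integration.integral_nonneg) simp
  ultimately show ?thesis using I C(1) by (intro that[of "C + (LINT t|lebesgue. ?i t)"] add_pos_nonneg) auto
qed

lemma integral_bounded_by:
  fixes f :: "'a \<Rightarrow> complex"
  assumes "f \<in> borel_measurable M" "integrable M w" "AE t in M. norm (f t) \<le> w t"
  shows "integrable M f" "norm (LINT t|M. f t) \<le> (LINT t|M. w t)"
proof -
  show I: "integrable M f"
    using assms(3) by (intro Bochner_Integration.integrable_bound[OF assms(2,1)]) (auto elim!: eventually_mono)
  show "norm (LINT t|M. f t) \<le> (LINT t|M. w t)"
    using integral_norm_bound[of M f] integral_mono_AE[OF integrable_norm[OF I] assms(2,3)] by linarith
qed

section \<open>Pointwise estimates for the commutator kernel\<close>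

definition holder_with :: "real \<Rightarrow> real \<Rightarrow> (complex \<Rightarrow> complex) \<Rightarrow> bool" where
  "holder_with \<alpha> A f \<longleftrightarrow> (\<forall>z w. cmod (f z - f w) \<le> A * cmod (z - w) powr \<alpha>)"

lemma holder_withD: "holder_with \<alpha> A f \<Longrightarrow> cmod (f z - f w) \<le> A * cmod (z - w) powr \<alpha>"
  by (simp add: holder_with_def)

lemma holder_with_nonneg: "holder_with \<alpha> A f \<Longrightarrow> 0 \<le> A"
  using holder_withD[of \<alpha> A f 1 0] order_trans[OF norm_ge_zero] by fastforce

lemma powr_times_power:
  fixes y :: complex
  assumes "y \<noteq> 0"
  shows "cmod y powr (a - real n) = cmod y powr a / cmod y ^ n"
  using assms by (simp add: powr_diff powr_realpow)

lemma powr_le_multiple: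
  fixes x y :: real
  assumes "x \<le> c * y" "0 \<le> x" "0 \<le> y" "1 \<le> c" "0 < \<gamma>" "\<gamma> < 1"
  shows "x powr \<gamma> \<le> c * y powr \<gamma>"
proof -
  have "x powr \<gamma> \<le> (c * y) powr \<gamma>" using assms by (intro powr_mono2) auto
  also have "\<dots> \<le> c * y powr \<gamma>"
    using assms powr_mono[of \<gamma> 1 c] by (simp add: powr_mult mult_right_mono)
  finally show ?thesis .
qed

lemma far_norm_bounds:
  fixes x y :: complex
  assumes "2 * cmod (x - y) \<le> cmod y"
  shows "cmod y \<le> 2 * cmod x" "cmod x \<le> 3 / 2 * cmod y"
  using assms norm_triangle_ineq4[of x "x - y"] norm_triangle_ineq[of y "x - y"] by auto

lemma inverse_square_diff:
  fixes x y :: complex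
  assumes y: "y \<noteq> 0" and d: "2 * cmod (x - y) \<le> cmod y"
  shows "cmod (1 / x\<^sup>2 - 1 / y\<^sup>2) \<le> 10 * cmod (x - y) / cmod y ^ 3"
proof -
  note xy = far_norm_bounds[OF d]
  have x: "x \<noteq> 0" using xy y by auto
  have p: "0 < cmod y" "0 < cmod x" using x y by auto
  have "1 / x\<^sup>2 - 1 / y\<^sup>2 = (y - x) * (y + x) / (x\<^sup>2 * y\<^sup>2)"
    using x y by (simp add: field_simps power2_eq_square)
  then have "cmod (1 / x\<^sup>2 - 1 / y\<^sup>2) = cmod (x - y) * cmod (y + x) / ((cmod x)\<^sup>2 * (cmod y)\<^sup>2)"
    by (simp add: norm_mult norm_divide norm_power norm_minus_commute)
  also have "\<dots> \<le> cmod (x - y) * (5 / 2 * cmod y) / ((cmod y / 2)\<^sup>2 * (cmod y)\<^sup>2)"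
    using xy p norm_triangle_ineq[of y x]
    by (intro frac_le mult_left_mono mult_right_mono power_mono) auto
  also have "\<dots> = 10 * cmod (x - y) / cmod y ^ 3"
    using p by (simp add: field_simps power2_eq_square power3_eq_cube)
  finally show ?thesis .
qed

lemma inverse_cube_diff:
  fixes x y :: complex
  assumes y: "y \<noteq> 0" and d: "2 * cmod (x - y) \<le> cmod y"
  shows "cmod (1 / x ^ 3 - 1 / y ^ 3) \<le> 38 * cmod (x - y) / cmod y ^ 4"
proof -
  note xy = far_norm_bounds[OF d]
  have x: "x \<noteq> 0" using xy y by auto
  have p: "0 < cmod y" "0 < cmod x" using x y by auto
  have "1 / x ^ 3 - 1 / y ^ 3 = (y - x) * (y * y + y * x + x * x) / (x ^ 3 * y ^ 3)"
    using x y by (simp add: field_simps power3_eq_cube)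
  then have "cmod (1 / x ^ 3 - 1 / y ^ 3) =
      cmod (x - y) * cmod (y * y + y * x + x * x) / (cmod x ^ 3 * cmod y ^ 3)"
    by (simp add: norm_mult norm_divide norm_power norm_minus_commute)
  also have "\<dots> \<le> cmod (x - y) * (19 / 4 * (cmod y)\<^sup>2) / ((cmod y / 2) ^ 3 * cmod y ^ 3)"
  proof (intro frac_le mult_left_mono mult_right_mono power_mono)
    have "cmod (y * y + y * x + x * x) \<le> cmod y * cmod y + cmod y * cmod x + cmod x * cmod x"
      unfolding norm_mult[symmetric] by (meson norm_triangle_ineq norm_triangle_mono order_refl)
    also have "\<dots> \<le> cmod y * cmod y + cmod y * (3 / 2 * cmod y) + (3 / 2 * cmod y) * (3 / 2 * cmod y)"
      using xy p by (intro add_mono mult_mono) auto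
    finally show "cmod (y * y + y * x + x * x) \<le> 19 / 4 * (cmod y)\<^sup>2"
      by (simp add: power2_eq_square)
  qed (use xy p in auto)
  also have "\<dots> = 38 * cmod (x - y) / cmod y ^ 4"
    using p by (simp add: field_simps power2_eq_square power3_eq_cube power4_eq_xxxx)
  finally show ?thesis .
qed

text \<open>
  The factor $c$ lets the near zone of one of the points $z$, $w$ be used for the other one, at a
  comparable radius.
\<close>

lemma powr_le_near:
  assumes "cmod y \<le> c * \<delta>" "1 \<le> c"
  shows "cmod y powr (\<alpha> - 2) \<le> c * weight \<alpha> \<delta> y"
proof (cases "y = 0")
  case False
  have "1 \<le> c * min 1 (\<delta> / cmod y)"
    using assms False by (simp add: min_def field_simps)
  then have "cmod y powr (\<alpha> - 2) * 1 \<le> cmod y powr (\<alpha> - 2) * (c * min 1 (\<delta> / cmod y))"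
    by (intro mult_left_mono) auto
  then show ?thesis by (simp add: weight_def mult_ac)
qed (simp add: weight_def)

lemma weight_far:
  assumes "\<delta> \<le> cmod y" "y \<noteq> 0"
  shows "weight \<alpha> \<delta> y = \<delta> * cmod y powr \<alpha> / cmod y ^ 3"
proof -
  have "min 1 (\<delta> / cmod y) = \<delta> / cmod y" using assms by (simp add: min_def field_simps)
  then show ?thesis
    using assms powr_times_power[of y \<alpha> 2] by (simp add: weight_def power2_eq_square power3_eq_cube)
qed

lemma commutator_kernel_bound:
  assumes "holder_with \<alpha> A a"
  shows "cmod ((a t - a z) / (t - z)\<^sup>2) \<le> A * cmod (t - z) powr (\<alpha> - 2)"
proof (cases "t = z")
  case False
  then show ?thesis
    using powr_times_power[of "t - z" \<alpha> 2] holder_withD[OF assms, of t z]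
    by (simp add: norm_divide norm_power divide_right_mono)
qed (use assms in simp)

text \<open>
  Subtracting the main term turns the difference of the kernels into
  $(a(t)-a(z))\,((t-z)^{-2} - (t-w)^{-2})$, where the first factor is $O(|t-w|^\alpha)$ and the second
  $O(\delta|t-w|^{-3})$.
\<close>

lemma commutator_kernel_far:
  assumes a: "holder_with \<alpha> A a" and \<alpha>: "0 < \<alpha>" "\<alpha> < 1" and t: "2 * cmod (z - w) < cmod (t - w)"
  shows "cmod ((a t - a z) / (t - z)\<^sup>2 - (a t - a w) / (t - w)\<^sup>2 - (a w - a z) / (t - w)\<^sup>2)
    \<le> 20 * A * weight \<alpha> (cmod (z - w)) (t - w)"
proof -
  let ?x = "t - z" and ?y = "t - w"
  have xy: "cmod (?x - ?y) = cmod (z - w)" by (simp add: norm_minus_commute)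
  have y: "?y \<noteq> 0" and d: "2 * cmod (?x - ?y) \<le> cmod ?y" using t xy by (auto simp: not_le[symmetric])
  have A: "0 \<le> A" by (rule holder_with_nonneg[OF a])
  have "cmod ?x \<le> 2 * cmod ?y"
    using far_norm_bounds(2)[OF d] norm_ge_zero[of ?y] by linarith
  then have x\<alpha>: "cmod ?x powr \<alpha> \<le> 2 * cmod ?y powr \<alpha>"
    using \<alpha> by (intro powr_le_multiple) auto
  have "cmod (a t - a z) \<le> A * (2 * cmod ?y powr \<alpha>)"
    using holder_withD[OF a, of t z] mult_left_mono[OF x\<alpha> A] by linarith
  then have "cmod ((a t - a z) * (1 / ?x\<^sup>2 - 1 / ?y\<^sup>2)) \<le>
      (A * (2 * cmod ?y powr \<alpha>)) * (10 * cmod (?x - ?y) / cmod ?y ^ 3)"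
    unfolding norm_mult using inverse_square_diff[OF y d] A by (intro mult_mono) auto
  also have "\<dots> = 20 * A * weight \<alpha> (cmod (z - w)) ?y"
    using t y norm_ge_zero[of "z - w"] unfolding xy by (subst weight_far) (auto simp: algebra_simps simp del: norm_ge_zero)
  also have "(a t - a z) * (1 / ?x\<^sup>2 - 1 / ?y\<^sup>2) =
      (a t - a z) / (t - z)\<^sup>2 - (a t - a w) / (t - w)\<^sup>2 - (a w - a z) / (t - w)\<^sup>2"
    by (simp add: algebra_simps diff_divide_distrib)
  finally show ?thesis .
qed

lemma near_bounds:
  assumes "\<not> 2 * cmod (z - w) < cmod (t - w)"
  shows "cmod (t - w) \<le> 2 * cmod (z - w)" "cmod (t - z) \<le> 3 * cmod (z - w)"
  using assms norm_triangle_ineq4[of "t - w" "z - w"] by auto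

lemma commutator_kernel_diff:
  assumes a: "holder_with \<alpha> A a" and \<alpha>: "0 < \<alpha>" "\<alpha> < 1"
  shows "cmod ((a t - a z) / (t - z)\<^sup>2 - (a t - a w) / (t - w)\<^sup>2
      - indicat_real {t. 2 * cmod (z - w) < cmod (t - w)} t *\<^sub>R ((a w - a z) / (t - w)\<^sup>2))
    \<le> 20 * A * (weight \<alpha> (cmod (z - w)) (t - z) + weight \<alpha> (cmod (z - w)) (t - w))"
proof (cases "2 * cmod (z - w) < cmod (t - w)")
  case True
  have "20 * A * weight \<alpha> (cmod (z - w)) (t - w) \<le> 20 * A * (weight \<alpha> (cmod (z - w)) (t - z) + weight \<alpha> (cmod (z - w)) (t - w))"
    using holder_with_nonneg[OF a] by (intro mult_left_mono) (auto simp: weight_nonneg)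
  then show ?thesis using commutator_kernel_far[OF a \<alpha> True] True by simp
next
  case False
  let ?d = "cmod (z - w)"
  have A: "0 \<le> A" by (rule holder_with_nonneg[OF a])
  have "cmod ((a t - a z) / (t - z)\<^sup>2 - (a t - a w) / (t - w)\<^sup>2)
      \<le> A * cmod (t - z) powr (\<alpha> - 2) + A * cmod (t - w) powr (\<alpha> - 2)"
    using commutator_kernel_bound[OF a, of t z] commutator_kernel_bound[OF a, of t w]
    by (intro order_trans[OF norm_triangle_ineq4]) auto
  also have "\<dots> \<le> A * (3 * weight \<alpha> ?d (t - z)) + A * (2 * weight \<alpha> ?d (t - w))"
    using near_bounds[OF False] A by (intro add_mono mult_left_mono powr_le_near) auto
  also have "\<dots> \<le> A * (20 * weight \<alpha> ?d (t - z)) + A * (20 * weight \<alpha> ?d (t - w))"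
    using A by (intro add_mono mult_left_mono) (auto simp: weight_nonneg)
  finally show ?thesis using False by (simp add: algebra_simps)
qed

text \<open>
  The form without a main term. In the far zone $\delta \le |t-w|$, so any surplus power of $\delta$ may
  be exchanged for the same power of $|t-w|$. This lowers the exponent from $\alpha$ to $\beta$ and
  leaves the integrable singularity $|t-w|^{\alpha-\beta-2}$.
\<close>

lemma commutator_kernel_diff_weak:
  assumes a: "holder_with \<alpha> A a" and \<alpha>: "0 < \<beta>" "\<beta> < \<alpha>" "\<alpha> < 1"
  shows "cmod ((a t - a z) / (t - z)\<^sup>2 - (a t - a w) / (t - w)\<^sup>2)
    \<le> 21 * A * cmod (z - w) powr \<beta> * (cmod (t - z) powr (\<alpha> - \<beta> - 2) + cmod (t - w) powr (\<alpha> - \<beta> - 2))"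
proof -
  let ?d = "cmod (z - w)" and ?g = "\<alpha> - \<beta> - 2"
  have A: "0 \<le> A" by (rule holder_with_nonneg[OF a])
  show ?thesis
  proof (cases "2 * ?d < cmod (t - w)")
    case True
    let ?y = "t - w"
    have y: "?y \<noteq> 0" "0 < cmod ?y" "?d \<le> cmod ?y"
      using True norm_ge_zero[of "z - w"] by (auto simp del: norm_ge_zero)
    have "cmod ((a w - a z) / ?y\<^sup>2) \<le> A * ?d powr \<alpha> / cmod ?y ^ 2"
      using holder_withD[OF a, of w z] by (simp add: norm_divide norm_power divide_right_mono norm_minus_commute)
    also have "\<dots> = A * ?d powr \<beta> * ?d powr (\<alpha> - \<beta>) / cmod ?y ^ 2"
      by (simp flip: powr_add)
    also have "\<dots> \<le> A * ?d powr \<beta> * cmod ?y powr (\<alpha> - \<beta>) / cmod ?y ^ 2"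
      using A y \<alpha> by (intro divide_right_mono mult_left_mono powr_mono2) auto
    also have "\<dots> = A * ?d powr \<beta> * cmod ?y powr ?g"
      using powr_times_power[of ?y "\<alpha> - \<beta>" 2] y by simp
    finally have 1: "cmod ((a w - a z) / ?y\<^sup>2) \<le> A * ?d powr \<beta> * cmod ?y powr ?g" .
    have "weight \<alpha> ?d ?y = ?d powr \<beta> * ?d powr (1 - \<beta>) * (cmod ?y powr \<alpha> / cmod ?y ^ 3)"
      using y by (subst weight_far) (auto simp flip: powr_add)
    also have "\<dots> \<le> ?d powr \<beta> * cmod ?y powr (1 - \<beta>) * (cmod ?y powr \<alpha> / cmod ?y ^ 3)"
      using y \<alpha> by (intro mult_right_mono mult_left_mono powr_mono2) auto
    also have "\<dots> = ?d powr \<beta> * (cmod ?y powr (1 - \<beta> + \<alpha>) / cmod ?y ^ 3)"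
      by (simp add: powr_add)
    also have "cmod ?y powr (1 - \<beta> + \<alpha>) / cmod ?y ^ 3 = cmod ?y powr ?g"
      using powr_times_power[of ?y "1 - \<beta> + \<alpha>" 3] y by (simp add: algebra_simps)
    finally have 2: "20 * A * weight \<alpha> ?d ?y \<le> 20 * A * (?d powr \<beta> * cmod ?y powr ?g)"
      using A by (intro mult_left_mono) auto
    have "cmod ((a t - a z) / (t - z)\<^sup>2 - (a t - a w) / (t - w)\<^sup>2) \<le>
        20 * A * weight \<alpha> ?d ?y + cmod ((a w - a z) / ?y\<^sup>2)"
      using commutator_kernel_far[OF a _ _ True] \<alpha>
        norm_triangle_sub[of "(a t - a z) / (t - z)\<^sup>2 - (a t - a w) / (t - w)\<^sup>2" "(a w - a z) / ?y\<^sup>2"]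
      by auto
    also have "\<dots> \<le> 21 * A * ?d powr \<beta> * cmod ?y powr ?g"
      using 1 2 by (simp add: algebra_simps)
    also have "\<dots> \<le> 21 * A * ?d powr \<beta> * (cmod (t - z) powr ?g + cmod ?y powr ?g)"
      using A by (intro mult_left_mono) auto
    finally show ?thesis .
  next
    case False
    have e: "A * cmod s powr (\<alpha> - 2) \<le> 21 * A * ?d powr \<beta> * cmod s powr ?g"
      if s: "cmod s \<le> 3 * ?d" for s
    proof -
      have "cmod s powr \<beta> \<le> 3 * ?d powr \<beta>"
        using s \<alpha> by (intro powr_le_multiple) auto
      then have "cmod s powr \<beta> \<le> 21 * ?d powr \<beta>" by (smt (verit) powr_ge_zero)
      then have "A * (cmod s powr \<beta> * cmod s powr ?g) \<le> A * (21 * ?d powr \<beta> * cmod s powr ?g)"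
        using A by (intro mult_left_mono mult_right_mono) auto
      then show ?thesis by (simp add: mult_ac flip: powr_add)
    qed
    have "cmod ((a t - a z) / (t - z)\<^sup>2 - (a t - a w) / (t - w)\<^sup>2)
        \<le> A * cmod (t - z) powr (\<alpha> - 2) + A * cmod (t - w) powr (\<alpha> - 2)"
      using commutator_kernel_bound[OF a, of t z] commutator_kernel_bound[OF a, of t w]
      by (intro order_trans[OF norm_triangle_ineq4]) auto
    also have "\<dots> \<le> 21 * A * ?d powr \<beta> * cmod (t - z) powr ?g + 21 * A * ?d powr \<beta> * cmod (t - w) powr ?g"
      using near_bounds[OF False] norm_ge_zero[of "z - w"] by (intro add_mono e) linarith+
    finally show ?thesis by (simp add: algebra_simps)
  qed
qed

section \<open>Mapping properties for a Hoelder continuous coefficient\<close>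

text \<open>The commutator without its constant factor $-1/\pi$.\<close>

definition comm_int :: "(complex \<Rightarrow> complex) \<Rightarrow> (complex \<Rightarrow> complex) \<Rightarrow> complex \<Rightarrow> complex" where
  "comm_int a u z = (LINT t|lebesgue. (a t - a z) / (t - z)\<^sup>2 * u t)"

definition bounded_in_ball :: "real \<Rightarrow> real \<Rightarrow> (complex \<Rightarrow> complex) \<Rightarrow> bool" where
  "bounded_in_ball \<rho> M u \<longleftrightarrow> u \<in> borel_measurable lebesgue \<and>
     (AE t in lebesgue. cmod (u t) \<le> M * indicator (cball 0 \<rho>) t)"

text \<open>
  One constant bounds both the function and its Hoelder quotient. Working with such constants keeps
  suprema out of all estimates until the norms enter at the end.
\<close>

definition holder_bd :: "real \<Rightarrow> real \<Rightarrow> (complex \<Rightarrow> complex) \<Rightarrow> bool" where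
  "holder_bd \<alpha> M f \<longleftrightarrow> (\<forall>z. cmod (f z) \<le> M) \<and> holder_with \<alpha> M f"

lemma holder_bdD:
  assumes "holder_bd \<alpha> M f"
  shows "cmod (f z) \<le> M" "holder_with \<alpha> M f" "cmod (f z - f w) \<le> M * cmod (z - w) powr \<alpha>" "0 \<le> M"
  using assms holder_withD[of \<alpha> M f z w] holder_with_nonneg[of \<alpha> M f] by (auto simp: holder_bd_def)

lemma borel_imp_lebesgue: "f \<in> borel_measurable borel \<Longrightarrow> f \<in> borel_measurable lebesgue"
  by (simp add: measurable_completion)

lemma holder_with_continuous:
  assumes "0 < \<alpha>" "holder_with \<alpha> A f"
  shows "continuous_on UNIV f"
proof -
  have "isCont f z" for z
  proof -
    have "((\<lambda>w. A * cmod (w - z) powr \<alpha>) \<longlongrightarrow> A * cmod (z - z) powr \<alpha>) (at z)"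
      using assms(1) by (intro tendsto_intros tendsto_powr') auto
    then have "((\<lambda>w. A * cmod (w - z) powr \<alpha>) \<longlongrightarrow> 0) (at z)" by simp
    then have "((\<lambda>w. f w - f z) \<longlongrightarrow> 0) (at z)"
      by (rule Lim_null_comparison[rotated]) (simp add: holder_withD[OF assms(2)])
    then show ?thesis by (simp add: isCont_def LIM_zero_iff)
  qed
  then show ?thesis by (simp add: continuous_at_imp_continuous_on)
qed

lemma continuous_borel: "continuous_on UNIV f \<Longrightarrow> f \<in> borel_measurable borel"
  by (rule borel_measurable_continuous_onI)

lemma commutator_kernel_borel:
  fixes a :: "complex \<Rightarrow> complex"
  assumes "continuous_on UNIV a"
  shows "(\<lambda>t. (a t - a z) / (t - z)\<^sup>2) \<in> borel_measurable borel"
proof -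
  have a: "a \<in> borel_measurable borel" by (rule continuous_borel[OF assms])
  have t: "(\<lambda>t. (t - z)\<^sup>2) \<in> borel_measurable borel" by simp
  show ?thesis by (intro borel_measurable_divide borel_measurable_diff borel_measurable_const a t)
qed

lemma comm_int_bounded:
  assumes \<alpha>: "0 < \<alpha>" "\<alpha> < 1"
  obtains C where "0 \<le> C"
    "\<And>a A u M z. holder_with \<alpha> A a \<Longrightarrow> bounded_in_ball \<rho> M u \<Longrightarrow> 0 \<le> M \<Longrightarrow>
      integrable lebesgue (\<lambda>t. (a t - a z) / (t - z)\<^sup>2 * u t) \<and> cmod (comm_int a u z) \<le> C * A * M"
proof -
  obtain C where C: "0 < C"
    "\<And>z. integrable lebesgue (\<lambda>t. indicator (cball 0 \<rho>) t * cmod (t - z) powr (\<alpha> - 2))"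
    "\<And>z. (LINT t|lebesgue. indicator (cball 0 \<rho>) t * cmod (t - z) powr (\<alpha> - 2)) \<le> C"
    using ball_weight_integral[OF \<alpha>] by metis
  show ?thesis
  proof (rule that[of C])
    fix a A u M z
    assume a: "holder_with \<alpha> A a" and u: "bounded_in_ball \<rho> M u" and M: "0 \<le> M"
    have A: "0 \<le> A" by (rule holder_with_nonneg[OF a])
    let ?f = "\<lambda>t. (a t - a z) / (t - z)\<^sup>2 * u t"
    let ?w = "\<lambda>t. A * M * (indicator (cball 0 \<rho>) t * cmod (t - z) powr (\<alpha> - 2))"
    have m: "?f \<in> borel_measurable lebesgue"
      using u borel_imp_lebesgue[OF commutator_kernel_borel[OF holder_with_continuous[OF \<alpha>(1) a]]]
      by (intro borel_measurable_times) (auto simp: bounded_in_ball_def)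
    have "AE t in lebesgue. cmod (u t) \<le> M * indicator (cball 0 \<rho>) t"
      using u by (simp add: bounded_in_ball_def)
    then have b: "AE t in lebesgue. cmod (?f t) \<le> ?w t"
    proof eventually_elim
      case (elim t)
      then have "cmod (?f t) \<le> (A * cmod (t - z) powr (\<alpha> - 2)) * (M * indicator (cball 0 \<rho>) t)"
        unfolding norm_mult using commutator_kernel_bound[OF a] A by (intro mult_mono) auto
      then show ?case by (simp add: mult_ac)
    qed
    have I: "integrable lebesgue ?w" using C(2) by simp
    have "(LINT t|lebesgue. ?w t) \<le> A * M * C"
      unfolding integral_mult_right_zero using C(3) A M by (intro mult_left_mono) auto
    with integral_bounded_by[OF m I b]
    show "integrable lebesgue ?f \<and> cmod (comm_int a u z) \<le> C * A * M"
      by (simp add: comm_int_def mult_ac)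
  qed (use C in auto)
qed

lemma commutator_kernel_integrable:
  assumes "0 < \<alpha>" "\<alpha> < 1" "holder_with \<alpha> A a" "bounded_in_ball \<rho> M u" "0 \<le> M"
  shows "integrable lebesgue (\<lambda>t. (a t - a z) / (t - z)\<^sup>2 * u t)"
proof (rule comm_int_bounded[OF assms(1,2), of \<rho>])
  fix C assume "\<And>a A u M z. holder_with \<alpha> A a \<Longrightarrow> bounded_in_ball \<rho> M u \<Longrightarrow> 0 \<le> M \<Longrightarrow>
    integrable lebesgue (\<lambda>t. (a t - a z) / (t - z)\<^sup>2 * u t) \<and> cmod (comm_int a u z) \<le> C * A * M"
  from this[OF assms(3-5)] show ?thesis by blast
qed

lemma comm_int_holder_of_bounded:
  assumes \<alpha>: "0 < \<beta>" "\<beta> < \<alpha>" "\<alpha> < 1"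
  obtains C where "0 \<le> C"
    "\<And>a A u M. holder_with \<alpha> A a \<Longrightarrow> bounded_in_ball \<rho> M u \<Longrightarrow> 0 \<le> M \<Longrightarrow> holder_bd \<beta> (C * A * M) (comm_int a u)"
proof -
  have \<gamma>: "0 < \<alpha> - \<beta>" "\<alpha> - \<beta> < 1" and \<alpha>0: "0 < \<alpha>" using \<alpha> by auto
  obtain C where C: "0 < C"
    "\<And>z. integrable lebesgue (\<lambda>t. indicator (cball 0 \<rho>) t * cmod (t - z) powr (\<alpha> - \<beta> - 2))"
    "\<And>z. (LINT t|lebesgue. indicator (cball 0 \<rho>) t * cmod (t - z) powr (\<alpha> - \<beta> - 2)) \<le> C"
    using ball_weight_integral[OF \<gamma>] by metis
  obtain C0 where C0: "0 \<le> C0"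
    "\<And>a A u M z. holder_with \<alpha> A a \<Longrightarrow> bounded_in_ball \<rho> M u \<Longrightarrow> 0 \<le> M \<Longrightarrow>
      integrable lebesgue (\<lambda>t. (a t - a z) / (t - z)\<^sup>2 * u t) \<and> cmod (comm_int a u z) \<le> C0 * A * M"
    by (rule comm_int_bounded[OF \<alpha>0 \<alpha>(3), of \<rho>]) (rule that; blast)
  show ?thesis
  proof (rule that[of "C0 + 42 * C"])
    fix a A u M
    assume a: "holder_with \<alpha> A a" and u: "bounded_in_ball \<rho> M u" and M: "0 \<le> M"
    have A: "0 \<le> A" by (rule holder_with_nonneg[OF a])
    have bd: "cmod (comm_int a u z) \<le> (C0 + 42 * C) * A * M" for z
      using C0(2)[OF a u M, of z] C(1) A M by (simp add: distrib_right add_increasing2)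
    have "cmod (comm_int a u z - comm_int a u w) \<le> (C0 + 42 * C) * A * M * cmod (z - w) powr \<beta>" for z w
    proof -
      let ?k = "\<lambda>z t. (a t - a z) / (t - z)\<^sup>2"
      let ?D = "cmod (z - w) powr \<beta>"
      let ?e = "\<lambda>z t. indicator (cball 0 \<rho>) t * cmod (t - z) powr (\<alpha> - \<beta> - 2)"
      let ?W = "\<lambda>t. 21 * A * M * ?D * (?e z t + ?e w t)"
      have i: "integrable lebesgue (\<lambda>t. ?k z t * u t)" for z
        using C0(2)[OF a u M] by blast
      have d: "comm_int a u z - comm_int a u w = (LINT t|lebesgue. ?k z t * u t - ?k w t * u t)"
        unfolding comm_int_def by (rule Bochner_Integration.integral_diff[symmetric, OF i i])
      have m: "(\<lambda>t. ?k z t * u t - ?k w t * u t) \<in> borel_measurable lebesgue"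
        using i by (intro borel_measurable_diff borel_measurable_integrable) auto
      have "AE t in lebesgue. cmod (u t) \<le> M * indicator (cball 0 \<rho>) t"
        using u by (simp add: bounded_in_ball_def)
      then have b: "AE t in lebesgue. cmod (?k z t * u t - ?k w t * u t) \<le> ?W t"
      proof eventually_elim
        case (elim t)
        have "?k z t * u t - ?k w t * u t = (?k z t - ?k w t) * u t" by (simp add: left_diff_distrib)
        also have "cmod \<dots> \<le> (21 * A * ?D * (cmod (t - z) powr (\<alpha> - \<beta> - 2) + cmod (t - w) powr (\<alpha> - \<beta> - 2)))
            * (M * indicator (cball 0 \<rho>) t)"
          unfolding norm_mult using commutator_kernel_diff_weak[OF a \<alpha>, of t z w] A elim
          by (intro mult_mono) auto
        also have "\<dots> = ?W t" by (simp add: algebra_simps)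
        finally show ?case .
      qed
      have I: "integrable lebesgue ?W" using C(2) by simp
      have "(LINT t|lebesgue. ?W t) = 21 * A * M * ?D * ((LINT t|lebesgue. ?e z t) + (LINT t|lebesgue. ?e w t))"
        using C(2) by (simp add: Bochner_Integration.integral_add)
      also have "\<dots> \<le> 21 * A * M * ?D * (C + C)"
        using C(3)[of z] C(3)[of w] A M by (intro mult_left_mono add_mono) auto
      finally have "cmod (comm_int a u z - comm_int a u w) \<le> 21 * A * M * ?D * (C + C)"
        unfolding d by (rule order_trans[OF integral_bounded_by(2)[OF m I b]])
      also have "\<dots> \<le> (C0 + 42 * C) * A * M * ?D"
        using C0(1) A M by (simp add: algebra_simps)
      finally show ?thesis .
    qed
    then show "holder_bd \<beta> ((C0 + 42 * C) * A * M) (comm_int a u)"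
      using bd by (auto simp: holder_bd_def holder_with_def)
  qed (use C0 C in auto)
qed

lemma holder_bd_supp_bounded_in_ball:
  assumes "0 < \<beta>" "holder_bd \<beta> M u" "\<And>t. t \<notin> cball 0 \<rho> \<Longrightarrow> u t = 0"
  shows "bounded_in_ball \<rho> M u"
  unfolding bounded_in_ball_def
proof (intro conjI AE_I2)
  show "u \<in> borel_measurable lebesgue"
    using assms holder_bdD(2) by (intro borel_imp_lebesgue continuous_borel holder_with_continuous) auto
  show "cmod (u t) \<le> M * indicator (cball 0 \<rho>) t" for t
    using assms(3)[of t] holder_bdD(1)[OF assms(2), of t] by (cases "t \<in> cball 0 \<rho>") auto
qed

text \<open>
  For $r < |t-w| \le 1$ the numerator $u(t)$ may be replaced by $u(t)-u(w)$, because $(t-w)^{-2}$ has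
  mean zero over annuli, and then $|t-w|^{\beta-2}$ is an integrable majorant independent of $r$. For
  $|t-w| > 1$ the kernel is at most $1$ and $u$ has compact support.
\<close>

lemma truncated_CZ_bounded:
  assumes \<beta>: "0 < \<beta>" "\<beta> < 1"
  obtains C where "0 \<le> C"
    "\<And>u M w r. holder_bd \<beta> M u \<Longrightarrow> (\<And>t. t \<notin> cball 0 \<rho> \<Longrightarrow> u t = 0) \<Longrightarrow> 0 < r \<Longrightarrow>
      integrable lebesgue (\<lambda>t. indicat_real {t. r < cmod (t - w)} t *\<^sub>R (u t / (t - w)\<^sup>2)) \<and>
      cmod (LINT t|lebesgue. indicat_real {t. r < cmod (t - w)} t *\<^sub>R (u t / (t - w)\<^sup>2)) \<le> C * M"
proof -
  obtain C where C: "0 < C" "\<And>\<delta> z. 0 < \<delta> \<Longrightarrow> integrable lebesgue (\<lambda>t. weight \<beta> \<delta> (t - z))"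
    "\<And>\<delta> z. 0 < \<delta> \<Longrightarrow> (LINT t|lebesgue. weight \<beta> \<delta> (t - z)) \<le> C * \<delta> powr \<beta>"
    using weight_integral[OF \<beta>] by metis
  let ?i = "indicat_real (cball (0::complex) \<rho>)"
  have i: "integrable lebesgue ?i"
    by (intro integrable_real_indicator) (use emeasure_lborel_cball_finite[of "0::complex" \<rho>] in auto)
  show ?thesis
  proof (rule that[of "C + (LINT t|lebesgue. ?i t)"])
    show "0 \<le> C + (LINT t|lebesgue. ?i t)"
      using C(1) by (intro add_nonneg_nonneg Bochner_Integration.integral_nonneg) auto
    fix u M w and r :: real
    assume u: "holder_bd \<beta> M u" and supp: "\<And>t. t \<notin> cball 0 \<rho> \<Longrightarrow> u t = 0" and r: "0 < r"
    have M: "0 \<le> M" by (rule holder_bdD(4)[OF u])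
    let ?L = "\<lambda>t. indicat_real {t. r < cmod (t - w)} t *\<^sub>R (u t / (t - w)\<^sup>2)"
    let ?A = "\<lambda>t. indicat_real {t. r < cmod (t - w) \<and> cmod (t - w) \<le> 1} t *\<^sub>R (1 / (t - w)\<^sup>2)"
    let ?p = "\<lambda>t. ?L t - u w * ?A t"
    let ?W = "\<lambda>t. M * (weight \<beta> 1 (t - w) + ?i t)"
    have "u \<in> Linf_space_R \<rho>"
    proof -
      have "AE t in lebesgue. cmod (u t) \<le> M" using holder_bdD(1)[OF u] by simp
      then have "\<exists>C. AE t in lebesgue. cmod (u t) \<le> C" by blast
      then show ?thesis
        using holder_bd_supp_bounded_in_ball[OF \<beta>(1) u supp] supp
        by (auto simp: Linf_space_R_def bounded_in_ball_def)
    qed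
    then have IL: "integrable lebesgue ?L"
      using trunc_kernel_integrable[of u \<rho> r w] r by (simp add: set_integrable_def)
    have b: "cmod (?p t) \<le> ?W t" for t
    proof (cases "r < cmod (t - w)")
      case rt: True
      then have t: "t - w \<noteq> 0" using r by auto
      show ?thesis
      proof (cases "cmod (t - w) \<le> 1")
        case True
        have "cmod (?p t) = cmod (u t - u w) / (cmod (t - w))\<^sup>2"
          using rt True t by (simp add: norm_divide norm_power flip: diff_divide_distrib)
        also have "\<dots> \<le> M * cmod (t - w) powr \<beta> / (cmod (t - w))\<^sup>2"
          using holder_bdD(3)[OF u] by (intro divide_right_mono) auto
        also have "\<dots> = M * cmod (t - w) powr (\<beta> - 2)"
          using powr_times_power[OF t, of \<beta> 2] by simp
        also have "\<dots> \<le> M * (1 * weight \<beta> 1 (t - w))"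
          using True M by (intro mult_left_mono powr_le_near) auto
        also have "\<dots> \<le> ?W t" using M by (intro mult_left_mono) auto
        finally show ?thesis .
      next
        case False
        then have "1 \<le> (cmod (t - w))\<^sup>2" by simp
        then have "cmod (?p t) \<le> cmod (u t)"
          using rt False by (simp add: norm_divide norm_power divide_le_eq mult_left_mono mult_le_cancel_left1)
        also have "\<dots> \<le> M * ?i t" using supp[of t] holder_bdD(1)[OF u, of t] by (cases "t \<in> cball 0 \<rho>") auto
        also have "\<dots> \<le> ?W t" using M by (intro mult_left_mono) (auto simp: weight_nonneg)
        finally show ?thesis .
      qed
    next
      case False
      then show ?thesis using M by (simp add: weight_nonneg)
    qed
    have "{t. r < cmod (t - w) \<and> cmod (t - w) \<le> 1} \<in> sets borel" by measurable
    then have "?A \<in> borel_measurable lebesgue"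
      by (intro borel_imp_lebesgue borel_measurable_scaleR borel_measurable_indicator) auto
    then have m: "?p \<in> borel_measurable lebesgue"
      by (intro borel_measurable_diff[OF borel_measurable_integrable[OF IL]] borel_measurable_times
          borel_measurable_const)
    have I: "integrable lebesgue ?W" using C(2)[of 1 w] i by simp
    have Ip: "integrable lebesgue ?p" and np: "cmod (LINT t|lebesgue. ?p t) \<le> (LINT t|lebesgue. ?W t)"
      using integral_bounded_by[OF m I AE_I2[OF b]] by auto
    have "(LINT t|lebesgue. ?W t) = M * ((LINT t|lebesgue. weight \<beta> 1 (t - w)) + (LINT t|lebesgue. ?i t))"
      unfolding integral_mult_right_zero
      by (subst Bochner_Integration.integral_add) (use C(2)[of 1 w] i in auto)
    also have "\<dots> \<le> M * (C + (LINT t|lebesgue. ?i t))"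
      using C(3)[of 1 w] M by (intro mult_left_mono add_mono) auto
    finally have W: "(LINT t|lebesgue. ?W t) \<le> M * (C + (LINT t|lebesgue. ?i t))" .
    have "(LINT t|lebesgue. ?L t) - (LINT t|lebesgue. ?p t) = (LINT t|lebesgue. ?L t - ?p t)"
      by (rule Bochner_Integration.integral_diff[symmetric, OF IL Ip])
    also have "\<dots> = u w * (LINT t|lebesgue. ?A t)"
      unfolding integral_mult_right_zero[symmetric] by simp
    also have "\<dots> = 0" using annulus_integral_eq_0[of r w 1] by simp
    finally have "(LINT t|lebesgue. ?L t) = (LINT t|lebesgue. ?p t)" by simp
    then show "integrable lebesgue ?L \<and> cmod (LINT t|lebesgue. ?L t) \<le> (C + (LINT t|lebesgue. ?i t)) * M"
      using IL np W by (simp add: mult.commute)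
  qed
qed

text \<open>
  The main term of the kernel difference, integrated over the far zone, is $a(w)-a(z)$ times a
  truncated singular integral, hence $O(\delta^\alpha)$. Any exponent $\beta$ for $u$ suffices.
\<close>

lemma comm_int_holder_of_holder:
  assumes \<alpha>: "0 < \<alpha>" "\<alpha> < 1" and \<beta>: "0 < \<beta>" "\<beta> < 1"
  obtains C where "0 \<le> C"
    "\<And>a A u M. holder_with \<alpha> A a \<Longrightarrow> holder_bd \<beta> M u \<Longrightarrow> (\<And>t. t \<notin> cball 0 \<rho> \<Longrightarrow> u t = 0) \<Longrightarrow>
      holder_bd \<alpha> (C * A * M) (comm_int a u)"
proof -
  obtain C where C: "0 < C" "\<And>\<delta> z. 0 < \<delta> \<Longrightarrow> integrable lebesgue (\<lambda>t. weight \<alpha> \<delta> (t - z))"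
    "\<And>\<delta> z. 0 < \<delta> \<Longrightarrow> (LINT t|lebesgue. weight \<alpha> \<delta> (t - z)) \<le> C * \<delta> powr \<alpha>"
    using weight_integral[OF \<alpha>] by metis
  obtain C0 where C0: "0 \<le> C0"
    "\<And>a A u M z. holder_with \<alpha> A a \<Longrightarrow> bounded_in_ball \<rho> M u \<Longrightarrow> 0 \<le> M \<Longrightarrow>
      integrable lebesgue (\<lambda>t. (a t - a z) / (t - z)\<^sup>2 * u t) \<and> cmod (comm_int a u z) \<le> C0 * A * M"
    by (rule comm_int_bounded[OF \<alpha>, of \<rho>]) (rule that; blast)
  obtain C1 where C1: "0 \<le> C1"
    "\<And>u M w r. holder_bd \<beta> M u \<Longrightarrow> (\<And>t. t \<notin> cball 0 \<rho> \<Longrightarrow> u t = 0) \<Longrightarrow> 0 < r \<Longrightarrow>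
      integrable lebesgue (\<lambda>t. indicat_real {t. r < cmod (t - w)} t *\<^sub>R (u t / (t - w)\<^sup>2)) \<and>
      cmod (LINT t|lebesgue. indicat_real {t. r < cmod (t - w)} t *\<^sub>R (u t / (t - w)\<^sup>2)) \<le> C1 * M"
    by (rule truncated_CZ_bounded[OF \<beta>, of \<rho>]) (rule that; blast)
  show ?thesis
  proof (rule that[of "C0 + 40 * C + C1"])
    fix a A u M
    assume a: "holder_with \<alpha> A a" and u: "holder_bd \<beta> M u" and supp: "\<And>t. t \<notin> cball 0 \<rho> \<Longrightarrow> u t = 0"
    have A: "0 \<le> A" by (rule holder_with_nonneg[OF a])
    have M: "0 \<le> M" by (rule holder_bdD(4)[OF u])
    note ub = holder_bd_supp_bounded_in_ball[OF \<beta>(1) u supp]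
    have bd: "cmod (comm_int a u z) \<le> (C0 + 40 * C + C1) * A * M" for z
    proof -
      have "C0 * A * M \<le> (C0 + 40 * C + C1) * A * M"
        using C(1) C1(1) A M by (intro mult_right_mono) auto
      then show ?thesis using C0(2)[OF a ub M, of z] by linarith
    qed
    have "cmod (comm_int a u z - comm_int a u w) \<le> (C0 + 40 * C + C1) * A * M * cmod (z - w) powr \<alpha>" for z w
    proof (cases "z = w")
      case False
      let ?k = "\<lambda>z t. (a t - a z) / (t - z)\<^sup>2"
      let ?d = "cmod (z - w)"
      have d: "0 < ?d" using False by simp
      let ?T = "\<lambda>t. indicat_real {t. 2 * ?d < cmod (t - w)} t *\<^sub>R (u t / (t - w)\<^sup>2)"
      let ?P = "\<lambda>t. ?k z t * u t - ?k w t * u t - (a w - a z) * ?T t"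
      let ?W = "\<lambda>t. 20 * A * M * (weight \<alpha> ?d (t - z) + weight \<alpha> ?d (t - w))"
      have i: "integrable lebesgue (\<lambda>t. ?k z t * u t)" for z
        using C0(2)[OF a ub M] by blast
      have iT: "integrable lebesgue ?T" and nT: "cmod (LINT t|lebesgue. ?T t) \<le> C1 * M"
        using C1(2)[OF u supp, of "2 * ?d" w] d by auto
      have iP: "integrable lebesgue ?P"
        by (intro Bochner_Integration.integrable_diff integrable_mult_right i iT)
      have "(LINT t|lebesgue. ?P t) = comm_int a u z - comm_int a u w - (a w - a z) * (LINT t|lebesgue. ?T t)"
        unfolding comm_int_def integral_mult_right_zero[symmetric]
        by (subst Bochner_Integration.integral_diff,
            intro Bochner_Integration.integrable_diff i, intro integrable_mult_right iT,
            subst Bochner_Integration.integral_diff[OF i i], rule refl)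
      then have eq: "comm_int a u z - comm_int a u w =
          (LINT t|lebesgue. ?P t) + (a w - a z) * (LINT t|lebesgue. ?T t)" by simp
      have b: "cmod (?P t) \<le> ?W t" for t
      proof -
        have "?P t = (?k z t - ?k w t
           - indicat_real {t. 2 * ?d < cmod (t - w)} t *\<^sub>R ((a w - a z) / (t - w)\<^sup>2)) * u t"
          by (simp add: algebra_simps diff_divide_distrib)
        also have "cmod \<dots> \<le> (20 * A * (weight \<alpha> ?d (t - z) + weight \<alpha> ?d (t - w))) * M"
          unfolding norm_mult using commutator_kernel_diff[OF a \<alpha>, of t z w] holder_bdD(1)[OF u, of t] A d
          by (intro mult_mono) (auto simp: weight_nonneg)
        finally show ?thesis by (simp add: mult_ac)
      qed
      have I: "integrable lebesgue ?W" using C(2)[OF d] by simp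
      have "cmod (LINT t|lebesgue. ?P t) \<le> (LINT t|lebesgue. ?W t)"
        by (rule integral_bounded_by(2)[OF borel_measurable_integrable[OF iP] I AE_I2[OF b]])
      also have "\<dots> = 20 * A * M * ((LINT t|lebesgue. weight \<alpha> ?d (t - z)) + (LINT t|lebesgue. weight \<alpha> ?d (t - w)))"
        using C(2)[OF d] by simp
      also have "\<dots> \<le> 20 * A * M * (C * ?d powr \<alpha> + C * ?d powr \<alpha>)"
        using C(3)[OF d] A M by (intro mult_left_mono add_mono) auto
      finally have P: "cmod (LINT t|lebesgue. ?P t) \<le> 40 * C * A * M * ?d powr \<alpha>"
        by (simp add: algebra_simps)
      have "cmod ((a w - a z) * (LINT t|lebesgue. ?T t)) \<le> (A * ?d powr \<alpha>) * (C1 * M)"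
        unfolding norm_mult using holder_withD[OF a, of w z] nT A
        by (intro mult_mono) (auto simp: norm_minus_commute)
      then have "cmod (comm_int a u z - comm_int a u w) \<le> 40 * C * A * M * ?d powr \<alpha> + (A * ?d powr \<alpha>) * (C1 * M)"
        unfolding eq using P by (intro order_trans[OF norm_triangle_ineq]) auto
      also have "\<dots> \<le> (C0 + 40 * C + C1) * A * M * ?d powr \<alpha>"
        using C0(1) A M by (simp add: algebra_simps)
      finally show ?thesis .
    qed simp
    then show "holder_bd \<alpha> ((C0 + 40 * C + C1) * A * M) (comm_int a u)"
      using bd by (auto simp: holder_bd_def holder_with_def)
  qed (use C0 C C1 in auto)
qed

section \<open>Lipschitz bounds and cut-off functions\<close>

lemma holder_bd_mult:
  assumes "holder_bd \<alpha> M f" "holder_bd \<alpha> N g"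
  shows "holder_bd \<alpha> (2 * M * N) (\<lambda>z. f z * g z)"
proof -
  have M: "0 \<le> M" and N: "0 \<le> N" using assms holder_bdD(4) by blast+
  have "cmod (f z * g z) \<le> 2 * M * N" for z
  proof -
    have "cmod (f z * g z) \<le> M * N"
      unfolding norm_mult using holder_bdD(1)[OF assms(1)] holder_bdD(1)[OF assms(2)] M by (intro mult_mono) auto
    moreover have "0 \<le> M * N" using M N by simp
    ultimately show ?thesis by linarith
  qed
  moreover have "cmod (f z * g z - f w * g w) \<le> 2 * M * N * cmod (z - w) powr \<alpha>" for z w
  proof -
    have "f z * g z - f w * g w = f z * (g z - g w) + (f z - f w) * g w" by (simp add: algebra_simps)
    also have "cmod \<dots> \<le> M * (N * cmod (z - w) powr \<alpha>) + (M * cmod (z - w) powr \<alpha>) * N"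
      using holder_bdD[OF assms(1)] holder_bdD[OF assms(2)] M
      by (intro order_trans[OF norm_triangle_ineq] add_mono; unfold norm_mult; intro mult_mono) auto
    finally show ?thesis by (simp add: algebra_simps)
  qed
  ultimately show ?thesis by (auto simp: holder_bd_def holder_with_def)
qed

lemma holder_bd_add:
  assumes "holder_bd \<alpha> M f" "holder_bd \<alpha> N g"
  shows "holder_bd \<alpha> (M + N) (\<lambda>z. f z + g z)"
proof -
  have "cmod (f z + g z) \<le> M + N" for z
    using holder_bdD(1)[OF assms(1)] holder_bdD(1)[OF assms(2)] by (meson norm_triangle_mono)
  moreover have "cmod (f z + g z - (f w + g w)) \<le> (M + N) * cmod (z - w) powr \<alpha>" for z w
  proof -
    have "f z + g z - (f w + g w) = (f z - f w) + (g z - g w)" by simp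
    also have "cmod \<dots> \<le> M * cmod (z - w) powr \<alpha> + N * cmod (z - w) powr \<alpha>"
      using holder_bdD(3)[OF assms(1)] holder_bdD(3)[OF assms(2)] by (meson norm_triangle_mono)
    finally show ?thesis by (simp add: distrib_right)
  qed
  ultimately show ?thesis by (auto simp: holder_bd_def holder_with_def)
qed

lemma holder_bd_mono: "holder_bd \<alpha> M f \<Longrightarrow> M \<le> N \<Longrightarrow> holder_bd \<alpha> N f"
  unfolding holder_bd_def holder_with_def
  by (meson mult_right_mono order_trans powr_ge_zero)

lemma holder_bd_cmult:
  assumes "holder_bd \<alpha> M f"
  shows "holder_bd \<alpha> (cmod c * M) (\<lambda>z. c * f z)"
proof -
  have "cmod (c * f z - c * f w) \<le> cmod c * M * cmod (z - w) powr \<alpha>" for z w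
    using mult_left_mono[OF holder_bdD(3)[OF assms, of z w] norm_ge_zero[of c]]
    by (simp add: mult.assoc flip: right_diff_distrib norm_mult)
  then show ?thesis
    using holder_bdD(1)[OF assms] by (auto simp: holder_bd_def holder_with_def norm_mult mult_left_mono)
qed

lemma lipschitz_of_derivative:
  fixes f :: "complex \<Rightarrow> complex"
  assumes "\<And>z. (f has_derivative f' z) (at z)" "\<And>z h. cmod (f' z h) \<le> B * cmod h"
  shows "cmod (f z - f w) \<le> B * cmod (z - w)"
proof -
  have B: "0 \<le> B" using assms(2)[of 0 1] order_trans[OF norm_ge_zero] by fastforce
  show ?thesis
    by (rule differentiable_bound[of UNIV f f'])
       (use assms B in \<open>auto intro!: onorm_le has_derivative_at_withinI\<close>)
qed

lemma holder_bd_of_lipschitz: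
  assumes "\<And>z. cmod (f z) \<le> B" "\<And>z w. cmod (f z - f w) \<le> L * cmod (z - w)" "0 < \<gamma>" "\<gamma> < 1"
  shows "holder_bd \<gamma> (2 * B + L) f"
proof -
  have B: "0 \<le> B" using assms(1)[of 0] order_trans[OF norm_ge_zero] by blast
  have L: "0 \<le> L" using assms(2)[of 1 0] order_trans[OF norm_ge_zero] by fastforce
  have "cmod (f z - f w) \<le> (2 * B + L) * cmod (z - w) powr \<gamma>" for z w
  proof (cases "cmod (z - w) \<le> 1")
    case True
    have "cmod (z - w) \<le> cmod (z - w) powr \<gamma>"
      using powr_mono'[of \<gamma> 1 "cmod (z - w)"] True assms(4) by simp
    then have "L * cmod (z - w) \<le> (2 * B + L) * cmod (z - w) powr \<gamma>"
      using B L by (intro mult_mono) auto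
    then show ?thesis using assms(2)[of z w] by linarith
  next
    case False
    then have 1: "1 \<le> cmod (z - w) powr \<gamma>" using assms(3) by (simp add: ge_one_powr_ge_zero)
    have "cmod (f z - f w) \<le> 2 * B" using assms(1)[of z] assms(1)[of w] norm_triangle_ineq4[of "f z" "f w"] by linarith
    also have "2 * B * 1 \<le> (2 * B + L) * cmod (z - w) powr \<gamma>" using B L 1 by (intro mult_mono) auto
    finally show ?thesis by simp
  qed
  moreover have "cmod (f z) \<le> 2 * B + L" for z using assms(1)[of z] B L by linarith
  ultimately show ?thesis by (auto simp: holder_bd_def holder_with_def)
qed

text \<open>
  The squared positive part is the building block of the cut-off functions: it is zero on a half
  line and continuously differentiable, and the error of its linearization is at most $h^2$.
\<close>

lemma square_of_positive_part_deriv: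
  "((\<lambda>s::real. (max 0 s)\<^sup>2) has_real_derivative 2 * max 0 s) (at s)"
proof -
  have "(\<lambda>h. ((max 0 (s + h))\<^sup>2 - (max 0 s)\<^sup>2) / h - 2 * max 0 s) \<midarrow>0\<rightarrow> 0"
  proof (rule Lim_null_comparison)
    show "\<forall>\<^sub>F h in at 0. norm (((max 0 (s + h))\<^sup>2 - (max 0 s)\<^sup>2) / h - 2 * max 0 s) \<le> \<bar>h\<bar>"
      unfolding eventually_at_filter
    proof (rule always_eventually, intro allI impI)
      fix h :: real
      assume "h \<noteq> 0"
      have "\<bar>(max 0 (s + h))\<^sup>2 - (max 0 s)\<^sup>2 - 2 * max 0 s * h\<bar> \<le> h\<^sup>2"
      proof -
        consider "0 \<le> s" "0 \<le> s + h" | "0 \<le> s" "s + h < 0" | "s < 0" "0 \<le> s + h" | "s < 0" "s + h < 0" by linarith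
        then show ?thesis
        proof cases
          case 1
          then show ?thesis by (simp add: power2_eq_square algebra_simps)
        next
          case 2
          have "\<bar>(max 0 (s + h))\<^sup>2 - (max 0 s)\<^sup>2 - 2 * max 0 s * h\<bar> = \<bar>h\<^sup>2 - (s + h)\<^sup>2\<bar>"
            using 2 by (simp add: power2_eq_square algebra_simps)
          also have "\<dots> \<le> h\<^sup>2"
          proof -
            have "(- (s + h))\<^sup>2 \<le> (- h)\<^sup>2" using 2 by (intro power_mono) auto
            then have "(s + h)\<^sup>2 \<le> h\<^sup>2" by (simp only: power2_minus)
            moreover have "0 \<le> (s + h)\<^sup>2" by simp
            ultimately show ?thesis by linarith
          qed
          finally show ?thesis .
        next
          case 3
          then show ?thesis using power_mono[of "s + h" h 2] by simp
        qed auto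
      qed
      then show "norm (((max 0 (s + h))\<^sup>2 - (max 0 s)\<^sup>2) / h - 2 * max 0 s) \<le> \<bar>h\<bar>"
      proof -
        note False = \<open>h \<noteq> 0\<close>
        have "((max 0 (s + h))\<^sup>2 - (max 0 s)\<^sup>2) / h - 2 * max 0 s =
            ((max 0 (s + h))\<^sup>2 - (max 0 s)\<^sup>2 - 2 * max 0 s * h) / h" using False by (simp add: field_simps)
        also have "\<bar>\<dots>\<bar> \<le> h\<^sup>2 / \<bar>h\<bar>"
          unfolding abs_divide using \<open>\<bar>(max 0 (s + h))\<^sup>2 - (max 0 s)\<^sup>2 - 2 * max 0 s * h\<bar> \<le> h\<^sup>2\<close>
          by (intro divide_right_mono) auto
        also have "\<dots> = \<bar>h\<bar>" by (simp add: power2_eq_square abs_if)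
        finally show ?thesis by simp
      qed
    qed
    show "((\<lambda>h::real. \<bar>h\<bar>) \<longlongrightarrow> 0) (at 0)" by (rule tendsto_eq_intros | simp)+
  qed
  then show ?thesis by (simp add: DERIV_def LIM_zero_iff)
qed

text \<open>
  With $p(s) = \max(0,s)^2$ the function $1 - p(1-p(s))$ is $0$ for $s \le 0$ and $1$ for $s \ge 1$.
  It is applied to $s = 2 - |t-w|^2/\rho^2$. By scaling, its derivative is $O(1/\rho)$.
\<close>

lemma cutoff_exists:
  fixes w :: complex and \<rho> :: real
  assumes \<rho>: "0 < \<rho>"
  obtains \<phi> \<phi>' where
    "\<And>t. (\<phi> has_derivative \<phi>' t) (at t)"
    "\<And>t. cmod (\<phi> t) \<le> 1" "\<And>t h. cmod (\<phi>' t h) \<le> 16 / \<rho> * cmod h"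
    "\<And>h. continuous_on UNIV (\<lambda>t. \<phi>' t h)"
    "\<And>t. cmod (t - w) \<le> \<rho> \<Longrightarrow> \<phi> t = 1" "\<And>t. 2 * \<rho> < cmod (t - w) \<Longrightarrow> \<phi> t = 0"
proof -
  define f :: "real \<Rightarrow> real" where "f s = 1 - (max 0 (1 - (max 0 s)\<^sup>2))\<^sup>2" for s
  define f' :: "real \<Rightarrow> real" where "f' s = 4 * max 0 (1 - (max 0 s)\<^sup>2) * max 0 s" for s
  define g :: "complex \<Rightarrow> real" where "g t = 2 - (t - w) \<bullet> (t - w) / \<rho>\<^sup>2" for t
  define \<phi> where "\<phi> t = complex_of_real (f (g t))" for t
  define \<phi>' where "\<phi>' t h = complex_of_real (f' (g t) * (- 2 * ((t - w) \<bullet> h) / \<rho>\<^sup>2))" for t h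
  have df: "(f has_real_derivative f' s) (at s)" for s
  proof -
    have "((\<lambda>s. 1 - (max 0 s)\<^sup>2) has_real_derivative - (2 * max 0 s)) (at s)"
      using DERIV_diff[OF DERIV_const square_of_positive_part_deriv] by simp
    from DERIV_diff[OF DERIV_const DERIV_chain2[OF square_of_positive_part_deriv this], of 1]
    show ?thesis unfolding f_def by (rule DERIV_cong) (simp add: f'_def)
  qed
  have dg: "(g has_derivative (\<lambda>h. - 2 * ((t - w) \<bullet> h) / \<rho>\<^sup>2)) (at t)" for t
    unfolding g_def using \<rho>
    by (auto intro!: derivative_eq_intros simp: inner_commute field_simps power2_eq_square power4_eq_xxxx)
  have "((\<lambda>t. f (g t)) has_derivative (\<lambda>h. f' (g t) * (- 2 * ((t - w) \<bullet> h) / \<rho>\<^sup>2))) (at t)" for t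
    using has_derivative_compose[OF dg df[unfolded has_field_derivative_def]] by simp
  then have 1: "(\<phi> has_derivative \<phi>' t) (at t)" for t
    unfolding \<phi>_def \<phi>'_def by (rule has_derivative_of_real)
  have f01: "0 \<le> f s" "f s \<le> 1" for s
  proof -
    have "max 0 (1 - (max 0 s)\<^sup>2) \<le> 1" by simp
    then have "(max 0 (1 - (max 0 s)\<^sup>2))\<^sup>2 \<le> 1" by (intro power_le_one) auto
    then show "0 \<le> f s" "f s \<le> 1" by (auto simp: f_def)
  qed
  have f'0: "f' s = 0" if "s \<le> 0 \<or> 1 \<le> s" for s
    using that
  proof
    assume "1 \<le> s"
    then have "1 \<le> (max 0 s)\<^sup>2" using one_le_power[of s 2] by simp
    then show ?thesis by (simp add: f'_def)
  qed (simp add: f'_def)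
  have f'4: "\<bar>f' s\<bar> \<le> 4" for s
  proof (cases "s \<le> 0 \<or> 1 \<le> s")
    case False
    then have "s\<^sup>2 \<le> 1" by (simp add: power_le_one)
    then have "\<bar>f' s\<bar> = 4 * (1 - s\<^sup>2) * s" using False by (simp add: f'_def max_def abs_mult)
    also have "\<dots> \<le> 4 * 1 * 1" using False \<open>s\<^sup>2 \<le> 1\<close> by (intro mult_mono) auto
    finally show ?thesis by simp
  qed (simp add: f'0)
  have gd: "g t = 2 - (cmod (t - w))\<^sup>2 / \<rho>\<^sup>2" for t
    by (simp add: g_def power2_norm_eq_inner)
  have g1: "1 \<le> g t" if "cmod (t - w) \<le> \<rho>" for t
    using that \<rho> by (simp add: gd divide_le_eq power_mono)
  have g0: "g t \<le> 0" if "2 * \<rho> < cmod (t - w)" for t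
  proof -
    have "(2 * \<rho>)\<^sup>2 \<le> (cmod (t - w))\<^sup>2" using that \<rho> by (intro power_mono) auto
    then have "4 * \<rho>\<^sup>2 \<le> (cmod (t - w))\<^sup>2" by (simp add: power_mult_distrib)
    then have "2 * \<rho>\<^sup>2 \<le> (cmod (t - w))\<^sup>2" using zero_le_power2[of \<rho>] by linarith
    then show ?thesis using \<rho> by (simp add: gd le_divide_eq)
  qed
  have 3: "cmod (\<phi>' t h) \<le> 16 / \<rho> * cmod h" for t h
  proof (cases "2 * \<rho> < cmod (t - w)")
    case True
    then show ?thesis using f'0[of "g t"] g0[of t] \<rho> by (simp add: \<phi>'_def)
  next
    case False
    have "cmod (\<phi>' t h) = \<bar>f' (g t)\<bar> * (2 * \<bar>(t - w) \<bullet> h\<bar> / \<rho>\<^sup>2)"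
      unfolding \<phi>'_def norm_of_real by (simp add: abs_mult)
    also have "\<dots> \<le> 4 * (2 * (2 * \<rho> * cmod h) / \<rho>\<^sup>2)"
    proof (intro mult_mono divide_right_mono f'4)
      have "\<bar>(t - w) \<bullet> h\<bar> \<le> cmod (t - w) * cmod h" by (rule Cauchy_Schwarz_ineq2)
      also have "\<dots> \<le> 2 * \<rho> * cmod h" using False by (intro mult_right_mono) auto
      finally show "\<bar>(t - w) \<bullet> h\<bar> \<le> 2 * \<rho> * cmod h" .
    qed auto
    also have "\<dots> = 16 / \<rho> * cmod h" using \<rho> by (simp add: power2_eq_square)
    finally show ?thesis .
  qed
  have 4: "continuous_on UNIV (\<lambda>t. \<phi>' t h)" for h
    unfolding \<phi>'_def f'_def g_def using \<rho> by (intro continuous_intros) auto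
  show ?thesis
  proof (rule that[of \<phi> \<phi>'])
    show "\<phi> t = 1" if "cmod (t - w) \<le> \<rho>" for t
    proof -
      have "1 \<le> (max 0 (g t))\<^sup>2" using g1[OF that] by simp
      then show ?thesis by (simp add: \<phi>_def f_def)
    qed
    show "\<phi> t = 0" if "2 * \<rho> < cmod (t - w)" for t
      using g0[OF that] by (simp add: \<phi>_def f_def)
    show "cmod (\<phi> t) \<le> 1" for t using f01[of "g t"] by (simp add: \<phi>_def)
  qed (use 1 3 4 in auto)
qed

lemma derivative_zero_outside:
  fixes f :: "complex \<Rightarrow> complex"
  assumes "(f has_derivative f') (at t)" "\<And>t. t \<notin> cball z \<rho> \<Longrightarrow> f t = 0" "t \<notin> cball z \<rho>"
  shows "f' h = 0"
proof -
  have "(f has_derivative (\<lambda>_. 0)) (at t)"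
    using has_derivative_const[of 0 "at t"]
    by (rule has_derivative_transform_within_open[of _ _ _ _ "- cball z \<rho>"]) (use assms in \<open>auto simp: open_Compl\<close>)
  then show ?thesis using has_derivative_unique[OF assms(1)] by metis
qed

section \<open>A coefficient with Hoelder continuous first derivatives\<close>

text \<open>
  The derivative of $(a(t)-a(z))/(t-z)^2$ with respect to $z$, as a real-linear map of
  the increment $h$.
\<close>

definition diff_kernel ::
  "(complex \<Rightarrow> complex) \<Rightarrow> (complex \<Rightarrow> complex \<Rightarrow> complex) \<Rightarrow> complex \<Rightarrow> complex \<Rightarrow> complex \<Rightarrow> complex" where
  "diff_kernel a a' z t h = 2 * h * (a t - a z) / (t - z) ^ 3 - a' z h / (t - z)\<^sup>2"

locale C1_coefficient =
  fixes a :: "complex \<Rightarrow> complex" and a' :: "complex \<Rightarrow> complex \<Rightarrow> complex" and \<alpha> A :: real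
  assumes \<alpha>: "0 < \<alpha>" "\<alpha> < 1"
    and a_deriv: "\<And>z. (a has_derivative a' z) (at z)"
    and a_bound: "\<And>z. cmod (a z) \<le> A"
    and a_holder: "holder_with \<alpha> A a"
    and a'_bound: "\<And>z h. cmod (a' z h) \<le> A * cmod h"
    and a'_holder: "\<And>h. holder_with \<alpha> (A * cmod h) (\<lambda>z. a' z h)"
begin

abbreviation "K \<equiv> diff_kernel a a'"

lemma A_nonneg: "0 \<le> A"
  by (rule holder_with_nonneg[OF a_holder])

lemma a_lipschitz: "cmod (a z - a w) \<le> A * cmod (z - w)"
  by (rule lipschitz_of_derivative[OF a_deriv a'_bound])

lemma a_continuous: "continuous_on UNIV a"
  by (rule holder_with_continuous[OF \<alpha>(1) a_holder])

lemma a'_linear: "bounded_linear (a' z)"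
  by (rule has_derivative_bounded_linear[OF a_deriv])

lemma K_linear: "linear (K z t)"
proof -
  interpret a': bounded_linear "a' z" by (rule a'_linear)
  have K: "K z t h = h * (2 * (a t - a z) / (t - z) ^ 3) - a' z h * (1 / (t - z)\<^sup>2)" for h
    by (simp add: diff_kernel_def mult_ac)
  show ?thesis
    unfolding K by (rule linearI) (simp_all only: a'.add a'.scaleR distrib_right mult_scaleR_left scaleR_diff_right add_diff_add)
qed

lemma K_bound: "cmod (K z t h) \<le> 3 * A * cmod h / (cmod (t - z))\<^sup>2"
proof (cases "t = z")
  case False
  have "cmod (2 * h * (a t - a z) / (t - z) ^ 3) \<le> 2 * cmod h * (A * cmod (t - z)) / cmod (t - z) ^ 3"
    unfolding norm_divide norm_mult norm_power norm_numeral using a_lipschitz[of t z]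
    by (intro divide_right_mono mult_left_mono) auto
  also have "\<dots> = 2 * A * cmod h / (cmod (t - z))\<^sup>2"
    using False by (simp add: power2_eq_square power3_eq_cube)
  finally have 1: "cmod (2 * h * (a t - a z) / (t - z) ^ 3) \<le> 2 * A * cmod h / (cmod (t - z))\<^sup>2" .
  have 2: "cmod (a' z h / (t - z)\<^sup>2) \<le> A * cmod h / (cmod (t - z))\<^sup>2"
    unfolding norm_divide norm_power using a'_bound[of z h] by (intro divide_right_mono) auto
  have "cmod (K z t h) \<le> 2 * A * cmod h / (cmod (t - z))\<^sup>2 + A * cmod h / (cmod (t - z))\<^sup>2"
    unfolding diff_kernel_def using 1 2 norm_triangle_ineq4 by (meson add_mono order_trans)
  also have "\<dots> = 3 * A * cmod h / (cmod (t - z))\<^sup>2"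
    by (simp add: add_divide_distrib[symmetric])
  finally show ?thesis .
qed (simp add: diff_kernel_def)

lemma K_diff:
  assumes t: "2 * cmod (z - w) \<le> cmod (t - w)" "t \<noteq> w"
  shows "cmod (K z t h - K w t h) \<le>
    cmod h * A * (126 * cmod (z - w) / cmod (t - w) ^ 3 + cmod (z - w) powr \<alpha> / (cmod (t - w))\<^sup>2)"
proof -
  let ?x = "t - z" and ?y = "t - w" and ?d = "cmod (z - w)"
  have xy: "cmod (?x - ?y) = ?d" by (simp add: norm_minus_commute)
  have y: "?y \<noteq> 0" and d: "2 * cmod (?x - ?y) \<le> cmod ?y" using t xy by auto
  note A = A_nonneg
  note x = far_norm_bounds(2)[OF d]
  note I2 = inverse_square_diff[OF y d, unfolded xy] and I3 = inverse_cube_diff[OF y d, unfolded xy]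
  have "cmod (a t - a z) \<le> A * (3 / 2 * cmod ?y)"
    using a_lipschitz[of t z] mult_left_mono[OF x A] by linarith
  then have 1: "cmod (2 * h * (a t - a z) * (1 / ?x ^ 3 - 1 / ?y ^ 3)) \<le>
      (2 * cmod h * (A * (3 / 2 * cmod ?y))) * (38 * ?d / cmod ?y ^ 4)"
    unfolding norm_mult using I3 A by (intro mult_mono) auto
  have 2: "cmod (2 * h * (a w - a z) / ?y ^ 3) \<le> 2 * cmod h * (A * ?d) / cmod ?y ^ 3"
    unfolding norm_divide norm_mult norm_power norm_numeral using a_lipschitz[of w z]
    by (intro divide_right_mono mult_left_mono) (auto simp: norm_minus_commute)
  have 3: "cmod (a' z h * (1 / ?x\<^sup>2 - 1 / ?y\<^sup>2)) \<le> (A * cmod h) * (10 * ?d / cmod ?y ^ 3)"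
    unfolding norm_mult using I2 a'_bound A by (intro mult_mono) auto
  have 4: "cmod ((a' z h - a' w h) / ?y\<^sup>2) \<le> (A * cmod h * ?d powr \<alpha>) / (cmod ?y)\<^sup>2"
    unfolding norm_divide norm_power using holder_withD[OF a'_holder] by (intro divide_right_mono) auto
  have "K z t h - K w t h = (2 * h * (a t - a z) * (1 / ?x ^ 3 - 1 / ?y ^ 3) + 2 * h * (a w - a z) / ?y ^ 3)
     - (a' z h * (1 / ?x\<^sup>2 - 1 / ?y\<^sup>2) + (a' z h - a' w h) / ?y\<^sup>2)"
    by (simp add: diff_kernel_def algebra_simps diff_divide_distrib)
  also have "cmod \<dots> \<le> ((2 * cmod h * (A * (3 / 2 * cmod ?y))) * (38 * ?d / cmod ?y ^ 4) + 2 * cmod h * (A * ?d) / cmod ?y ^ 3)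
     + ((A * cmod h) * (10 * ?d / cmod ?y ^ 3) + (A * cmod h * ?d powr \<alpha>) / (cmod ?y)\<^sup>2)"
    using 1 2 3 4 by (intro order_trans[OF norm_triangle_ineq4] add_mono order_trans[OF norm_triangle_ineq])
  also have "\<dots> = cmod h * A * (126 * ?d / cmod ?y ^ 3 + ?d powr \<alpha> / (cmod ?y)\<^sup>2)"
    using y by (simp add: field_simps power2_eq_square power3_eq_cube power4_eq_xxxx)
  finally show ?thesis .
qed

lemma kernel_has_derivative:
  assumes "t \<noteq> z"
  shows "((\<lambda>z. (a t - a z) / (t - z)\<^sup>2) has_derivative K z t) (at z within S)"
proof -
  have "((\<lambda>z. 1 / (t - z)\<^sup>2) has_field_derivative 2 / (t - z) ^ 3) (at z within S)"
  proof -
    have "((\<lambda>z. (t - z)\<^sup>2) has_field_derivative - (2 * (t - z))) (at z within S)"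
      by (auto intro!: derivative_eq_intros)
    note d = DERIV_divide[OF DERIV_const[of 1] this]
    have e: "(0 * x\<^sup>2 - 1 * - (2 * x)) / (x\<^sup>2 * x\<^sup>2) = 2 / x ^ 3" if "x \<noteq> 0" for x :: complex
      using that by (simp add: power2_eq_square power3_eq_cube)
    show ?thesis by (rule DERIV_cong[OF d e]) (use assms in simp_all)
  qed
  then have 1: "((\<lambda>z. 1 / (t - z)\<^sup>2) has_derivative (*) (2 / (t - z) ^ 3)) (at z within S)"
    by (simp add: has_field_derivative_def)
  have 2: "((\<lambda>z. a t - a z) has_derivative (\<lambda>h. - a' z h)) (at z within S)"
    using has_derivative_at_withinI[OF a_deriv] by (auto intro!: derivative_eq_intros)
  have "((\<lambda>z. (a t - a z) * (1 / (t - z)\<^sup>2)) has_derivative K z t) (at z within S)"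
    by (rule has_derivative_eq_rhs[OF has_derivative_mult[OF 2 1]]) (simp add: diff_kernel_def fun_eq_iff)
  then show ?thesis by simp
qed

text \<open>
  A second derivative of $a$ is not available, so the remainder is obtained from the mean value
  inequality: the derivative of the kernel differs from its value at $w$ by what \<open>K_diff\<close> allows,
  throughout the disc of radius $|z-w|$ about $w$.
\<close>

lemma kernel_taylor:
  assumes t: "2 * cmod (z - w) < cmod (t - w)"
  shows "cmod ((a t - a z) / (t - z)\<^sup>2 - (a t - a w) / (t - w)\<^sup>2 - K w t (z - w)) \<le>
    A * (126 * cmod (z - w) / cmod (t - w) ^ 3 + cmod (z - w) powr \<alpha> / (cmod (t - w))\<^sup>2) * cmod (z - w)"
proof -
  let ?d = "cmod (z - w)"
  let ?B = "A * (126 * ?d / cmod (t - w) ^ 3 + ?d powr \<alpha> / (cmod (t - w))\<^sup>2)"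
  let ?f = "\<lambda>z. (a t - a z) / (t - z)\<^sup>2 - K w t (z - w)"
  have B: "0 \<le> ?B" using A_nonneg by simp
  have tw: "t \<noteq> w" using t by (auto simp: not_less[symmetric])
  have lin: "bounded_linear (K w t)" using K_linear by (simp add: linear_conv_bounded_linear)
  have "cmod (?f z - ?f w) \<le> ?B * cmod (z - w)"
  proof (rule differentiable_bound[where S = "cball w ?d" and f' = "\<lambda>y h. K y t h - K w t h"])
    fix y assume y: "y \<in> cball w ?d"
    then have yd: "cmod (y - w) \<le> ?d" by (simp add: dist_norm norm_minus_commute)
    have "t \<noteq> y"
    proof
      assume "t = y"
      then have "cmod (t - w) \<le> ?d" using yd by simp
      then show False using t norm_ge_zero[of "z - w"] by linarith
    qed
    show "(?f has_derivative (\<lambda>h. K y t h - K w t h)) (at y within cball w ?d)"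
    proof (rule has_derivative_diff)
      show "((\<lambda>z. K w t (z - w)) has_derivative K w t) (at y within cball w ?d)"
        by (rule bounded_linear.has_derivative[OF lin, THEN has_derivative_eq_rhs])
           (auto intro!: derivative_eq_intros)
    qed (rule kernel_has_derivative[OF \<open>t \<noteq> y\<close>])
    show "onorm (\<lambda>h. K y t h - K w t h) \<le> ?B"
    proof (rule onorm_le)
      fix h
      have "2 * cmod (y - w) \<le> cmod (t - w)" using yd t by linarith
      from K_diff[OF this tw, of h] have "cmod (K y t h - K w t h) \<le>
        cmod h * A * (126 * cmod (y - w) / cmod (t - w) ^ 3 + cmod (y - w) powr \<alpha> / (cmod (t - w))\<^sup>2)" .
      also have "\<dots> \<le> cmod h * A * (126 * ?d / cmod (t - w) ^ 3 + ?d powr \<alpha> / (cmod (t - w))\<^sup>2)"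
        using A_nonneg yd \<alpha> by (intro mult_left_mono add_mono divide_right_mono powr_mono2) auto
      finally show "cmod (K y t h - K w t h) \<le> ?B * cmod h" by (simp add: mult_ac)
    qed
  qed (auto simp: dist_norm norm_minus_commute)
  moreover have "K w t (w - w) = 0" using linear_0[OF K_linear] by simp
  ultimately show ?thesis by (simp add: algebra_simps)
qed

end

section \<open>Differentiating the commutator\<close>

lemma has_derivative_of_holder_error:
  fixes f :: "complex \<Rightarrow> complex"
  assumes "linear G" "0 < \<alpha>" "\<And>h. cmod (f (z + h) - f z - G h) \<le> C * cmod h powr \<alpha> * cmod h"
  shows "(f has_derivative G) (at z)"
  unfolding has_derivative_at
proof (intro conjI)
  show "bounded_linear G" using assms(1) by (simp add: linear_conv_bounded_linear)
  show "(\<lambda>h. cmod (f (z + h) - f z - G h) / cmod h) \<midarrow>0\<rightarrow> 0"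
  proof (rule Lim_null_comparison)
    show "\<forall>\<^sub>F h in at 0. norm (cmod (f (z + h) - f z - G h) / cmod h) \<le> C * cmod h powr \<alpha>"
      unfolding eventually_at_filter using assms(3)
      by (intro always_eventually) (auto simp: divide_le_eq)
    have "((\<lambda>h::complex. C * cmod h powr \<alpha>) \<longlongrightarrow> C * cmod 0 powr \<alpha>) (at 0)"
      using assms(2) by (intro tendsto_intros tendsto_powr') auto
    then show "((\<lambda>h::complex. C * cmod h powr \<alpha>) \<longlongrightarrow> 0) (at 0)" by simp
  qed
qed

lemma comm_int_diff:
  assumes "0 < \<alpha>" "\<alpha> < 1" "holder_with \<alpha> A a" "bounded_in_ball \<rho> M u" "0 \<le> M"
    and "bounded_in_ball \<rho>' M' v" "0 \<le> M'"
  shows "comm_int a (\<lambda>t. u t - c * v t) z = comm_int a u z - c * comm_int a v z"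
proof -
  let ?k = "\<lambda>t. (a t - a z) / (t - z)\<^sup>2"
  have u: "integrable lebesgue (\<lambda>t. ?k t * u t)" and v: "integrable lebesgue (\<lambda>t. ?k t * v t)"
    by (rule commutator_kernel_integrable; fact assms)+
  have "comm_int a (\<lambda>t. u t - c * v t) z = (LINT t|lebesgue. ?k t * u t - c * (?k t * v t))"
    unfolding comm_int_def by (simp only: right_diff_distrib mult.left_commute)
  also have "\<dots> = (LINT t|lebesgue. ?k t * u t) - (LINT t|lebesgue. c * (?k t * v t))"
    by (rule Bochner_Integration.integral_diff[OF u integrable_mult_right[OF v]])
  finally show ?thesis by (simp only: comm_int_def integral_mult_right_zero)
qed

lemma lebesgue_integral_shift:
  fixes f :: "complex \<Rightarrow> complex"
  assumes "f \<in> borel_measurable borel"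
  shows "(LINT t|lebesgue. f t) = (LINT s|lborel. f (z + s))"
    and "integrable lebesgue f \<longleftrightarrow> integrable lborel (\<lambda>s. f (z + s))"
proof -
  have "(LINT t|lebesgue. f t) = (LINT t|distr lborel borel ((+) z). f t)"
    using assms by (simp add: lborel_distr_plus integral_completion)
  also have "\<dots> = (LINT s|lborel. f (z + s))"
    by (rule integral_distr) (use assms in auto)
  finally show "(LINT t|lebesgue. f t) = (LINT s|lborel. f (z + s))" .
  have "integrable lebesgue f \<longleftrightarrow> integrable (distr lborel borel ((+) z)) f"
    using assms by (simp add: lborel_distr_plus integrable_completion)
  also have "\<dots> \<longleftrightarrow> integrable lborel (\<lambda>s. f (z + s))"
    by (rule integrable_distr_eq) (use assms in auto)
  finally show "integrable lebesgue f \<longleftrightarrow> integrable lborel (\<lambda>s. f (z + s))" .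
qed

context C1_coefficient
begin

lemma K_measurable: "(\<lambda>t. K z t h) \<in> borel_measurable lebesgue"
proof -
  have a: "a \<in> borel_measurable borel" by (rule continuous_borel[OF a_continuous])
  have t: "(\<lambda>t. (t - z)\<^sup>2) \<in> borel_measurable borel" "(\<lambda>t. (t - z) ^ 3) \<in> borel_measurable borel" by simp_all
  show ?thesis unfolding diff_kernel_def
    by (intro borel_imp_lebesgue borel_measurable_divide borel_measurable_diff borel_measurable_times
        borel_measurable_const a t)
qed

lemma K_times_holder_bound:
  assumes "cmod x \<le> M * cmod (t - z) powr \<alpha>" "0 \<le> M"
  shows "cmod (K z t h * x) \<le> 3 * A * M * cmod h * cmod (t - z) powr (\<alpha> - 2)"
proof (cases "t = z")
  case False
  have "cmod (K z t h * x) \<le> (3 * A * cmod h / (cmod (t - z))\<^sup>2) * (M * cmod (t - z) powr \<alpha>)"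
    unfolding norm_mult using K_bound assms A_nonneg by (intro mult_mono) auto
  also have "\<dots> = 3 * A * M * cmod h * cmod (t - z) powr (\<alpha> - 2)"
    using powr_times_power[of "t - z" \<alpha> 2] False by simp
  finally show ?thesis .
qed (simp add: diff_kernel_def)

lemma K_integral_bounded:
  obtains C where "0 \<le> C" "\<And>v M z h. v \<in> borel_measurable lebesgue \<Longrightarrow>
    (\<And>t. cmod (v t) \<le> M * cmod (t - z) powr \<alpha>) \<Longrightarrow> (\<And>t. t \<notin> cball 0 \<rho> \<Longrightarrow> v t = 0) \<Longrightarrow> 0 \<le> M \<Longrightarrow>
    integrable lebesgue (\<lambda>t. K z t h * v t) \<and> cmod (LINT t|lebesgue. K z t h * v t) \<le> C * M * cmod h"
proof -
  obtain C where C: "0 < C"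
    "\<And>z. integrable lebesgue (\<lambda>t. indicator (cball 0 \<rho>) t * cmod (t - z) powr (\<alpha> - 2))"
    "\<And>z. (LINT t|lebesgue. indicator (cball 0 \<rho>) t * cmod (t - z) powr (\<alpha> - 2)) \<le> C"
    using ball_weight_integral[OF \<alpha>] by metis
  show ?thesis
  proof (rule that[of "3 * A * C"])
    show "0 \<le> 3 * A * C" using C(1) A_nonneg by simp
    fix v M z h
    assume v: "v \<in> borel_measurable lebesgue" "\<And>t. cmod (v t) \<le> M * cmod (t - z) powr \<alpha>"
      "\<And>t. t \<notin> cball 0 \<rho> \<Longrightarrow> v t = 0" "0 \<le> M"
    let ?w = "\<lambda>t. 3 * A * M * cmod h * (indicator (cball 0 \<rho>) t * cmod (t - z) powr (\<alpha> - 2))"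
    have m: "(\<lambda>t. K z t h * v t) \<in> borel_measurable lebesgue"
      by (intro borel_measurable_times K_measurable v)
    have b: "cmod (K z t h * v t) \<le> ?w t" for t
      using K_times_holder_bound[OF v(2,4), of t h] v(3)[of t] by (cases "t \<in> cball 0 \<rho>") auto
    have I: "integrable lebesgue ?w" using C(2) by simp
    have "(LINT t|lebesgue. ?w t) \<le> 3 * A * M * cmod h * C"
      unfolding integral_mult_right_zero using C(3) A_nonneg v(4) by (intro mult_left_mono) auto
    then show "integrable lebesgue (\<lambda>t. K z t h * v t) \<and> cmod (LINT t|lebesgue. K z t h * v t) \<le> 3 * A * C * M * cmod h"
      using integral_bounded_by[OF m I AE_I2[OF b]] by (auto simp: mult_ac)
  qed
qed

lemma K_integrable:
  assumes "v \<in> borel_measurable lebesgue" "\<And>t. cmod (v t) \<le> M * cmod (t - z) powr \<alpha>"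
    "\<And>t. t \<notin> cball 0 \<rho> \<Longrightarrow> v t = 0" "0 \<le> M"
  shows "integrable lebesgue (\<lambda>t. K z t h * v t)"
proof (rule K_integral_bounded[of \<rho>])
  fix C assume "\<And>v M z h. v \<in> borel_measurable lebesgue \<Longrightarrow>
    (\<And>t. cmod (v t) \<le> M * cmod (t - z) powr \<alpha>) \<Longrightarrow> (\<And>t. t \<notin> cball 0 \<rho> \<Longrightarrow> v t = 0) \<Longrightarrow> 0 \<le> M \<Longrightarrow>
    integrable lebesgue (\<lambda>t. K z t h * v t) \<and> cmod (LINT t|lebesgue. K z t h * v t) \<le> C * M * cmod h"
  from this[OF assms] show ?thesis by blast
qed

text \<open>
  The kernel itself is too singular to be differentiated under the integral sign, but $v$ vanishes
  to order $\alpha$ at $w$. In the far zone the Taylor remainder of the kernel times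
  $|t-w|^\alpha$ integrates to $O(|h|^{1+\alpha})$. In the near zone each of the three terms has this
  size by itself.
\<close>

lemma comm_int_has_derivative_vanishing:
  assumes v: "v \<in> borel_measurable lebesgue" "\<And>t. cmod (v t) \<le> M * cmod (t - w) powr \<alpha>"
    "\<And>t. t \<notin> cball 0 \<rho> \<Longrightarrow> v t = 0"
  shows "(comm_int a v has_derivative (\<lambda>h. LINT t|lebesgue. K w t h * v t)) (at w)"
proof -
  have M: "0 \<le> M" using v(2)[of "w + 1"] order_trans[OF norm_ge_zero] by fastforce
  obtain C where C: "0 < C" "\<And>\<delta> z. 0 < \<delta> \<Longrightarrow> integrable lebesgue (\<lambda>t. weight \<alpha> \<delta> (t - z))"
    "\<And>\<delta> z. 0 < \<delta> \<Longrightarrow> (LINT t|lebesgue. weight \<alpha> \<delta> (t - z)) \<le> C * \<delta> powr \<alpha>"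
    using weight_integral[OF \<alpha>] by metis
  obtain C' where C': "0 < C'"
    "\<And>z. integrable lebesgue (\<lambda>t. indicator (cball 0 \<rho>) t * cmod (t - z) powr (\<alpha> - 2))"
    "\<And>z. (LINT t|lebesgue. indicator (cball 0 \<rho>) t * cmod (t - z) powr (\<alpha> - 2)) \<le> C'"
    using ball_weight_integral[OF \<alpha>] by metis
  have KI: "integrable lebesgue (\<lambda>t. K w t h * v t)" for h
    by (rule K_integrable[OF v M])
  define B where "B = M * (\<bar>\<rho>\<bar> + cmod w) powr \<alpha>"
  have B: "0 \<le> B" using M by (simp add: B_def)
  have vb: "bounded_in_ball \<rho> B v"
    unfolding bounded_in_ball_def
  proof (intro conjI v(1) AE_I2)
    fix t
    show "cmod (v t) \<le> B * indicator (cball 0 \<rho>) t"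
    proof (cases "t \<in> cball 0 \<rho>")
      case True
      have "cmod (t - w) \<le> \<bar>\<rho>\<bar> + cmod w" using True norm_triangle_ineq4[of t w] by auto
      then have "M * cmod (t - w) powr \<alpha> \<le> B"
        unfolding B_def using M \<alpha> by (intro mult_left_mono powr_mono2) auto
      then show ?thesis using v(2)[of t] True by simp
    qed (use v(3) in simp)
  qed
  let ?k = "\<lambda>z t. (a t - a z) / (t - z)\<^sup>2"
  have kI: "integrable lebesgue (\<lambda>t. ?k z t * v t)" for z
    by (rule commutator_kernel_integrable[OF \<alpha> a_holder vb B])
  show ?thesis
  proof (rule has_derivative_of_holder_error[OF _ \<alpha>(1), of _ _ _ "A * M * (252 * C + C')"])
    show "linear (\<lambda>h. LINT t|lebesgue. K w t h * v t)"
    proof (rule linearI)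
      fix x y and r :: real
      have "(LINT t|lebesgue. K w t (x + y) * v t) = (LINT t|lebesgue. K w t x * v t + K w t y * v t)"
        by (simp add: linear_add[OF K_linear] distrib_right)
      also have "\<dots> = (LINT t|lebesgue. K w t x * v t) + (LINT t|lebesgue. K w t y * v t)"
        by (rule Bochner_Integration.integral_add[OF KI KI])
      finally show "(LINT t|lebesgue. K w t (x + y) * v t) = \<dots>" .
      show "(LINT t|lebesgue. K w t (r *\<^sub>R x) * v t) = r *\<^sub>R (LINT t|lebesgue. K w t x * v t)"
        by (simp add: linear_scale[OF K_linear])
    qed
    fix h
    show "cmod (comm_int a v (w + h) - comm_int a v w - (LINT t|lebesgue. K w t h * v t))
      \<le> A * M * (252 * C + C') * cmod h powr \<alpha> * cmod h"
    proof (cases "h = 0")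
      case True
      then show ?thesis using linear_0[OF K_linear] by simp
    next
      case False
      let ?z = "w + h" and ?d = "cmod h"
      have d: "0 < ?d" and zw: "?z - w = h" using False by auto
      let ?E = "\<lambda>t. ?k ?z t * v t - ?k w t * v t - K w t h * v t"
      let ?e = "\<lambda>t. indicator (cball 0 \<rho>) t * cmod (t - w) powr (\<alpha> - 2)"
      let ?W = "\<lambda>t. A * M * ?d * (126 * (weight \<alpha> ?d (t - ?z) + weight \<alpha> ?d (t - w)) + ?d powr \<alpha> * ?e t)"
      have eq: "comm_int a v ?z - comm_int a v w - (LINT t|lebesgue. K w t h * v t) = (LINT t|lebesgue. ?E t)"
        unfolding comm_int_def
        by (subst Bochner_Integration.integral_diff[OF Bochner_Integration.integrable_diff[OF kI kI] KI],
            subst Bochner_Integration.integral_diff[OF kI kI]) (rule refl)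
      have IE: "integrable lebesgue ?E"
        by (intro Bochner_Integration.integrable_diff kI KI)
      have b: "cmod (?E t) \<le> ?W t" for t
      proof (cases "2 * cmod (?z - w) < cmod (t - w)")
        case True
        let ?y = "t - w"
        have "2 * ?d < cmod ?y" using True unfolding zw .
        then have y: "?y \<noteq> 0" "?d \<le> cmod ?y" using d by (force, linarith)
        have "cmod (?E t) = cmod (?k ?z t - ?k w t - K w t (?z - w)) * cmod (v t)"
          unfolding zw by (simp add: left_diff_distrib flip: norm_mult)
        also have "\<dots> \<le> (A * (126 * ?d / cmod ?y ^ 3 + ?d powr \<alpha> / (cmod ?y)\<^sup>2) * ?d) *
            (M * cmod ?y powr \<alpha> * indicator (cball 0 \<rho>) t)"
          using kernel_taylor[OF True] v(2)[of t] v(3)[of t] A_nonneg unfolding zw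
          by (intro mult_mono) (auto simp: indicator_def M)
        also have "\<dots> = A * M * ?d * (126 * (weight \<alpha> ?d ?y * indicator (cball 0 \<rho>) t) + ?d powr \<alpha> * ?e t)"
          using powr_times_power[of ?y \<alpha> 2] y by (simp add: weight_far algebra_simps)
        also have "\<dots> \<le> ?W t"
          using A_nonneg M d by (intro mult_left_mono add_mono) (auto simp: weight_nonneg indicator_def)
        finally show ?thesis .
      next
        case False
        note nb = near_bounds[OF False, unfolded zw]
        then have nb3: "cmod (t - w) \<le> 3 * ?d" using d by linarith
        have lip: "cmod (?k z t * v t) \<le> 9 * A * M * ?d * weight \<alpha> ?d (t - z)"
          if z: "cmod (t - z) \<le> 3 * ?d" for z
        proof (cases "t = z")
          case False
          have "cmod (?k z t) \<le> A * (3 * ?d) powr (1 - \<alpha>) * cmod (t - z) powr (\<alpha> - 2)"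
          proof -
            have "cmod (?k z t) \<le> A * cmod (t - z) / (cmod (t - z))\<^sup>2"
              unfolding norm_divide norm_power using a_lipschitz[of t z] by (intro divide_right_mono) auto
            also have "\<dots> = A * (cmod (t - z) powr (1 - \<alpha>) * cmod (t - z) powr (\<alpha> - 2))"
              using False powr_times_power[of "t - z" 1 2] by (simp flip: powr_add)
            also have "\<dots> \<le> A * ((3 * ?d) powr (1 - \<alpha>) * cmod (t - z) powr (\<alpha> - 2))"
              using z A_nonneg \<alpha> by (intro mult_left_mono mult_right_mono powr_mono2) auto
            finally show ?thesis by (simp add: mult_ac)
          qed
          moreover have "cmod (v t) \<le> M * (3 * ?d) powr \<alpha>"
          proof -
            have "M * cmod (t - w) powr \<alpha> \<le> M * (3 * ?d) powr \<alpha>"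
              using nb3 M \<alpha> by (intro mult_left_mono powr_mono2) auto
            then show ?thesis using v(2)[of t] by linarith
          qed
          ultimately have "cmod (?k z t * v t) \<le>
            (A * (3 * ?d) powr (1 - \<alpha>) * cmod (t - z) powr (\<alpha> - 2)) * (M * (3 * ?d) powr \<alpha>)"
            unfolding norm_mult using A_nonneg by (intro mult_mono) auto
          also have "\<dots> = A * M * ((3 * ?d) powr (1 - \<alpha>) * (3 * ?d) powr \<alpha>) * cmod (t - z) powr (\<alpha> - 2)"
            by (simp add: mult_ac)
          also have "(3 * ?d) powr (1 - \<alpha>) * (3 * ?d) powr \<alpha> = 3 * ?d"
            using d by (simp flip: powr_add)
          also have "A * M * (3 * ?d) * cmod (t - z) powr (\<alpha> - 2) \<le> A * M * (3 * ?d) * (3 * weight \<alpha> ?d (t - z))"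
            using z A_nonneg M by (intro mult_left_mono powr_le_near) auto
          finally show ?thesis by simp
        qed (use A_nonneg M in \<open>auto simp: weight_nonneg\<close>)
        have "cmod (K w t h * v t) \<le> 3 * A * M * ?d * cmod (t - w) powr (\<alpha> - 2)"
          by (rule K_times_holder_bound[OF v(2) M])
        also have "\<dots> \<le> 3 * A * M * ?d * (2 * weight \<alpha> ?d (t - w))"
          using nb A_nonneg M by (intro mult_left_mono powr_le_near) auto
        finally have 3: "cmod (K w t h * v t) \<le> 6 * A * M * ?d * weight \<alpha> ?d (t - w)" by simp
        have "cmod (?E t) \<le> 9 * A * M * ?d * weight \<alpha> ?d (t - ?z) + 9 * A * M * ?d * weight \<alpha> ?d (t - w)
            + 6 * A * M * ?d * weight \<alpha> ?d (t - w)"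
          using lip[OF nb(2)] lip[OF nb3] 3
          by (intro order_trans[OF norm_triangle_ineq4] add_mono) auto
        also have "\<dots> = A * M * ?d * (9 * weight \<alpha> ?d (t - ?z) + 15 * weight \<alpha> ?d (t - w) + 0)"
          by (simp add: algebra_simps)
        also have "\<dots> \<le> A * M * ?d * (126 * weight \<alpha> ?d (t - ?z) + 126 * weight \<alpha> ?d (t - w) + ?d powr \<alpha> * ?e t)"
          using A_nonneg M d by (intro mult_left_mono add_mono mult_right_mono) (auto simp: weight_nonneg)
        finally show ?thesis by (simp add: algebra_simps)
      qed
      have I: "integrable lebesgue ?W" using C(2)[OF d] C'(2) by simp
      have "cmod (LINT t|lebesgue. ?E t) \<le> (LINT t|lebesgue. ?W t)"
        by (rule integral_bounded_by(2)[OF borel_measurable_integrable[OF IE] I AE_I2[OF b]])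
      also have "\<dots> = A * M * ?d * (126 * ((LINT t|lebesgue. weight \<alpha> ?d (t - ?z)) + (LINT t|lebesgue. weight \<alpha> ?d (t - w)))
          + ?d powr \<alpha> * (LINT t|lebesgue. ?e t))"
        using C(2)[OF d] C'(2) by simp
      also have "\<dots> \<le> A * M * ?d * (126 * (C * ?d powr \<alpha> + C * ?d powr \<alpha>) + ?d powr \<alpha> * C')"
        using C(3)[OF d] C'(3) A_nonneg M by (intro mult_left_mono add_mono) auto
      also have "\<dots> = A * M * (252 * C + C') * ?d powr \<alpha> * ?d" by (simp add: algebra_simps)
      finally show ?thesis unfolding eq .
    qed
  qed
qed

text \<open>
  The product rule. Both $a(z+s)-a(z)$ and its derivative in $z$ are $O(|s|^\alpha)$, so the difference
  quotients of the integrand are dominated by $|s|^{\alpha-2}$ on a fixed ball, and dominated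
  convergence applies.
\<close>

lemma comm_int_has_derivative_translation:
  assumes d: "\<And>t. (\<phi> has_derivative \<phi>' t) (at t)"
    and b: "\<And>t. cmod (\<phi> t) \<le> B" "\<And>t h. cmod (\<phi>' t h) \<le> B * cmod h"
    and c: "\<And>h. continuous_on UNIV (\<lambda>t. \<phi>' t h)"
    and supp: "\<And>t. t \<notin> cball 0 \<rho> \<Longrightarrow> \<phi> t = 0"
  shows "(comm_int a \<phi> has_derivative
    (\<lambda>h. comm_int a (\<lambda>t. \<phi>' t h) z + comm_int (\<lambda>t. a' t h) \<phi> z)) (at z)"
proof -
  have B: "0 \<le> B" using b(1)[of 0] order_trans[OF norm_ge_zero] by blast
  have supp': "\<phi>' t h = 0" if "t \<notin> cball 0 \<rho>" for t h
    by (rule derivative_zero_outside[OF d supp that])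
  have \<phi>_cont: "continuous_on UNIV \<phi>"
    using d by (intro continuous_at_imp_continuous_on) (auto intro: has_derivative_continuous)
  have in_ball: "bounded_in_ball \<rho> M f" if "continuous_on UNIV f" "\<And>t. cmod (f t) \<le> M" "\<And>t. t \<notin> cball 0 \<rho> \<Longrightarrow> f t = 0" for M f
    unfolding bounded_in_ball_def using that(1,2)
    by (intro conjI borel_imp_lebesgue continuous_borel AE_I2)
       (auto simp: indicator_def that(3))
  have a'c: "continuous_on UNIV (\<lambda>t. a' t h)" for h
    by (rule holder_with_continuous[OF \<alpha>(1) a'_holder])
  \<comment> \<open>After the substitution $t = z + s$ the singular factor $s^{-2}$ is fixed, and only \<open>\<Phi>\<close> depends on $z$.\<close>
  define \<Phi> where "\<Phi> z s = (a (z + s) - a z) * \<phi> (z + s)" for z s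
  define \<Phi>' where "\<Phi>' z s h = (a (z + s) - a z) * \<phi>' (z + s) h + (a' (z + s) h - a' z h) * \<phi> (z + s)" for z s h
  define G where "G h = comm_int a (\<lambda>t. \<phi>' t h) z + comm_int (\<lambda>t. a' t h) \<phi> z" for h
  have f0: "integrable lborel (\<lambda>s. \<Phi> z s / s\<^sup>2)" "comm_int a \<phi> z = (LINT s|lborel. \<Phi> z s / s\<^sup>2)" for z
  proof -
    have m: "(\<lambda>t. (a t - a z) / (t - z)\<^sup>2 * \<phi> t) \<in> borel_measurable borel"
      by (intro borel_measurable_times commutator_kernel_borel a_continuous continuous_borel \<phi>_cont)
    have "integrable lebesgue (\<lambda>t. (a t - a z) / (t - z)\<^sup>2 * \<phi> t)"
      by (rule commutator_kernel_integrable[OF \<alpha> a_holder in_ball[OF \<phi>_cont b(1) supp] B])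
    then show "integrable lborel (\<lambda>s. \<Phi> z s / s\<^sup>2)"
      unfolding lebesgue_integral_shift(2)[OF m, of z] by (simp add: \<Phi>_def)
    show "comm_int a \<phi> z = (LINT s|lborel. \<Phi> z s / s\<^sup>2)"
      unfolding comm_int_def lebesgue_integral_shift(1)[OF m, of z] by (simp add: \<Phi>_def)
  qed
  have f1: "integrable lborel (\<lambda>s. \<Phi>' z s h / s\<^sup>2)" "G h = (LINT s|lborel. \<Phi>' z s h / s\<^sup>2)" for h
  proof -
    let ?f = "\<lambda>t. (a t - a z) / (t - z)\<^sup>2 * \<phi>' t h" and ?g = "\<lambda>t. (a' t h - a' z h) / (t - z)\<^sup>2 * \<phi> t"
    have m: "?f \<in> borel_measurable borel" "?g \<in> borel_measurable borel"
      by (intro borel_measurable_times commutator_kernel_borel a_continuous continuous_borel \<phi>_cont c a'c)+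
    have "integrable lebesgue ?f"
      by (rule commutator_kernel_integrable[OF \<alpha> a_holder in_ball[OF c b(2) supp']]) (use B in simp_all)
    moreover have "integrable lebesgue ?g"
      by (rule commutator_kernel_integrable[OF \<alpha> a'_holder in_ball[OF \<phi>_cont b(1) supp] B])
    ultimately have I: "integrable lborel (\<lambda>s. ?f (z + s))" "integrable lborel (\<lambda>s. ?g (z + s))"
      using lebesgue_integral_shift(2)[OF m(1), of z] lebesgue_integral_shift(2)[OF m(2), of z] by blast+
    have e: "\<Phi>' z s h / s\<^sup>2 = ?f (z + s) + ?g (z + s)" for s
      by (simp add: \<Phi>'_def add_divide_distrib)
    show "integrable lborel (\<lambda>s. \<Phi>' z s h / s\<^sup>2)"
      unfolding e by (rule Bochner_Integration.integrable_add[OF I])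
    show "G h = (LINT s|lborel. \<Phi>' z s h / s\<^sup>2)"
      unfolding e Bochner_Integration.integral_add[OF I] G_def comm_int_def
        lebesgue_integral_shift(1)[OF m(1), of z] lebesgue_integral_shift(1)[OF m(2), of z] by (rule refl)
  qed
  have d\<Phi>: "((\<lambda>z. \<Phi> z s) has_derivative \<Phi>' z s) (at z)" for z s
  proof -
    have sh: "((\<lambda>z. z + s) has_derivative (\<lambda>h. h)) (at z)" by (auto intro!: derivative_eq_intros)
    have 1: "((\<lambda>z. a (z + s) - a z) has_derivative (\<lambda>h. a' (z + s) h - a' z h)) (at z)"
      by (rule has_derivative_diff[OF has_derivative_compose[OF sh a_deriv] a_deriv])
    from has_derivative_mult[OF 1 has_derivative_compose[OF sh d]]
    show ?thesis by (simp add: \<Phi>_def \<Phi>'_def[abs_def])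
  qed
  have \<Phi>'_bound: "cmod (\<Phi>' z s h) \<le> 2 * A * B * cmod s powr \<alpha> * cmod h" for z s h
  proof -
    have "cmod (\<Phi>' z s h) \<le> (A * cmod s powr \<alpha>) * (B * cmod h) + (A * cmod h * cmod s powr \<alpha>) * B"
      unfolding \<Phi>'_def
      using b holder_withD[OF a_holder, of "z + s" z] holder_withD[OF a'_holder, of "z + s" h z] A_nonneg
      by (intro order_trans[OF norm_triangle_ineq] add_mono; unfold norm_mult; intro mult_mono) auto
    then show ?thesis by (simp add: algebra_simps)
  qed
  have \<Phi>_lip: "cmod (\<Phi> z s - \<Phi> w s) \<le> 2 * A * B * cmod s powr \<alpha> * cmod (z - w)" for z w s
    by (rule lipschitz_of_derivative[OF d\<Phi> \<Phi>'_bound])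
  interpret \<Phi>': bounded_linear "\<Phi>' z s" for s
    by (rule has_derivative_bounded_linear[OF d\<Phi>])
  define r where "r = \<bar>\<rho>\<bar> + cmod z + 1"
  have r: "0 < r" by (auto simp: r_def add_nonneg_pos)
  have \<Phi>_supp: "\<Phi> (z + h) s = 0" if "cmod h \<le> 1" "r < cmod s" for h s
  proof -
    have "cmod s \<le> cmod (z + h + s) + cmod z + cmod h"
      using norm_triangle_ineq4[of "z + h + s" "z + h"] norm_triangle_ineq[of z h] by simp
    then have "z + h + s \<notin> cball 0 \<rho>" using that by (auto simp: r_def)
    then show ?thesis by (simp add: \<Phi>_def supp)
  qed
  have \<Phi>'_supp: "\<Phi>' z s h = 0" if "r < cmod s" for h s
  proof -
    have "cmod s \<le> cmod (z + s) + cmod z"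
      using norm_triangle_ineq4[of "z + s" z] by simp
    then have "z + s \<notin> cball 0 \<rho>" using that by (auto simp: r_def)
    then show ?thesis by (simp add: \<Phi>'_def supp supp')
  qed
  have "(comm_int a \<phi> has_derivative G) (at z)"
    unfolding has_derivative_at
  proof (intro conjI)
    have "linear G"
    proof (rule linearI)
      fix x y and c :: real
      show "G (x + y) = G x + G y"
        unfolding f1(2) \<Phi>'.add add_divide_distrib
        by (rule Bochner_Integration.integral_add[OF f1(1) f1(1)])
      show "G (c *\<^sub>R x) = c *\<^sub>R G x"
        unfolding f1(2) \<Phi>'.scaleR by (subst integral_scaleR_right[symmetric]) (simp add: scaleR_conv_of_real)
    qed
    then show "bounded_linear G" by (simp add: linear_conv_bounded_linear)
    let ?Q = "\<lambda>h s. (\<Phi> (z + h) s - \<Phi> z s - \<Phi>' z s h) / s\<^sup>2 / of_real (cmod h)"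
    have Q: "cmod (comm_int a \<phi> (z + h) - comm_int a \<phi> z - G h) / cmod h = cmod (LINT s|lborel. ?Q h s)" for h
    proof -
      have "(LINT s|lborel. ?Q h s) = (LINT s|lborel. \<Phi> (z + h) s / s\<^sup>2 - \<Phi> z s / s\<^sup>2 - \<Phi>' z s h / s\<^sup>2) / of_real (cmod h)"
        by (simp add: diff_divide_distrib flip: integral_divide_zero)
      also have "\<dots> = (comm_int a \<phi> (z + h) - comm_int a \<phi> z - G h) / of_real (cmod h)"
        unfolding f0(2) f1(2)
        by (subst Bochner_Integration.integral_diff[OF Bochner_Integration.integrable_diff[OF f0(1) f0(1)] f1(1)],
            subst Bochner_Integration.integral_diff[OF f0(1) f0(1)]) (rule refl)
      finally show ?thesis by (simp add: norm_divide)
    qed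
    have "((\<lambda>h. LINT s|lborel. ?Q h s) \<longlongrightarrow> (LINT s|(lborel::complex measure). 0)) (at 0 within ball 0 1)"
      unfolding tendsto_at_iff_sequentially comp_def
    proof (intro allI impI)
      fix X :: "nat \<Rightarrow> complex"
      assume X: "\<forall>i. X i \<in> ball 0 1 - {0}" "X \<longlonglongrightarrow> 0"
      have X1: "cmod (X i) \<le> 1" and X0: "X i \<noteq> 0" for i using X(1)[rule_format, of i] by auto
      show "(\<lambda>i. LINT s|lborel. ?Q (X i) s) \<longlonglongrightarrow> (LINT s|(lborel::complex measure). 0)"
      proof (rule integral_dominated_convergence[where
            w = "\<lambda>s. 4 * A * B * (indicator (cball 0 r) s * cmod (s - 0) powr (\<alpha> - 2))"])
        show "integrable lborel (\<lambda>s. 4 * A * B * (indicator (cball 0 r) s * cmod (s - 0) powr (\<alpha> - 2)))"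
        proof -
          have "integrable lborel (\<lambda>s. indicator (cball (0::complex) r) s * cmod (s - 0) powr (\<alpha> - 2))"
          proof -
            have "(\<lambda>s. indicator (cball (0::complex) r) s * cmod (s - 0) powr (\<alpha> - 2)) \<in> borel_measurable borel"
              by (intro borel_measurable_times borel_measurable_indicator powr_real_measurable) auto
            then show ?thesis
              using integrable_powr_cball[of \<alpha> r 0] \<alpha> r by (simp add: integrable_completion)
          qed
          then show ?thesis by (intro integrable_mult_right)
        qed
        show "AE s in lborel. (\<lambda>i. ?Q (X i) s) \<longlonglongrightarrow> 0"
        proof (intro AE_I2)
          fix s :: complex
          have "(\<lambda>h. cmod (\<Phi> (z + h) s - \<Phi> z s - \<Phi>' z s h) / cmod h) \<midarrow>0\<rightarrow> 0"
            using d\<Phi>[of s z] unfolding has_derivative_at by blast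
          then have "(\<lambda>i. cmod (\<Phi> (z + X i) s - \<Phi> z s - \<Phi>' z s (X i)) / cmod (X i)) \<longlonglongrightarrow> 0"
            using X(2) X0 unfolding tendsto_at_iff_sequentially comp_def by auto
          from tendsto_mult[OF this tendsto_const[of "1 / (cmod s)\<^sup>2"]]
          have "(\<lambda>i. cmod (?Q (X i) s)) \<longlonglongrightarrow> 0"
            by (simp add: norm_divide norm_power norm_mult mult.commute)
          then show "(\<lambda>i. ?Q (X i) s) \<longlonglongrightarrow> 0" by (rule tendsto_norm_zero_cancel)
        qed
        show "AE s in lborel. norm (?Q (X i) s) \<le> 4 * A * B * (indicator (cball 0 r) s * cmod (s - 0) powr (\<alpha> - 2))" for i
        proof (intro AE_I2)
          fix s :: complex
          show "norm (?Q (X i) s) \<le> 4 * A * B * (indicator (cball 0 r) s * cmod (s - 0) powr (\<alpha> - 2))"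
          proof (cases "r < cmod s \<or> s = 0")
            case True
            then show ?thesis
              using \<Phi>_supp[OF X1, of s i] \<Phi>_supp[of 0 s] \<Phi>'_supp[of s] A_nonneg B by auto
          next
            case False
            have "cmod (\<Phi> (z + X i) s - \<Phi> z s - \<Phi>' z s (X i)) \<le>
                2 * A * B * cmod s powr \<alpha> * cmod (X i) + 2 * A * B * cmod s powr \<alpha> * cmod (X i)"
              using \<Phi>_lip[of "z + X i" s z]
              by (intro order_trans[OF norm_triangle_ineq4 add_mono[OF _ \<Phi>'_bound]]) simp
            also have "\<dots> = 4 * A * B * cmod s powr \<alpha> * cmod (X i)" by simp
            finally have "norm (?Q (X i) s) \<le> 4 * A * B * cmod s powr \<alpha> * cmod (X i) / (cmod s)\<^sup>2 / cmod (X i)"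
              unfolding norm_divide norm_power norm_of_real abs_norm_cancel by (intro divide_right_mono) auto
            also have "\<dots> = 4 * A * B * cmod s powr (\<alpha> - 2)"
              using False X0[of i] powr_times_power[of s \<alpha> 2] by simp
            finally show ?thesis using False by simp
          qed
        qed
        show "?Q (X i) \<in> borel_measurable lborel" for i
        proof -
          have "integrable lborel (\<lambda>s. \<Phi> (z + X i) s / s\<^sup>2 - \<Phi> z s / s\<^sup>2 - \<Phi>' z s (X i) / s\<^sup>2)"
            by (intro Bochner_Integration.integrable_diff f0 f1)
          then show ?thesis
            unfolding diff_divide_distrib[symmetric] by (intro borel_measurable_integrable integrable_divide_zero) auto
        qed
      qed auto
    qed
    then have "((\<lambda>h. LINT s|lborel. ?Q h s) \<longlongrightarrow> 0) (at 0)"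
      using at_within_open[of 0 "ball (0::complex) 1"] by simp
    then show "(\<lambda>h. cmod (comm_int a \<phi> (z + h) - comm_int a \<phi> z - G h) / cmod h) \<midarrow>0\<rightarrow> 0"
      unfolding Q by (rule tendsto_norm_zero)
  qed
  then show ?thesis by (simp add: G_def[abs_def])
qed

text \<open>
  For a cut-off of radius $\delta$ the derivative costs a factor $1/\delta$, which the Lipschitz bound
  $|k(w,t)| = O(|t-w|^{-1})$, integrated over a disc of radius $2\delta$, compensates exactly. The
  second summand is even $O(\delta^\alpha)$.
\<close>

lemma cutoff_product_rule_bounded:
  obtains C where "0 \<le> C"
    "\<And>\<eta> \<eta>' \<delta> w h. 0 < \<delta> \<Longrightarrow> \<delta> \<le> 1 \<Longrightarrow> cmod h \<le> 1 \<Longrightarrow> (\<And>t. (\<eta> has_derivative \<eta>' t) (at t)) \<Longrightarrow>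
      (\<And>t. cmod (\<eta> t) \<le> 1) \<Longrightarrow> (\<And>t h. cmod (\<eta>' t h) \<le> 16 / \<delta> * cmod h) \<Longrightarrow>
      (\<And>h. continuous_on UNIV (\<lambda>t. \<eta>' t h)) \<Longrightarrow> (\<And>t. t \<notin> cball w (2 * \<delta>) \<Longrightarrow> \<eta> t = 0) \<Longrightarrow>
      cmod (comm_int a (\<lambda>t. \<eta>' t h) w + comm_int (\<lambda>t. a' t h) \<eta> w) \<le> C"
proof -
  obtain C where C: "0 < C" "\<And>\<delta> z. 0 < \<delta> \<Longrightarrow> integrable lebesgue (\<lambda>t. weight \<alpha> \<delta> (t - z))"
    "\<And>\<delta> z. 0 < \<delta> \<Longrightarrow> (LINT t|lebesgue. weight \<alpha> \<delta> (t - z)) \<le> C * \<delta> powr \<alpha>"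
    using weight_integral[OF \<alpha>] by metis
  show ?thesis
  proof (rule that[of "66 * A * C"])
    show "0 \<le> 66 * A * C" using C(1) A_nonneg by simp
    fix \<eta> \<eta>' w h and \<delta> :: real
    assume \<delta>: "0 < \<delta>" "\<delta> \<le> 1" and h: "cmod h \<le> 1"
      and d: "\<And>t. (\<eta> has_derivative \<eta>' t) (at t)"
      and b: "\<And>t. cmod (\<eta> t) \<le> 1" "\<And>t h. cmod (\<eta>' t h) \<le> 16 / \<delta> * cmod h"
      and c: "\<And>h. continuous_on UNIV (\<lambda>t. \<eta>' t h)"
      and supp: "\<And>t. t \<notin> cball w (2 * \<delta>) \<Longrightarrow> \<eta> t = 0"
    have supp': "\<eta>' t h = 0" if "t \<notin> cball w (2 * \<delta>)" for t
      by (rule derivative_zero_outside[OF d supp that])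
    have \<eta>_cont: "continuous_on UNIV \<eta>"
      using d by (intro continuous_at_imp_continuous_on) (auto intro: has_derivative_continuous)
    have a'c: "continuous_on UNIV (\<lambda>t. a' t h)"
      by (rule holder_with_continuous[OF \<alpha>(1) a'_holder])
    let ?f = "\<lambda>t. (a t - a w) / (t - w)\<^sup>2 * \<eta>' t h" and ?g = "\<lambda>t. (a' t h - a' w h) / (t - w)\<^sup>2 * \<eta> t"
    have m: "?f \<in> borel_measurable lebesgue" "?g \<in> borel_measurable lebesgue"
      by (intro borel_imp_lebesgue borel_measurable_times commutator_kernel_borel a_continuous continuous_borel \<eta>_cont c a'c)+
    have I: "integrable lebesgue (\<lambda>t. M * weight \<alpha> \<delta> (t - w))" for M
      using C(2)[OF \<delta>(1)] by simp
    have I_le: "(LINT t|lebesgue. M * weight \<alpha> \<delta> (t - w)) \<le> M * (C * \<delta> powr \<alpha>)" if "0 \<le> M" for M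
      unfolding integral_mult_right_zero using C(3)[OF \<delta>(1)] that by (intro mult_left_mono) auto
    have fb: "cmod (?f t) \<le> (64 * A * \<delta> powr (- \<alpha>)) * weight \<alpha> \<delta> (t - w)" for t
    proof (cases "t \<in> cball w (2 * \<delta>) \<and> t \<noteq> w")
      case True
      then have tw: "cmod (t - w) \<le> 2 * \<delta>" by (simp add: dist_norm norm_minus_commute)
      have "cmod ((a t - a w) / (t - w)\<^sup>2) \<le> A * cmod (t - w) / (cmod (t - w))\<^sup>2"
        unfolding norm_divide norm_power using a_lipschitz[of t w] by (intro divide_right_mono) auto
      also have "\<dots> = A * (cmod (t - w) powr (1 - \<alpha>) * cmod (t - w) powr (\<alpha> - 2))"
        using True powr_times_power[of "t - w" 1 2] by (simp flip: powr_add)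
      also have "\<dots> \<le> A * ((2 * \<delta>) powr (1 - \<alpha>) * cmod (t - w) powr (\<alpha> - 2))"
        using tw A_nonneg \<alpha> by (intro mult_left_mono mult_right_mono powr_mono2) auto
      also have "\<dots> \<le> A * ((2 * \<delta> powr (1 - \<alpha>)) * (2 * weight \<alpha> \<delta> (t - w)))"
        using \<alpha> \<delta> by (intro mult_left_mono mult_mono powr_le_near tw A_nonneg powr_le_multiple) auto
      finally have k: "cmod ((a t - a w) / (t - w)\<^sup>2) \<le> A * ((2 * \<delta> powr (1 - \<alpha>)) * (2 * weight \<alpha> \<delta> (t - w)))" .
      have "16 / \<delta> * cmod h \<le> 16 / \<delta> * 1" using h \<delta> by (intro mult_left_mono) auto
      then have e: "cmod (\<eta>' t h) \<le> 16 / \<delta>" using b(2)[of t h] by linarith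
      have "cmod (?f t) \<le> (A * ((2 * \<delta> powr (1 - \<alpha>)) * (2 * weight \<alpha> \<delta> (t - w)))) * (16 / \<delta>)"
        unfolding norm_mult using k e A_nonneg \<delta> by (intro mult_mono) (auto simp: weight_nonneg)
      also have "\<dots> = 64 * A * (\<delta> powr (1 - \<alpha>) / \<delta>) * weight \<alpha> \<delta> (t - w)" by simp
      also have "\<delta> powr (1 - \<alpha>) / \<delta> = \<delta> powr (- \<alpha>)"
        using \<delta> by (simp add: powr_diff powr_minus field_simps)
      finally show ?thesis .
    next
      case False
      then have "?f t = 0" using supp'[of t] by auto
      then show ?thesis using A_nonneg \<delta> by (auto simp: weight_nonneg)
    qed
    have gb: "cmod (?g t) \<le> 2 * A * weight \<alpha> \<delta> (t - w)" for t
    proof (cases "t \<in> cball w (2 * \<delta>)")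
      case True
      then have tw: "cmod (t - w) \<le> 2 * \<delta>" by (simp add: dist_norm norm_minus_commute)
      have "cmod (?g t) \<le> (A * cmod h * cmod (t - w) powr (\<alpha> - 2)) * 1"
        unfolding norm_mult using commutator_kernel_bound[OF a'_holder] b(1) A_nonneg by (intro mult_mono) auto
      also have "\<dots> \<le> (A * 1 * (2 * weight \<alpha> \<delta> (t - w))) * 1"
        using h A_nonneg tw \<delta> by (intro mult_mono powr_le_near) (auto simp: weight_nonneg)
      finally show ?thesis by simp
    next
      case False
      then show ?thesis using A_nonneg \<delta> supp[of t] by (auto simp: weight_nonneg)
    qed
    have "cmod (comm_int a (\<lambda>t. \<eta>' t h) w) \<le> (64 * A * \<delta> powr (- \<alpha>)) * (C * \<delta> powr \<alpha>)"
      unfolding comm_int_def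
      by (rule order_trans[OF integral_bounded_by(2)[OF m(1) I AE_I2[OF fb]] I_le]) (use A_nonneg in simp)
    also have "\<dots> = 64 * A * C" using \<delta> by (simp add: powr_minus field_simps)
    finally have 1: "cmod (comm_int a (\<lambda>t. \<eta>' t h) w) \<le> 64 * A * C" .
    have "cmod (comm_int (\<lambda>t. a' t h) \<eta> w) \<le> (2 * A) * (C * \<delta> powr \<alpha>)"
      unfolding comm_int_def
      by (rule order_trans[OF integral_bounded_by(2)[OF m(2) I AE_I2[OF gb]] I_le]) (use A_nonneg in simp)
    also have "\<dots> \<le> (2 * A) * (C * 1)"
      using \<delta> \<alpha> A_nonneg C(1) by (intro mult_left_mono powr_le1) auto
    finally show "cmod (comm_int a (\<lambda>t. \<eta>' t h) w + comm_int (\<lambda>t. a' t h) \<eta> w) \<le> 66 * A * C"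
      using 1 by (intro order_trans[OF norm_triangle_ineq]) auto
  qed
qed

text \<open>
  In the first summand the derivative of the cut-off is merely continuous and bounded. This is
  enough, because the Lipschitz function $a$ is Hoelder continuous with the exponent
  $(1+\alpha)/2 > \alpha$, so that bounded functions are mapped to $C^\alpha$. In the second summand
  the coefficient has only the exponent $\alpha$, but the cut-off is Lipschitz.
\<close>

lemma cutoff_product_rule_holder:
  assumes \<kappa>: "\<And>t. (\<kappa> has_derivative \<kappa>' t) (at t)" "\<And>t. cmod (\<kappa> t) \<le> B" "\<And>t h. cmod (\<kappa>' t h) \<le> B * cmod h"
    "\<And>h. continuous_on UNIV (\<lambda>t. \<kappa>' t h)" "\<And>t. t \<notin> cball 0 \<rho> \<Longrightarrow> \<kappa> t = 0"
  obtains C where "0 \<le> C"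
    "\<And>h. cmod h \<le> 1 \<Longrightarrow> holder_bd \<alpha> C (\<lambda>z. comm_int a (\<lambda>t. \<kappa>' t h) z + comm_int (\<lambda>t. a' t h) \<kappa> z)"
proof -
  let ?\<gamma> = "(1 + \<alpha>) / 2"
  have \<gamma>: "\<alpha> < ?\<gamma>" "?\<gamma> < 1" "0 < ?\<gamma>" using \<alpha> by auto
  have B: "0 \<le> B" using \<kappa>(2)[of 0] order_trans[OF norm_ge_zero] by blast
  obtain C1 where C1: "0 \<le> C1"
    "\<And>a A u M. holder_with ?\<gamma> A a \<Longrightarrow> bounded_in_ball \<rho> M u \<Longrightarrow> 0 \<le> M \<Longrightarrow> holder_bd \<alpha> (C1 * A * M) (comm_int a u)"
    by (rule comm_int_holder_of_bounded[OF \<alpha>(1) \<gamma>(1,2), of \<rho>]) (rule that; blast)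
  obtain C2 where C2: "0 \<le> C2"
    "\<And>a A u M. holder_with \<alpha> A a \<Longrightarrow> holder_bd \<alpha> M u \<Longrightarrow> (\<And>t. t \<notin> cball 0 \<rho> \<Longrightarrow> u t = 0) \<Longrightarrow>
      holder_bd \<alpha> (C2 * A * M) (comm_int a u)"
    by (rule comm_int_holder_of_holder[OF \<alpha> \<alpha>, of \<rho>]) (rule that; blast)
  have a\<gamma>: "holder_with ?\<gamma> (3 * A) a"
    using holder_bdD(2)[OF holder_bd_of_lipschitz[OF a_bound a_lipschitz \<gamma>(3,2)]] by simp
  have \<kappa>h: "holder_bd \<alpha> (3 * B) \<kappa>"
    using holder_bd_of_lipschitz[OF \<kappa>(2) lipschitz_of_derivative[OF \<kappa>(1,3)] \<alpha>] by simp
  have supp': "\<kappa>' t h = 0" if "t \<notin> cball 0 \<rho>" for t h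
    by (rule derivative_zero_outside[OF \<kappa>(1,5) that])
  show ?thesis
  proof (rule that[of "C1 * (3 * A) * B + C2 * A * (3 * B)"])
    show "0 \<le> C1 * (3 * A) * B + C2 * A * (3 * B)" using C1(1) C2(1) A_nonneg B by simp
    fix h :: complex assume h: "cmod h \<le> 1"
    have \<kappa>'B: "cmod (\<kappa>' t h) \<le> B" for t
      using \<kappa>(3)[of t h] mult_left_mono[OF h B] by simp
    have "bounded_in_ball \<rho> B (\<lambda>t. \<kappa>' t h)"
      unfolding bounded_in_ball_def
      using \<kappa>'B supp' by (intro conjI borel_imp_lebesgue continuous_borel \<kappa>(4) AE_I2) (auto simp: indicator_def)
    then have 1: "holder_bd \<alpha> (C1 * (3 * A) * B) (comm_int a (\<lambda>t. \<kappa>' t h))"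
      by (rule C1(2)[OF a\<gamma> _ B])
    have "A * cmod h * x \<le> A * x" if "0 \<le> x" for x
      using mult_left_mono[OF h A_nonneg] that by (simp add: mult_right_mono)
    then have "holder_with \<alpha> A (\<lambda>z. a' z h)"
      using a'_holder[of h] unfolding holder_with_def by (meson order_trans powr_ge_zero)
    then have 2: "holder_bd \<alpha> (C2 * A * (3 * B)) (comm_int (\<lambda>t. a' t h) \<kappa>)"
      by (rule C2(2)[OF _ \<kappa>h \<kappa>(5)])
    show "holder_bd \<alpha> (C1 * (3 * A) * B + C2 * A * (3 * B))
        (\<lambda>z. comm_int a (\<lambda>t. \<kappa>' t h) z + comm_int (\<lambda>t. a' t h) \<kappa> z)"
      by (rule holder_bd_add[OF 1 2])
  qed
qed

text \<open>
  The case of least regularity of $u$, by subtraction of $u(z)$ times a fixed cut-off and comparison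
  with a cut-off whose radius is the distance of the two points.
\<close>

lemma comm_int_derivative_holder:
  assumes R: "0 < R"
  obtains C where "0 \<le> C"
    "\<And>u M. holder_bd \<alpha> M u \<Longrightarrow> (\<And>t. t \<notin> cball 0 R \<Longrightarrow> u t = 0) \<Longrightarrow>
      \<exists>g'. (\<forall>z. (comm_int a u has_derivative g' z) (at z)) \<and>
        (\<forall>h. cmod h \<le> 1 \<longrightarrow> holder_bd \<alpha> (C * M) (\<lambda>z. g' z h))"
proof -
  let ?R = "R + 1"
  define \<rho> where "\<rho> = 2 * ?R"
  have \<rho>: "R \<le> \<rho>" "R + 2 \<le> \<rho>" "0 < ?R" using R by (auto simp: \<rho>_def)
  obtain \<kappa> \<kappa>' where \<kappa>: "\<And>t. (\<kappa> has_derivative \<kappa>' t) (at t)"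
    "\<And>t. cmod (\<kappa> t) \<le> 1" "\<And>t h. cmod (\<kappa>' t h) \<le> 16 / ?R * cmod h"
    "\<And>h. continuous_on UNIV (\<lambda>t. \<kappa>' t h)"
    "\<And>t. cmod (t - 0) \<le> ?R \<Longrightarrow> \<kappa> t = 1" "\<And>t. 2 * ?R < cmod (t - 0) \<Longrightarrow> \<kappa> t = 0"
    using cutoff_exists[OF \<rho>(3), of 0] by metis
  have \<kappa>'16: "cmod (\<kappa>' t h) \<le> 16 * cmod h" for t h
  proof -
    have "16 / ?R * cmod h \<le> 16 * cmod h" using R by (intro mult_right_mono) (auto simp: divide_le_eq)
    then show ?thesis using \<kappa>(3)[of t h] by linarith
  qed
  have \<kappa>_supp: "\<kappa> t = 0" if "t \<notin> cball 0 \<rho>" for t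
    using \<kappa>(6)[of t] that by (simp add: \<rho>_def)
  have \<kappa>1: "cmod (\<kappa> t) \<le> 16" for t using \<kappa>(2)[of t] by linarith
  have \<kappa>_lip: "cmod (\<kappa> t - \<kappa> s) \<le> 16 * cmod (t - s)" for t s
    by (rule lipschitz_of_derivative[OF \<kappa>(1) \<kappa>'16])
  have \<kappa>_hol: "holder_bd \<alpha> 48 \<kappa>"
    using holder_bd_of_lipschitz[OF \<kappa>1 \<kappa>_lip \<alpha>] by simp
  let ?b = "\<lambda>h z. comm_int a (\<lambda>t. \<kappa>' t h) z + comm_int (\<lambda>t. a' t h) \<kappa> z"
  obtain Cb where Cb: "0 \<le> Cb" "\<And>h. cmod h \<le> 1 \<Longrightarrow> holder_bd \<alpha> Cb (?b h)"
    by (rule cutoff_product_rule_holder[where \<rho> = \<rho>, OF \<kappa>(1) \<kappa>1 \<kappa>'16 \<kappa>(4) \<kappa>_supp]) (assumption, (rule that; blast))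
  obtain Ce where Ce: "0 \<le> Ce"
    "\<And>\<eta> \<eta>' \<delta> w h. 0 < \<delta> \<Longrightarrow> \<delta> \<le> 1 \<Longrightarrow> cmod h \<le> 1 \<Longrightarrow> (\<And>t. (\<eta> has_derivative \<eta>' t) (at t)) \<Longrightarrow>
      (\<And>t. cmod (\<eta> t) \<le> 1) \<Longrightarrow> (\<And>t h. cmod (\<eta>' t h) \<le> 16 / \<delta> * cmod h) \<Longrightarrow>
      (\<And>h. continuous_on UNIV (\<lambda>t. \<eta>' t h)) \<Longrightarrow> (\<And>t. t \<notin> cball w (2 * \<delta>) \<Longrightarrow> \<eta> t = 0) \<Longrightarrow>
      cmod (comm_int a (\<lambda>t. \<eta>' t h) w + comm_int (\<lambda>t. a' t h) \<eta> w) \<le> Ce"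
    by (rule cutoff_product_rule_bounded) (rule that; blast)
  obtain CK where CK: "0 \<le> CK" "\<And>v M z h. v \<in> borel_measurable lebesgue \<Longrightarrow>
    (\<And>t. cmod (v t) \<le> M * cmod (t - z) powr \<alpha>) \<Longrightarrow> (\<And>t. t \<notin> cball 0 \<rho> \<Longrightarrow> v t = 0) \<Longrightarrow> 0 \<le> M \<Longrightarrow>
    integrable lebesgue (\<lambda>t. K z t h * v t) \<and> cmod (LINT t|lebesgue. K z t h * v t) \<le> CK * M * cmod h"
    by (rule K_integral_bounded[of \<rho>]) (rule that; blast)
  obtain C where C: "0 < C" "\<And>\<delta> z. 0 < \<delta> \<Longrightarrow> integrable lebesgue (\<lambda>t. weight \<alpha> \<delta> (t - z))"
    "\<And>\<delta> z. 0 < \<delta> \<Longrightarrow> (LINT t|lebesgue. weight \<alpha> \<delta> (t - z)) \<le> C * \<delta> powr \<alpha>"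
    using weight_integral[OF \<alpha>] by metis
  obtain C' where C': "0 < C'"
    "\<And>z. integrable lebesgue (\<lambda>t. indicator (cball 0 \<rho>) t * cmod (t - z) powr (\<alpha> - 2))"
    "\<And>z. (LINT t|lebesgue. indicator (cball 0 \<rho>) t * cmod (t - z) powr (\<alpha> - 2)) \<le> C'"
    using ball_weight_integral[OF \<alpha>] by metis
  \<comment> \<open>49 is the Hoelder constant of \<open>v z\<close> at \<open>z\<close> (1 from \<open>u\<close>, 48 from \<open>\<kappa>\<close>); 113 = 49 + 64 also
     accounts for the cut-off at scale \<open>cmod (z - w)\<close>.\<close>
  define CG where "CG = 2 * (CK * 49) + A * 113 * (504 * C + 2 * C') + (Cb + Ce)"
  have CG0: "0 \<le> CG" "CK * 49 \<le> CG" "2 * (CK * 49) \<le> CG" "A * 113 * (504 * C + 2 * C') + (Cb + Ce) \<le> CG"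
    using CK(1) A_nonneg C(1) C'(1) Cb(1) Ce(1) by (auto simp: CG_def)
  show ?thesis
  proof (rule that[of "CG + 2 * Cb"])
    show "0 \<le> CG + 2 * Cb" using CG0(1) Cb(1) by simp
    fix u M
    assume u: "holder_bd \<alpha> M u" and supp: "\<And>t. t \<notin> cball 0 R \<Longrightarrow> u t = 0"
    have M: "0 \<le> M" by (rule holder_bdD(4)[OF u])
    have ub: "bounded_in_ball R M u"
      by (rule holder_bd_supp_bounded_in_ball[OF \<alpha>(1) u supp])
    have \<kappa>b: "bounded_in_ball \<rho> 48 \<kappa>"
      by (rule holder_bd_supp_bounded_in_ball[OF \<alpha>(1) \<kappa>_hol \<kappa>_supp])
    define v where "v z t = u t - u z * \<kappa> t" for z t
    have v_meas: "v z \<in> borel_measurable lebesgue" for z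
      using ub \<kappa>b unfolding v_def bounded_in_ball_def
      by (intro borel_measurable_diff borel_measurable_times borel_measurable_const) auto
    have v_supp: "v z t = 0" if "t \<notin> cball 0 \<rho>" for z t
      using supp[of t] \<kappa>_supp[OF that] that \<rho>(1) by (auto simp: v_def)
    have v_bound: "cmod (v z t) \<le> (49 * M) * cmod (t - z) powr \<alpha>" for z t
    proof (cases "z \<in> cball 0 R")
      case True
      then have "\<kappa> z = 1" using \<kappa>(5)[of z] by simp
      then have "v z t = (u t - u z) + u z * (\<kappa> z - \<kappa> t)" by (simp add: v_def algebra_simps)
      also have "cmod \<dots> \<le> M * cmod (t - z) powr \<alpha> + M * (48 * cmod (z - t) powr \<alpha>)"
      proof (rule order_trans[OF norm_triangle_ineq add_mono[OF holder_bdD(3)[OF u]]])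
        show "cmod (u z * (\<kappa> z - \<kappa> t)) \<le> M * (48 * cmod (z - t) powr \<alpha>)"
          unfolding norm_mult using holder_bdD(1)[OF u] holder_bdD(3)[OF \<kappa>_hol] M by (intro mult_mono) auto
      qed
      finally show ?thesis by (simp add: norm_minus_commute)
    next
      case False
      then have "cmod (v z t) = cmod (u t - u z)" using supp[OF False] by (simp add: v_def)
      also have "\<dots> \<le> M * cmod (t - z) powr \<alpha>" by (rule holder_bdD(3)[OF u])
      also have "\<dots> \<le> (49 * M) * cmod (t - z) powr \<alpha>" using M by (intro mult_right_mono) auto
      finally show ?thesis .
    qed
    have M49: "0 \<le> 49 * M" using M by simp
    define G where "G h z = (LINT t|lebesgue. K z t h * v z t)" for h z
    have GI: "integrable lebesgue (\<lambda>t. K z t h * v z t)" for h z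
      using CK(2)[OF v_meas v_bound v_supp M49] by blast
    define g' where "g' z h = G h z + u z * ?b h z" for z h
    have deriv: "(comm_int a u has_derivative g' z) (at z)" for z
    proof -
      have "comm_int a u = (\<lambda>x. comm_int a (v z) x + u z * comm_int a \<kappa> x)"
      proof
        fix x
        show "comm_int a u x = comm_int a (v z) x + u z * comm_int a \<kappa> x"
          unfolding v_def comm_int_diff[OF \<alpha> a_holder ub M \<kappa>b holder_bdD(4)[OF \<kappa>_hol]] by simp
      qed
      moreover have "((\<lambda>x. comm_int a (v z) x + u z * comm_int a \<kappa> x) has_derivative g' z) (at z)"
        unfolding g'_def G_def
        by (intro has_derivative_add has_derivative_mult_right
            comm_int_has_derivative_vanishing[OF v_meas v_bound v_supp]
            comm_int_has_derivative_translation[OF \<kappa>(1) \<kappa>1 \<kappa>'16 \<kappa>(4) \<kappa>_supp])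
      ultimately show ?thesis by simp
    qed
    have G_bound: "cmod (G h z) \<le> CK * 49 * M" if "cmod h \<le> 1" for h z
    proof -
      have "cmod (G h z) \<le> CK * (49 * M) * cmod h"
        unfolding G_def using CK(2)[OF v_meas v_bound v_supp M49] by blast
      also have "\<dots> \<le> CK * (49 * M) * 1" using that CK(1) M by (intro mult_left_mono) auto
      finally show ?thesis by simp
    qed
    have G_holder: "cmod (G h z - G h w) \<le> CG * M * cmod (z - w) powr \<alpha>" if h: "cmod h \<le> 1" for h z w
    proof -
      let ?d = "cmod (z - w)"
      consider "z = w" | "1 \<le> ?d" | "0 < ?d" "?d < 1" by fastforce
      then show ?thesis
      proof cases
        case 1
        then show ?thesis by simp
      next
        case 2
        have "cmod (G h z - G h w) \<le> CK * 49 * M + CK * 49 * M"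
          by (rule order_trans[OF norm_triangle_ineq4 add_mono[OF G_bound[OF h] G_bound[OF h]]])
        also have "\<dots> = 2 * (CK * 49) * M * 1" by simp
        also have "\<dots> \<le> CG * M * ?d powr \<alpha>"
          using CG0 M 2 \<alpha> ge_one_powr_ge_zero[of ?d \<alpha>] by (intro mult_mono) auto
        finally show ?thesis .
      next
        case 3
        note d = 3(1) and d1 = 3(2)
        obtain \<eta> \<eta>' where \<eta>: "\<And>t. (\<eta> has_derivative \<eta>' t) (at t)"
          "\<And>t. cmod (\<eta> t) \<le> 1" "\<And>t h. cmod (\<eta>' t h) \<le> 16 / ?d * cmod h"
          "\<And>h. continuous_on UNIV (\<lambda>t. \<eta>' t h)"
          "\<And>t. cmod (t - w) \<le> ?d \<Longrightarrow> \<eta> t = 1" "\<And>t. 2 * ?d < cmod (t - w) \<Longrightarrow> \<eta> t = 0"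
          using cutoff_exists[OF d, of w] by metis
        have \<eta>_lip: "cmod (\<eta> t - \<eta> s) \<le> 16 / ?d * cmod (t - s)" for t s
          by (rule lipschitz_of_derivative[OF \<eta>(1,3)])
        have \<eta>_supp: "\<eta> t = 0" if "t \<notin> cball w (2 * ?d)" for t
          using \<eta>(6)[of t] that by (simp add: dist_norm norm_minus_commute)
        define c where "c = u w - u z"
        have c_bound: "cmod c \<le> M * ?d powr \<alpha>"
          using holder_bdD(3)[OF u, of z w] by (simp add: c_def norm_minus_commute)
        \<comment> \<open>The extra 1 in the radius of \<open>\<kappa>\<close> is used here: if \<open>u\<close> is nonzero at \<open>z\<close> or \<open>w\<close>, then \<open>\<kappa> w = 1\<close>.\<close>
        have w_in: "cmod w \<le> ?R" if "c \<noteq> 0"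
        proof (rule ccontr)
          assume w: "\<not> cmod w \<le> ?R"
          then have "u w = 0" using supp[of w] by auto
          moreover have "R < cmod z" using w d1 norm_triangle_ineq[of "w - z" z] by (simp add: norm_minus_commute)
          then have "u z = 0" using supp[of z] by auto
          ultimately show False using that by (simp add: c_def)
        qed
        let ?\<psi> = "\<lambda>t. \<kappa> t - \<eta> t"
        have \<eta>_supp': "\<eta> t = 0" if "cmod w \<le> ?R" "t \<notin> cball 0 (\<rho> + 2)" for t
        proof -
          have "cmod t \<le> cmod (t - w) + cmod w" using norm_triangle_ineq[of "t - w" w] by simp
          then have "2 * ?d < cmod (t - w)" using that d1 R by (simp add: \<rho>_def)
          then show ?thesis by (rule \<eta>(6))
        qed
        have \<psi>_lip: "cmod (?\<psi> t - ?\<psi> s) \<le> 32 / ?d * cmod (t - s)" for t s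
        proof -
          have "cmod (?\<psi> t - ?\<psi> s) \<le> cmod (\<kappa> t - \<kappa> s) + cmod (\<eta> t - \<eta> s)"
            using norm_triangle_ineq4[of "\<kappa> t - \<kappa> s" "\<eta> t - \<eta> s"] by (simp add: algebra_simps)
          also have "\<dots> \<le> 16 / ?d * cmod (t - s) + 16 / ?d * cmod (t - s)"
          proof (rule add_mono[OF _ \<eta>_lip])
            have "16 * cmod (t - s) \<le> 16 / ?d * cmod (t - s)"
              using d d1 by (intro mult_right_mono) (auto simp: le_divide_eq)
            then show "cmod (\<kappa> t - \<kappa> s) \<le> 16 / ?d * cmod (t - s)" using \<kappa>_lip[of t s] by linarith
          qed
          finally show ?thesis by (simp add: field_simps)
        qed
        have \<psi>w: "?\<psi> w = 0" if "c \<noteq> 0" using \<kappa>(5)[of w] \<eta>(5)[of w] w_in[OF that] by simp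
        have cI: "integrable lebesgue (\<lambda>t. c * (K w t h * ?\<psi> t))"
          and c_int: "cmod (LINT t|lebesgue. c * (K w t h * ?\<psi> t)) \<le> M * ?d powr \<alpha> * (Cb + Ce)"
        proof -
          have "integrable lebesgue (\<lambda>t. c * (K w t h * ?\<psi> t)) \<and>
              cmod (LINT t|lebesgue. c * (K w t h * ?\<psi> t)) \<le> M * ?d powr \<alpha> * (Cb + Ce)"
          proof (cases "c = 0")
            case True
            then show ?thesis using M Cb(1) Ce(1) by simp
          next
            case False
            note w = w_in[OF False]
            have \<eta>h: "holder_bd \<alpha> (2 * 1 + 16 / ?d) \<eta>"
              by (rule holder_bd_of_lipschitz[OF \<eta>(2) \<eta>_lip \<alpha>])
            have \<eta>b: "bounded_in_ball (\<rho> + 2) (2 * 1 + 16 / ?d) \<eta>"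
              by (rule holder_bd_supp_bounded_in_ball[OF \<alpha>(1) \<eta>h \<eta>_supp'[OF w]])
            have "cmod (?\<psi> t) \<le> 2" for t
              using norm_triangle_ineq4[of "\<kappa> t" "\<eta> t"] \<kappa>(2)[of t] \<eta>(2)[of t] by linarith
            from holder_bd_of_lipschitz[OF this \<psi>_lip \<alpha>]
            have \<psi>h: "holder_bd \<alpha> (2 * 2 + 32 / ?d) ?\<psi>" .
            have \<psi>_bound: "cmod (?\<psi> t) \<le> (2 * 2 + 32 / ?d) * cmod (t - w) powr \<alpha>" for t
              using holder_bdD(3)[OF \<psi>h, of t w] unfolding \<psi>w[OF False] by simp
            have \<psi>_supp: "?\<psi> t = 0" if "t \<notin> cball 0 (\<rho> + 2)" for t
              using \<kappa>_supp[of t] \<eta>_supp'[OF w that] that by auto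
            have \<psi>_meas: "?\<psi> \<in> borel_measurable lebesgue"
              using \<kappa>b \<eta>b by (intro borel_measurable_diff) (auto simp: bounded_in_ball_def)
            have B16: "cmod (\<eta> t) \<le> 16 / ?d" for t
            proof -
              have "1 \<le> 16 / ?d" using d d1 by (simp add: le_divide_eq)
              then show ?thesis using \<eta>(2)[of t] by linarith
            qed
            \<comment> \<open>Two expressions for one derivative at \<open>w\<close>: this one exists because \<open>\<kappa> - \<eta>\<close> vanishes there.\<close>
            have D1: "(comm_int a ?\<psi> has_derivative (\<lambda>h. LINT t|lebesgue. K w t h * ?\<psi> t)) (at w)"
              by (rule comm_int_has_derivative_vanishing[OF \<psi>_meas \<psi>_bound \<psi>_supp])
            have "comm_int a ?\<psi> = (\<lambda>z. comm_int a \<kappa> z - comm_int a \<eta> z)"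
              using comm_int_diff[OF \<alpha> a_holder \<kappa>b holder_bdD(4)[OF \<kappa>_hol] \<eta>b holder_bdD(4)[OF \<eta>h], of 1]
              by (auto simp: fun_eq_iff)
            moreover have "((\<lambda>z. comm_int a \<kappa> z - comm_int a \<eta> z) has_derivative
              (\<lambda>h. ?b h w - (comm_int a (\<lambda>t. \<eta>' t h) w + comm_int (\<lambda>t. a' t h) \<eta> w))) (at w)"
              by (intro has_derivative_diff
                comm_int_has_derivative_translation[OF \<kappa>(1) \<kappa>1 \<kappa>'16 \<kappa>(4) \<kappa>_supp]
                comm_int_has_derivative_translation[OF \<eta>(1) B16 \<eta>(3) \<eta>(4) \<eta>_supp'[OF w]])
            ultimately have "(LINT t|lebesgue. K w t h * ?\<psi> t) =
                ?b h w - (comm_int a (\<lambda>t. \<eta>' t h) w + comm_int (\<lambda>t. a' t h) \<eta> w)"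
              using has_derivative_unique[OF D1] by (metis (no_types, lifting))
            then have n: "cmod (LINT t|lebesgue. K w t h * ?\<psi> t) \<le> Cb + Ce"
              using holder_bdD(1)[OF Cb(2)[OF h], of w] Ce(2)[OF d less_imp_le[OF d1] h \<eta>(1-4) \<eta>_supp]
              by (auto intro: order_trans[OF norm_triangle_ineq4 add_mono])
            have I: "integrable lebesgue (\<lambda>t. K w t h * ?\<psi> t)"
              by (rule K_integrable[OF \<psi>_meas \<psi>_bound \<psi>_supp holder_bdD(4)[OF \<psi>h]])
            have "cmod c * cmod (LINT t|lebesgue. K w t h * ?\<psi> t) \<le> (M * ?d powr \<alpha>) * (Cb + Ce)"
              using c_bound n M by (intro mult_mono) auto
            then show ?thesis using I by (simp add: norm_mult del: times_divide_eq_left)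
          qed
          then show "integrable lebesgue (\<lambda>t. c * (K w t h * ?\<psi> t))"
            "cmod (LINT t|lebesgue. c * (K w t h * ?\<psi> t)) \<le> M * ?d powr \<alpha> * (Cb + Ce)" by blast+
        qed
        \<comment> \<open>As \<open>v z = v w + c * \<kappa>\<close>, the part of \<open>K w\<close> in \<open>?P\<close> is multiplied by \<open>v z\<close> in the far zone, where \<open>\<eta>\<close>
           is zero, and by a function of order \<open>\<alpha>\<close> at \<open>w\<close> in the near zone.\<close>
        let ?P = "\<lambda>t. K z t h * v z t - K w t h * v w t - c * (K w t h * ?\<psi> t)"
        let ?e = "\<lambda>t. indicator (cball 0 \<rho>) t * cmod (t - w) powr (\<alpha> - 2)"
        let ?W = "\<lambda>t. A * 113 * M * (252 * (weight \<alpha> ?d (t - z) + weight \<alpha> ?d (t - w)) + 2 * ?d powr \<alpha> * ?e t)"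
        have PI: "integrable lebesgue ?P" by (intro Bochner_Integration.integrable_diff GI cI)
        have eq: "G h z - G h w = (LINT t|lebesgue. ?P t) + (LINT t|lebesgue. c * (K w t h * ?\<psi> t))"
          unfolding G_def
          by (subst Bochner_Integration.integral_diff[OF Bochner_Integration.integrable_diff[OF GI GI] cI],
              subst Bochner_Integration.integral_diff[OF GI GI]) simp
        have b: "cmod (?P t) \<le> ?W t" for t
        proof (cases "2 * ?d < cmod (t - w)")
          case True
          have t: "2 * ?d \<le> cmod (t - w)" "t - w \<noteq> 0" "?d \<le> cmod (t - w)"
            using True d by (linarith, force, linarith)
          have "?P t = (K z t h - K w t h) * v z t"
            using \<eta>(6)[OF True] by (simp add: v_def c_def algebra_simps)
          also have "cmod \<dots> \<le> (1 * A * (126 * ?d / cmod (t - w) ^ 3 + ?d powr \<alpha> / (cmod (t - w))\<^sup>2)) *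
              (2 * (49 * M) * cmod (t - w) powr \<alpha> * indicator (cball 0 \<rho>) t)"
            unfolding norm_mult
          proof (intro mult_mono)
            have "cmod (K z t h - K w t h) \<le>
              cmod h * A * (126 * ?d / cmod (t - w) ^ 3 + ?d powr \<alpha> / (cmod (t - w))\<^sup>2)"
              using t by (intro K_diff) auto
            also have "\<dots> \<le> 1 * A * (126 * ?d / cmod (t - w) ^ 3 + ?d powr \<alpha> / (cmod (t - w))\<^sup>2)"
              using h A_nonneg by (intro mult_right_mono) auto
            finally show "cmod (K z t h - K w t h) \<le>
               1 * A * (126 * ?d / cmod (t - w) ^ 3 + ?d powr \<alpha> / (cmod (t - w))\<^sup>2)" .
            have "cmod (t - z) \<le> 3 / 2 * cmod (t - w)"
              using far_norm_bounds(2)[of "t - z" "t - w"] t by (simp add: norm_minus_commute)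
            then have "cmod (t - z) \<le> 2 * cmod (t - w)" using norm_ge_zero[of "t - w"] by linarith
            then have "cmod (t - z) powr \<alpha> \<le> 2 * cmod (t - w) powr \<alpha>"
              using \<alpha> by (intro powr_le_multiple) auto
            then have "(49 * M) * cmod (t - z) powr \<alpha> \<le> (49 * M) * (2 * cmod (t - w) powr \<alpha>)"
              using M by (intro mult_left_mono) auto
            then show "cmod (v z t) \<le> 2 * (49 * M) * cmod (t - w) powr \<alpha> * indicator (cball 0 \<rho>) t"
              using v_bound[of z t] v_supp[of t z] by (cases "t \<in> cball 0 \<rho>") auto
          qed (use A_nonneg in auto)
          also have "\<dots> = A * 49 * M * (252 * (weight \<alpha> ?d (t - w) * indicator (cball 0 \<rho>) t) + 2 * ?d powr \<alpha> * ?e t)"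
            using powr_times_power[OF t(2), of \<alpha> 2] t by (simp add: weight_far algebra_simps)
          also have "\<dots> \<le> A * 113 * M * (252 * (weight \<alpha> ?d (t - w) * indicator (cball 0 \<rho>) t) + 2 * ?d powr \<alpha> * ?e t)"
            using A_nonneg M by (intro mult_right_mono) (auto simp: weight_nonneg mult_left_mono)
          also have "\<dots> \<le> ?W t"
            using A_nonneg M by (intro mult_left_mono add_mono) (auto simp: weight_nonneg indicator_def)
          finally show ?thesis .
        next
          case False
          note nb = near_bounds[OF False]
          have 1: "cmod (K z t h * v z t) \<le> A * 113 * M * (252 * weight \<alpha> ?d (t - z))"
          proof -
            have "cmod (K z t h * v z t) \<le> 3 * A * (49 * M) * cmod h * cmod (t - z) powr (\<alpha> - 2)"
              by (rule K_times_holder_bound[OF v_bound M49])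
            also have "\<dots> \<le> 3 * A * (49 * M) * 1 * (3 * weight \<alpha> ?d (t - z))"
              using nb h A_nonneg M by (intro mult_mono mult_left_mono powr_le_near) auto
            also have "\<dots> \<le> A * 113 * M * (252 * weight \<alpha> ?d (t - z))"
              using A_nonneg M by (simp add: mult_right_mono mult_left_mono weight_nonneg)
            finally show ?thesis .
          qed
          have c\<psi>: "cmod (c * ?\<psi> t) \<le> 64 * M * cmod (t - w) powr \<alpha>"
          proof (cases "c = 0 \<or> t = w")
            case True
            then show ?thesis using M \<psi>w by (cases "c = 0") simp_all
          next
            case nz: False
            have "cmod (?\<psi> t) \<le> 32 / ?d * cmod (t - w)"
              using \<psi>_lip[of t w] \<psi>w nz by simp
            then have "cmod (c * ?\<psi> t) \<le> (M * ?d powr \<alpha>) * (32 / ?d * cmod (t - w))"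
              unfolding norm_mult using c_bound M by (intro mult_mono) auto
            also have "\<dots> = 32 * M * (?d powr (\<alpha> - 1) * (cmod (t - w) powr (1 - \<alpha>) * cmod (t - w) powr \<alpha>))"
              using d nz by (simp add: powr_diff)
            also have "\<dots> \<le> 32 * M * (?d powr (\<alpha> - 1) * ((2 * ?d powr (1 - \<alpha>)) * cmod (t - w) powr \<alpha>))"
              using nb \<alpha> M by (intro mult_left_mono mult_right_mono powr_le_multiple) auto
            also have "\<dots> = 64 * M * cmod (t - w) powr \<alpha>"
              using d by (simp add: powr_diff)
            finally show ?thesis .
          qed
          have vc: "cmod (v w t + c * ?\<psi> t) \<le> (113 * M) * cmod (t - w) powr \<alpha>"
            using order_trans[OF norm_triangle_ineq add_mono[OF v_bound[of w t] c\<psi>]] by (simp add: algebra_simps)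
          have 2: "cmod (K w t h * (v w t + c * ?\<psi> t)) \<le> A * 113 * M * (252 * weight \<alpha> ?d (t - w))"
          proof -
            have "cmod (K w t h * (v w t + c * ?\<psi> t)) \<le> 3 * A * (113 * M) * cmod h * cmod (t - w) powr (\<alpha> - 2)"
              by (rule K_times_holder_bound[OF vc]) (use M in simp)
            also have "\<dots> \<le> 3 * A * (113 * M) * 1 * (2 * weight \<alpha> ?d (t - w))"
              using nb h A_nonneg M by (intro mult_mono mult_left_mono powr_le_near) auto
            also have "\<dots> \<le> A * 113 * M * (252 * weight \<alpha> ?d (t - w))"
              using A_nonneg M by (simp add: mult_right_mono mult_left_mono weight_nonneg)
            finally show ?thesis .
          qed
          have "?P t = K z t h * v z t - K w t h * (v w t + c * ?\<psi> t)" by (simp add: algebra_simps)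
          also have "cmod \<dots> \<le> A * 113 * M * (252 * weight \<alpha> ?d (t - z)) + A * 113 * M * (252 * weight \<alpha> ?d (t - w))"
            by (rule order_trans[OF norm_triangle_ineq4 add_mono[OF 1 2]])
          also have "\<dots> = A * 113 * M * (252 * (weight \<alpha> ?d (t - z) + weight \<alpha> ?d (t - w)) + 0)"
            by (simp add: algebra_simps)
          also have "\<dots> \<le> ?W t" using A_nonneg M by (intro mult_left_mono add_left_mono) auto
          finally show ?thesis .
        qed
        have I: "integrable lebesgue ?W" using C(2)[OF d] C'(2) by simp
        have "cmod (LINT t|lebesgue. ?P t) \<le> (LINT t|lebesgue. ?W t)"
          by (rule integral_bounded_by(2)[OF borel_measurable_integrable[OF PI] I AE_I2[OF b]])
        also have "\<dots> = A * 113 * M * (252 * ((LINT t|lebesgue. weight \<alpha> ?d (t - z)) + (LINT t|lebesgue. weight \<alpha> ?d (t - w)))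
            + 2 * ?d powr \<alpha> * (LINT t|lebesgue. ?e t))"
          using C(2)[OF d] C'(2) by simp
        also have "\<dots> \<le> A * 113 * M * (252 * (C * ?d powr \<alpha> + C * ?d powr \<alpha>) + 2 * ?d powr \<alpha> * C')"
          using C(3)[OF d] C'(3) A_nonneg M by (intro mult_left_mono add_mono) auto
        finally have "cmod (LINT t|lebesgue. ?P t) \<le> A * 113 * (504 * C + 2 * C') * M * ?d powr \<alpha>"
          by (simp add: algebra_simps)
        then have "cmod (G h z - G h w) \<le> A * 113 * (504 * C + 2 * C') * M * ?d powr \<alpha> + M * ?d powr \<alpha> * (Cb + Ce)"
          unfolding eq by (rule order_trans[OF norm_triangle_ineq add_mono[OF _ c_int]])
        also have "\<dots> = (A * 113 * (504 * C + 2 * C') + (Cb + Ce)) * M * ?d powr \<alpha>"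
          by (simp add: algebra_simps)
        also have "\<dots> \<le> CG * M * ?d powr \<alpha>" using CG0 M by (intro mult_right_mono) auto
        finally show ?thesis .
      qed
    qed
    show "\<exists>g'. (\<forall>z. (comm_int a u has_derivative g' z) (at z)) \<and>
        (\<forall>h. cmod h \<le> 1 \<longrightarrow> holder_bd \<alpha> ((CG + 2 * Cb) * M) (\<lambda>z. g' z h))"
    proof (intro exI[of _ g'] conjI allI impI deriv)
      fix h :: complex assume h: "cmod h \<le> 1"
      have "holder_bd \<alpha> (CG * M) (G h)"
        unfolding holder_bd_def holder_with_def
      proof (intro conjI allI G_holder[OF h])
        fix z
        have "CK * 49 * M \<le> CG * M" using CG0 M by (intro mult_right_mono) auto
        then show "cmod (G h z) \<le> CG * M" using G_bound[OF h, of z] by linarith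
      qed
      from holder_bd_add[OF this holder_bd_mult[OF u Cb(2)[OF h]]]
      show "holder_bd \<alpha> ((CG + 2 * Cb) * M) (\<lambda>z. g' z h)"
        unfolding g'_def by (simp add: algebra_simps)
    qed
  qed
qed

end

section \<open>Symmetry of second derivatives\<close>

abbreviation dir_deriv :: "complex \<Rightarrow> (complex \<Rightarrow> complex) \<Rightarrow> complex \<Rightarrow> complex" where
  "dir_deriv u f z \<equiv> frechet_derivative f (at z) u"

lemma has_derivative_along:
  fixes f :: "complex \<Rightarrow> complex"
  assumes "\<And>z. f differentiable (at z)"
  shows "((\<lambda>s::real. f (w + s *\<^sub>R u)) has_derivative (\<lambda>k. k *\<^sub>R dir_deriv u f (w + s *\<^sub>R u))) (at s within S)"
proof -
  have f: "(f has_derivative frechet_derivative f (at z)) (at z)" for z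
    using assms frechet_derivative_works by blast
  interpret bounded_linear "frechet_derivative f (at z)" for z
    by (rule has_derivative_bounded_linear[OF f])
  have "((\<lambda>s::real. w + s *\<^sub>R u) has_derivative (\<lambda>k. k *\<^sub>R u)) (at s within S)"
    by (auto intro!: derivative_eq_intros)
  from has_derivative_compose[OF this f] show ?thesis by (simp add: scaleR)
qed

text \<open>
  Two applications of the mean value inequality, first in the direction $v$ to the derivative in the
  direction $u$, then in the direction $u$ to the difference in the direction $v$. The second
  difference is symmetric in $u$ and $v$, which proves Schwarz's theorem below.
\<close>

lemma second_difference:
  fixes f :: "complex \<Rightarrow> complex" and u v z :: complex
  assumes f: "\<And>z. f differentiable (at z)" and fu: "\<And>z. dir_deriv u f differentiable (at z)"
    and fuv: "continuous_on UNIV (dir_deriv v (dir_deriv u f))" and e: "0 < e"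
  shows "\<exists>\<delta>>0. \<forall>h. 0 < h \<and> h < \<delta> \<longrightarrow>
    cmod (f (z + h *\<^sub>R u + h *\<^sub>R v) - f (z + h *\<^sub>R u) - f (z + h *\<^sub>R v) + f z
      - h\<^sup>2 *\<^sub>R dir_deriv v (dir_deriv u f) z) \<le> e * h\<^sup>2"
proof -
  let ?L = "dir_deriv v (dir_deriv u f) z"
  have "isCont (dir_deriv v (dir_deriv u f)) z"
    using fuv by (simp add: continuous_on_eq_continuous_at)
  then obtain d where d: "0 < d" "\<And>y. dist y z < d \<Longrightarrow> dist (dir_deriv v (dir_deriv u f) y) ?L < e"
    using e unfolding continuous_at_eps_delta by blast
  let ?n = "cmod u + cmod v + 1"
  have n: "0 < ?n" by (simp add: add_nonneg_pos)
  show ?thesis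
  proof (intro exI[of _ "d / ?n"] conjI allI impI)
    show "0 < d / ?n" using d n by simp
    fix h assume h: "0 < h \<and> h < d / ?n"
    then have hn: "h * ?n < d" using n by (simp add: field_simps)
    have near: "cmod (dir_deriv v (dir_deriv u f) (z + s *\<^sub>R u + t *\<^sub>R v) - ?L) \<le> e"
      if st: "s \<in> {0..h}" "t \<in> {0..h}" for s t
    proof -
      have "cmod (s *\<^sub>R u + t *\<^sub>R v) \<le> s * cmod u + t * cmod v"
        using st by (intro order_trans[OF norm_triangle_ineq]) auto
      also have "\<dots> \<le> h * cmod u + h * cmod v" using st by (intro add_mono mult_right_mono) auto
      also have "\<dots> < d" using hn h by (simp add: algebra_simps)
      finally show ?thesis
        using d(2)[of "z + s *\<^sub>R u + t *\<^sub>R v"] by (simp add: dist_norm add.assoc less_imp_le)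
    qed
    have inner: "cmod (dir_deriv u f (z + s *\<^sub>R u + h *\<^sub>R v) - dir_deriv u f (z + s *\<^sub>R u) - h *\<^sub>R ?L) \<le> e * h"
      if s: "s \<in> {0..h}" for s
    proof -
      let ?p = "\<lambda>t. dir_deriv u f (z + s *\<^sub>R u + t *\<^sub>R v) - t *\<^sub>R ?L"
      have "norm (?p h - ?p 0) \<le> e * norm (h - 0)"
      proof (rule differentiable_bound[of "{0..h}" _
            "\<lambda>t k. k *\<^sub>R dir_deriv v (dir_deriv u f) (z + s *\<^sub>R u + t *\<^sub>R v) - k *\<^sub>R ?L"])
        fix t assume t: "t \<in> {0..h}"
        show "(?p has_derivative (\<lambda>k. k *\<^sub>R dir_deriv v (dir_deriv u f) (z + s *\<^sub>R u + t *\<^sub>R v) - k *\<^sub>R ?L)) (at t within {0..h})"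
          by (intro has_derivative_diff has_derivative_along fu) (auto intro!: derivative_eq_intros)
        show "onorm (\<lambda>k. k *\<^sub>R dir_deriv v (dir_deriv u f) (z + s *\<^sub>R u + t *\<^sub>R v) - k *\<^sub>R ?L) \<le> e"
        proof (rule onorm_le)
          fix k :: real
          show "norm (k *\<^sub>R dir_deriv v (dir_deriv u f) (z + s *\<^sub>R u + t *\<^sub>R v) - k *\<^sub>R ?L) \<le> e * norm k"
            unfolding scaleR_diff_right[symmetric] norm_scaleR real_norm_def mult.commute[of e]
            by (rule mult_left_mono[OF near[OF s t]]) simp
        qed
      qed (use h in auto)
      then show ?thesis using h by (simp add: algebra_simps)
    qed
    let ?q = "\<lambda>s. f (z + h *\<^sub>R v + s *\<^sub>R u) - f (z + s *\<^sub>R u) - s *\<^sub>R (h *\<^sub>R ?L)"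
    have "norm (?q h - ?q 0) \<le> (e * h) * norm (h - 0)"
    proof (rule differentiable_bound[of "{0..h}" _
          "\<lambda>s k. k *\<^sub>R dir_deriv u f (z + h *\<^sub>R v + s *\<^sub>R u) - k *\<^sub>R dir_deriv u f (z + s *\<^sub>R u) - k *\<^sub>R (h *\<^sub>R ?L)"])
      fix s assume s: "s \<in> {0..h}"
      show "(?q has_derivative (\<lambda>k. k *\<^sub>R dir_deriv u f (z + h *\<^sub>R v + s *\<^sub>R u) - k *\<^sub>R dir_deriv u f (z + s *\<^sub>R u)
          - k *\<^sub>R (h *\<^sub>R ?L))) (at s within {0..h})"
        by (intro has_derivative_diff has_derivative_along f) (auto intro!: derivative_eq_intros)
      show "onorm (\<lambda>k. k *\<^sub>R dir_deriv u f (z + h *\<^sub>R v + s *\<^sub>R u) - k *\<^sub>R dir_deriv u f (z + s *\<^sub>R u)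
          - k *\<^sub>R (h *\<^sub>R ?L)) \<le> e * h"
      proof (rule onorm_le)
        fix k :: real
        show "norm (k *\<^sub>R dir_deriv u f (z + h *\<^sub>R v + s *\<^sub>R u) - k *\<^sub>R dir_deriv u f (z + s *\<^sub>R u)
          - k *\<^sub>R (h *\<^sub>R ?L)) \<le> (e * h) * norm k"
          unfolding scaleR_diff_right[symmetric] norm_scaleR real_norm_def mult.commute[of "e * h"]
          using inner[OF s] by (intro mult_left_mono) (auto simp: add_ac)
      qed
    qed (use h in auto)
    then show "cmod (f (z + h *\<^sub>R u + h *\<^sub>R v) - f (z + h *\<^sub>R u) - f (z + h *\<^sub>R v) + f z - h\<^sup>2 *\<^sub>R ?L) \<le> e * h\<^sup>2"
      using h by (simp add: algebra_simps power2_eq_square)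
  qed
qed

lemma dir_deriv_commute:
  fixes f :: "complex \<Rightarrow> complex"
  assumes f: "\<And>z. f differentiable (at z)"
    and fu: "\<And>z. dir_deriv u f differentiable (at z)" "continuous_on UNIV (dir_deriv v (dir_deriv u f))"
    and fv: "\<And>z. dir_deriv v f differentiable (at z)" "continuous_on UNIV (dir_deriv u (dir_deriv v f))"
  shows "dir_deriv v (dir_deriv u f) z = dir_deriv u (dir_deriv v f) z"
proof -
  let ?L = "dir_deriv v (dir_deriv u f) z" and ?M = "dir_deriv u (dir_deriv v f) z"
  have "cmod (?L - ?M) \<le> 0 + e" if e: "0 < e" for e
  proof -
    have e2: "0 < e / 2" using e by simp
    let ?D = "\<lambda>h::real. f (z + h *\<^sub>R u + h *\<^sub>R v) - f (z + h *\<^sub>R u) - f (z + h *\<^sub>R v) + f z"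
    obtain d1 where d1: "0 < d1" "\<And>h. 0 < h \<Longrightarrow> h < d1 \<Longrightarrow> cmod (?D h - h\<^sup>2 *\<^sub>R ?L) \<le> e / 2 * h\<^sup>2"
      using second_difference[OF f fu e2, of z] by blast
    obtain d2 where d2: "0 < d2" "\<And>h. 0 < h \<Longrightarrow> h < d2 \<Longrightarrow> cmod (?D h - h\<^sup>2 *\<^sub>R ?M) \<le> e / 2 * h\<^sup>2"
      using second_difference[OF f fv e2, of z] by (auto simp: algebra_simps)
    define h where "h = min d1 d2 / 2"
    have h: "0 < h" "h < d1" "h < d2" using d1(1) d2(1) by (auto simp: h_def)
    have "h\<^sup>2 * cmod (?L - ?M) = cmod ((?D h - h\<^sup>2 *\<^sub>R ?M) - (?D h - h\<^sup>2 *\<^sub>R ?L))"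
      by (simp flip: scaleR_diff_right)
    also have "\<dots> \<le> e / 2 * h\<^sup>2 + e / 2 * h\<^sup>2"
      by (rule order_trans[OF norm_triangle_ineq4 add_mono[OF d2(2)[OF h(1,3)] d1(2)[OF h(1,2)]]])
    also have "\<dots> = h\<^sup>2 * e" by simp
    finally show ?thesis using h(1) by (simp add: mult_le_cancel_left)
  qed
  then have "cmod (?L - ?M) \<le> 0" by (rule field_le_epsilon)
  then show ?thesis by simp
qed

section \<open>Hoelder spaces of higher order\<close>

text \<open>
  A quantitative form of $C^{k,\alpha}$ built by differentiating once at each step, as in an
  induction on the order. Derivatives are taken here in every order of the variables, whereas
  \<open>partial\<close> has all \<open>dy\<close> inside, so the comparison of the two uses that \<open>dx\<close> and \<open>dy\<close> commute.
\<close>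

primrec holder_bd_upto :: "nat \<Rightarrow> real \<Rightarrow> real \<Rightarrow> (complex \<Rightarrow> complex) \<Rightarrow> bool" where
  "holder_bd_upto 0 \<alpha> M f \<longleftrightarrow> holder_bd \<alpha> M f"
| "holder_bd_upto (Suc k) \<alpha> M f \<longleftrightarrow> holder_bd \<alpha> M f \<and> (\<forall>z. f differentiable (at z)) \<and>
     holder_bd_upto k \<alpha> M (dx f) \<and> holder_bd_upto k \<alpha> M (dy f)"

lemma holder_bd_upto_0D: "holder_bd_upto k \<alpha> M f \<Longrightarrow> holder_bd \<alpha> M f"
  by (cases k) auto

lemma holder_bd_upto_mono: "holder_bd_upto k \<alpha> M f \<Longrightarrow> M \<le> N \<Longrightarrow> holder_bd_upto k \<alpha> N f"
  by (induction k arbitrary: f) (auto intro: holder_bd_mono)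

lemma holder_bd_upto_down: "holder_bd_upto (Suc k) \<alpha> M f \<Longrightarrow> holder_bd_upto k \<alpha> M f"
proof (induction k arbitrary: f)
  case (Suc k)
  then show ?case
    unfolding holder_bd_upto.simps(2)[of "Suc k" \<alpha> M f] holder_bd_upto.simps(2)[of k \<alpha> M f] by blast
qed simp

lemma dx_eq: "(f has_derivative f') (at z) \<Longrightarrow> dx f z = f' 1"
  and dy_eq: "(f has_derivative f') (at z) \<Longrightarrow> dy f z = f' \<i>"
  using frechet_derivative_at[of f f' z] by (auto simp: dx_def dy_def)

abbreviation total_deriv :: "(complex \<Rightarrow> complex) \<Rightarrow> complex \<Rightarrow> complex \<Rightarrow> complex" where
  "total_deriv f z h \<equiv> of_real (Re h) * dx f z + of_real (Im h) * dy f z"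

lemma has_derivative_dx_dy:
  assumes "f differentiable (at z)"
  shows "(f has_derivative (\<lambda>h. total_deriv f z h)) (at z)"
proof -
  have f: "(f has_derivative frechet_derivative f (at z)) (at z)"
    using assms frechet_derivative_works by blast
  interpret bounded_linear "frechet_derivative f (at z)"
    by (rule has_derivative_bounded_linear[OF f])
  show ?thesis
  proof (rule has_derivative_eq_rhs[OF f], rule ext)
    fix h
    have "h = Re h *\<^sub>R 1 + Im h *\<^sub>R \<i>" by (simp add: complex_eq_iff)
    then have "frechet_derivative f (at z) h = frechet_derivative f (at z) (Re h *\<^sub>R 1 + Im h *\<^sub>R \<i>)" by simp
    then show "frechet_derivative f (at z) h = total_deriv f z h"
      by (simp only: add scaleR) (simp add: dx_def dy_def scaleR_conv_of_real)
  qed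
qed

lemma dx_dy_add:
  assumes "\<And>z. f differentiable (at z)" "\<And>z. g differentiable (at z)"
  shows "dx (\<lambda>z. f z + g z) = (\<lambda>z. dx f z + dx g z)" "dy (\<lambda>z. f z + g z) = (\<lambda>z. dy f z + dy g z)"
  using dx_eq[OF has_derivative_add[OF has_derivative_dx_dy[OF assms(1)] has_derivative_dx_dy[OF assms(2)]]]
    dy_eq[OF has_derivative_add[OF has_derivative_dx_dy[OF assms(1)] has_derivative_dx_dy[OF assms(2)]]]
  by (auto simp: fun_eq_iff)

lemma dx_dy_cmult:
  assumes "\<And>z. f differentiable (at z)"
  shows "dx (\<lambda>z. c * f z) = (\<lambda>z. c * dx f z)" "dy (\<lambda>z. c * f z) = (\<lambda>z. c * dy f z)"
  using dx_eq[OF has_derivative_mult_right[OF has_derivative_dx_dy[OF assms]]]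
    dy_eq[OF has_derivative_mult_right[OF has_derivative_dx_dy[OF assms]]]
  by (auto simp: fun_eq_iff)

lemma holder_bd_upto_add:
  "holder_bd_upto k \<alpha> M f \<Longrightarrow> holder_bd_upto k \<alpha> N g \<Longrightarrow> holder_bd_upto k \<alpha> (M + N) (\<lambda>z. f z + g z)"
proof (induction k arbitrary: f g)
  case (Suc k)
  then show ?case by (auto simp: dx_dy_add intro: holder_bd_add differentiable_add)
qed (simp add: holder_bd_add)

lemma holder_bd_upto_cmult:
  "holder_bd_upto k \<alpha> M f \<Longrightarrow> holder_bd_upto k \<alpha> (cmod c * M) (\<lambda>z. c * f z)"
proof (induction k arbitrary: f)
  case (Suc k)
  then show ?case by (auto simp: dx_dy_cmult intro: holder_bd_cmult differentiable_mult)
qed (simp add: holder_bd_cmult)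

lemma dx_dy_zero_outside:
  assumes "\<And>z. f differentiable (at z)" "\<And>t. t \<notin> cball 0 R \<Longrightarrow> f t = 0" "t \<notin> cball 0 R"
  shows "dx f t = 0" "dy f t = 0"
  using derivative_zero_outside[OF has_derivative_dx_dy[OF assms(1)] assms(2,3), of 1]
    derivative_zero_outside[OF has_derivative_dx_dy[OF assms(1)] assms(2,3), of \<i>] by simp_all

subsection \<open>Comparison with the norms\<close>

lemma differentiable_continuous: "(\<And>z. f differentiable (at z)) \<Longrightarrow> continuous_on UNIV f"
  by (simp add: differentiable_imp_continuous_on differentiable_on_def)

lemma Ck_cont: "Ck k g \<Longrightarrow> continuous_on UNIV g"
  by (cases k) (simp_all add: differentiable_continuous)

lemma dx_dy_commute:
  assumes "Ck (Suc (Suc k)) f"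
  shows "dy (dx f) = dx (dy f)"
proof -
  have dxd: "dx g = dir_deriv 1 g" "dy g = dir_deriv \<i> g" for g
    by (auto simp: dx_def dy_def)
  show ?thesis
    unfolding dxd
  proof (intro ext dir_deriv_commute)
    have c: "continuous_on UNIV (dy (dx f))" "continuous_on UNIV (dx (dy f))"
      and d: "dx f differentiable at z" "dy f differentiable at z" for z
      using assms Ck_cont[of k "dy (dx f)"] Ck_cont[of k "dx (dy f)"] by simp_all
    show "continuous_on UNIV (dir_deriv \<i> (dir_deriv 1 f))" "continuous_on UNIV (dir_deriv 1 (dir_deriv \<i> f))"
      using c unfolding dxd .
    show "dir_deriv 1 f differentiable at z" "dir_deriv \<i> f differentiable at z" for z
      using d unfolding dxd .
  qed (use assms in simp)
qed

lemma Ck_down: "Ck (Suc k) f \<Longrightarrow> Ck k f"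
proof (induction k arbitrary: f)
  case 0
  then show ?case by (simp add: differentiable_continuous)
next
  case (Suc k)
  then show ?case unfolding Ck.simps(2)[of "Suc k" f] Ck.simps(2)[of k f] by blast
qed

lemma dy_pow_dx_commute: "Ck (Suc j) f \<Longrightarrow> (dy ^^ j) (dx f) = dx ((dy ^^ j) f)"
proof (induction j arbitrary: f)
  case (Suc j)
  have "Ck (Suc j) (dy f)" using Suc.prems by simp
  then show ?case
    using Suc.IH[of "dy f"] dx_dy_commute[OF Suc.prems] by (simp add: funpow_swap1)
qed simp

lemma Ck_mono: "Ck k f \<Longrightarrow> j \<le> k \<Longrightarrow> Ck j f"
  by (induction k) (auto simp: le_Suc_eq simp del: Ck.simps dest: Ck_down)

lemma partial_dy: "partial i j (dy f) = partial i (Suc j) f"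
  by (simp add: partial_def funpow_swap1)

lemma partial_dx:
  assumes "Ck (Suc k) f" "i + j \<le> k"
  shows "partial i j (dx f) = partial (Suc i) j f"
proof -
  have "Ck (Suc j) f" using Ck_mono[OF assms(1), of "Suc j"] assms(2) by simp
  then show ?thesis by (simp add: partial_def dy_pow_dx_commute funpow_swap1)
qed

lemma holder_bd_upto_of_partial:
  assumes "Ck k f" "\<And>i j. i + j \<le> k \<Longrightarrow> holder_bd \<alpha> M (partial i j f)"
  shows "holder_bd_upto k \<alpha> M f"
  using assms
proof (induction k arbitrary: f)
  case 0
  then show ?case using "0.prems"(2)[of 0 0] by (simp add: partial_def)
next
  case (Suc k)
  have "holder_bd \<alpha> M f" using Suc.prems(2)[of 0 0] by (simp add: partial_def)
  moreover have "holder_bd_upto k \<alpha> M (dy f)"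
    using Suc.prems by (intro Suc.IH) (auto simp: partial_dy)
  moreover have "holder_bd_upto k \<alpha> M (dx f)"
    using Suc.prems by (intro Suc.IH) (auto simp: partial_dx[OF Suc.prems(1)])
  ultimately show ?case using Suc.prems(1) by simp
qed

lemma Ck_of_holder_bd_upto: "0 < \<alpha> \<Longrightarrow> holder_bd_upto k \<alpha> M f \<Longrightarrow> Ck k f"
  by (induction k arbitrary: f) (auto intro: holder_with_continuous holder_bdD)

lemma partial_of_holder_bd_upto:
  "holder_bd_upto k \<alpha> M f \<Longrightarrow> i + j \<le> k \<Longrightarrow> holder_bd \<alpha> M (partial i j f)"
proof (induction k arbitrary: f i j)
  case 0
  then show ?case by (simp add: partial_def)
next
  case (Suc k)
  consider j' where "j = Suc j'" | i' where "j = 0" "i = Suc i'" | "i = 0" "j = 0"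
    by (cases i; cases j) auto
  then show ?case
  proof cases
    case 1
    then show ?thesis using Suc.IH[of "dy f" i j'] Suc.prems by (simp add: partial_dy)
  next
    case 2
    then show ?thesis using Suc.IH[of "dx f" i' 0] Suc.prems by (simp add: partial_def funpow_swap1)
  next
    case 3
    then show ?thesis using Suc.prems by (simp add: partial_def)
  qed
qed

lemma sup_norm_ge:
  assumes "bounded (range f)"
  shows "cmod (f z) \<le> sup_norm f"
proof -
  obtain B where "\<And>z. cmod (f z) \<le> B" using assms by (auto simp: bounded_iff)
  then have "bdd_above (range (\<lambda>z. cmod (f z)))" by (auto simp: bdd_above_def)
  then show ?thesis unfolding sup_norm_def by (rule cSUP_upper[OF UNIV_I])
qed

lemma holder_seminorm_ge:
  assumes "holder_cond \<alpha> f"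
  shows "cmod (f z - f w) \<le> holder_seminorm \<alpha> f * cmod (z - w) powr \<alpha>" "0 \<le> holder_seminorm \<alpha> f"
proof -
  let ?q = "\<lambda>(z, w). cmod (f z - f w) / cmod (z - w) powr \<alpha>"
  obtain B where B: "\<And>z w. cmod (f z - f w) \<le> B * cmod (z - w) powr \<alpha>"
    using assms by (auto simp: holder_cond_def)
  have bdd: "bdd_above (?q ` {(z, w). z \<noteq> w})"
    unfolding bdd_above_def using B by (intro exI[of _ B]) (auto simp: divide_le_eq)
  have q: "?q p \<le> holder_seminorm \<alpha> f" if "p \<in> {(z, w). z \<noteq> w}" for p
    unfolding holder_seminorm_def by (rule cSUP_upper[OF that bdd])
  show "cmod (f z - f w) \<le> holder_seminorm \<alpha> f * cmod (z - w) powr \<alpha>"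
  proof (cases "z = w")
    case False
    then show ?thesis using q[of "(z, w)"] by (simp add: divide_le_eq)
  qed simp
  have "0 \<le> ?q (0, 1)" by simp
  also have "\<dots> \<le> holder_seminorm \<alpha> f" by (rule q) simp
  finally show "0 \<le> holder_seminorm \<alpha> f" .
qed

lemma finite_multi_indices: "finite {(i, j). i + j \<le> (k::nat)}"
  by (rule finite_subset[of _ "{..k} \<times> {..k}"]) auto

lemma holder_bd_upto_holder_norm:
  assumes f: "f \<in> holder_space k \<alpha>"
  shows "holder_bd_upto k \<alpha> (holder_norm k \<alpha> f) f"
proof (rule holder_bd_upto_of_partial)
  show "Ck k f" using f by (simp add: holder_space_def)
  fix i j assume ij: "i + j \<le> k"
  have bd: "bounded (range (partial i j f))" "holder_cond \<alpha> (partial i j f)" if "i + j \<le> k" for i j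
    using f that by (auto simp: holder_space_def)
  let ?N = "\<lambda>i j. sup_norm (partial i j f) + holder_seminorm \<alpha> (partial i j f)"
  have nn: "0 \<le> sup_norm (partial i j f)" "0 \<le> holder_seminorm \<alpha> (partial i j f)" if "i + j \<le> k" for i j
    using sup_norm_ge[OF bd(1)[OF that], of 0] holder_seminorm_ge(2)[OF bd(2)[OF that]]
    by (auto intro: order_trans[OF norm_ge_zero])
  have "(case (i, j) of (i, j) \<Rightarrow> ?N i j) \<le> holder_norm k \<alpha> f"
    unfolding holder_norm_def
    by (rule member_le_sum) (use ij finite_multi_indices nn in auto)
  then have N: "sup_norm (partial i j f) \<le> holder_norm k \<alpha> f" "holder_seminorm \<alpha> (partial i j f) \<le> holder_norm k \<alpha> f"
    using nn[OF ij] by auto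
  show "holder_bd \<alpha> (holder_norm k \<alpha> f) (partial i j f)"
    unfolding holder_bd_def holder_with_def
  proof (intro conjI allI)
    fix z w
    show "cmod (partial i j f z) \<le> holder_norm k \<alpha> f"
      using sup_norm_ge[OF bd(1)[OF ij], of z] N by linarith
    show "cmod (partial i j f z - partial i j f w) \<le> holder_norm k \<alpha> f * cmod (z - w) powr \<alpha>"
      using holder_seminorm_ge(1)[OF bd(2)[OF ij], of z w] mult_right_mono[OF N(2), of "cmod (z - w) powr \<alpha>"]
      by simp
  qed
qed

lemma holder_space_of_holder_bd_upto:
  assumes \<alpha>: "0 < \<alpha>" and f: "holder_bd_upto k \<alpha> M f"
  shows "f \<in> holder_space k \<alpha>"
    and "holder_norm k \<alpha> f \<le> real (card {(i, j). i + j \<le> k}) * (2 * M)"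
proof -
  have p: "holder_bd \<alpha> M (partial i j f)" if "i + j \<le> k" for i j
    by (rule partial_of_holder_bd_upto[OF f that])
  show "f \<in> holder_space k \<alpha>"
    unfolding holder_space_def
  proof (intro CollectI conjI allI impI Ck_of_holder_bd_upto[OF \<alpha> f])
    fix i j assume ij: "i + j \<le> k"
    show "bounded (range (partial i j f))" using holder_bdD(1)[OF p[OF ij]] by (auto simp: bounded_iff)
    show "holder_cond \<alpha> (partial i j f)" using holder_bdD(3)[OF p[OF ij]] by (auto simp: holder_cond_def)
  qed
  have "sup_norm g + holder_seminorm \<alpha> g \<le> 2 * M" if g: "holder_bd \<alpha> M g" for g
  proof -
    have "sup_norm g \<le> M" unfolding sup_norm_def
      by (rule cSUP_least) (use holder_bdD(1)[OF g] in auto)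
    moreover have "holder_seminorm \<alpha> g \<le> M" unfolding holder_seminorm_def
    proof (rule cSUP_least)
      have "(0, 1) \<in> {(z, w). z \<noteq> (w::complex)}" by simp
      then show "{(z, w). z \<noteq> (w::complex)} \<noteq> {}" by blast
    qed (use holder_bdD(3)[OF g] in \<open>auto simp: divide_le_eq\<close>)
    ultimately show ?thesis by simp
  qed
  then show "holder_norm k \<alpha> f \<le> real (card {(i, j). i + j \<le> k}) * (2 * M)"
    unfolding holder_norm_def using p by (intro sum_bounded_above) auto
qed

section \<open>The commutator on Hoelder spaces\<close>

lemma C1_coefficient_of_holder_bd_upto:
  assumes \<alpha>: "0 < \<alpha>" "\<alpha> < 1" and a: "holder_bd_upto (Suc k) \<alpha> A a"
  shows "C1_coefficient a (\<lambda>z h. total_deriv a z h) \<alpha> (2 * A)"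
proof
  have a0: "holder_bd \<alpha> A a" and d: "\<And>z. a differentiable (at z)"
    and x: "holder_bd \<alpha> A (dx a)" and y: "holder_bd \<alpha> A (dy a)"
    using a by (auto intro: holder_bd_upto_0D)
  have A: "0 \<le> A" by (rule holder_bdD(4)[OF a0])
  have lin: "cmod (of_real (Re h) * p + of_real (Im h) * q) \<le> 2 * B * cmod h"
    if "cmod p \<le> B" "cmod q \<le> B" for p q h B
  proof -
    have "cmod (of_real (Re h) * p + of_real (Im h) * q) \<le> \<bar>Re h\<bar> * cmod p + \<bar>Im h\<bar> * cmod q"
      by (rule order_trans[OF norm_triangle_ineq]) (simp add: norm_mult)
    also have "\<dots> \<le> cmod h * B + cmod h * B"
      using that abs_Re_le_cmod abs_Im_le_cmod by (intro add_mono mult_mono) auto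
    finally show ?thesis by simp
  qed
  show "(a has_derivative (\<lambda>h. total_deriv a z h)) (at z)" for z
    by (rule has_derivative_dx_dy[OF d])
  show "cmod (a z) \<le> 2 * A" for z using holder_bdD(1)[OF a0, of z] A by linarith
  show "holder_with \<alpha> (2 * A) a" using holder_bdD(2)[OF holder_bd_mono[OF a0]] A by simp
  show "cmod (total_deriv a z h) \<le> 2 * A * cmod h" for z h
    by (rule lin[OF holder_bdD(1)[OF x] holder_bdD(1)[OF y]])
  show "holder_with \<alpha> (2 * A * cmod h) (\<lambda>z. total_deriv a z h)" for h
    unfolding holder_with_def
  proof (intro allI)
    fix z w
    have "(total_deriv a z h) - (total_deriv a w h)
      = of_real (Re h) * (dx a z - dx a w) + of_real (Im h) * (dy a z - dy a w)" by (simp add: algebra_simps)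
    also have "cmod \<dots> \<le> 2 * (A * cmod (z - w) powr \<alpha>) * cmod h"
      by (rule lin[OF holder_bdD(3)[OF x] holder_bdD(3)[OF y]])
    finally show "cmod ((total_deriv a z h) - (total_deriv a w h))
      \<le> 2 * A * cmod h * cmod (z - w) powr \<alpha>" by (simp add: mult_ac)
  qed
qed (use \<alpha> in auto)

lemma comm_int_product_rule:
  assumes \<alpha>: "0 < \<alpha>" "\<alpha> < 1" and a: "holder_bd_upto (Suc k) \<alpha> A a"
    and u: "holder_bd_upto (Suc l) \<alpha> M u" and supp: "\<And>t. t \<notin> cball 0 R \<Longrightarrow> u t = 0"
  shows "comm_int a u differentiable (at z)"
    and "dx (comm_int a u) = (\<lambda>z. comm_int a (dx u) z + comm_int (dx a) u z)"
    and "dy (comm_int a u) = (\<lambda>z. comm_int a (dy u) z + comm_int (dy a) u z)"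
proof -
  interpret a: C1_coefficient a "\<lambda>z h. total_deriv a z h" \<alpha> "2 * A"
    by (rule C1_coefficient_of_holder_bd_upto[OF \<alpha> a])
  interpret u: C1_coefficient u "\<lambda>z h. total_deriv u z h" \<alpha> "2 * M"
    by (rule C1_coefficient_of_holder_bd_upto[OF \<alpha> u])
  have c: "continuous_on UNIV (\<lambda>z. total_deriv u z h)" for h
    by (rule holder_with_continuous[OF \<alpha>(1) u.a'_holder])
  have D: "(comm_int a u has_derivative
     (\<lambda>h. comm_int a (\<lambda>t. total_deriv u t h) z +
          comm_int (\<lambda>t. total_deriv a t h) u z)) (at z)" for z
    by (rule a.comm_int_has_derivative_translation[OF u.a_deriv u.a_bound u.a'_bound c supp])
  show "comm_int a u differentiable (at z)" using D differentiable_def by blast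
  show "dx (comm_int a u) = (\<lambda>z. comm_int a (dx u) z + comm_int (dx a) u z)"
    using dx_eq[OF D] by (simp add: fun_eq_iff)
  show "dy (comm_int a u) = (\<lambda>z. comm_int a (dy u) z + comm_int (dy a) u z)"
    using dy_eq[OF D] by (simp add: fun_eq_iff)
qed

text \<open>
  In the induction step the two terms of the product rule lose one derivative of $u$ and of $a$
  respectively, so the induction hypothesis is used for $a$ and for both of its partial derivatives.
\<close>

lemma comm_int_gains_derivative:
  assumes \<alpha>: "0 < \<alpha>" "\<alpha> < 1" and R: "0 < R"
  shows "holder_bd_upto (Suc k) \<alpha> A a \<Longrightarrow> \<exists>C\<ge>0. \<forall>u M. holder_bd_upto k \<alpha> M u \<longrightarrow>
    (\<forall>t. t \<notin> cball 0 R \<longrightarrow> u t = 0) \<longrightarrow> holder_bd_upto (Suc k) \<alpha> (C * M) (comm_int a u)"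
proof (induction k arbitrary: a)
  case 0
  interpret a: C1_coefficient a "\<lambda>z h. total_deriv a z h" \<alpha> "2 * A"
    by (rule C1_coefficient_of_holder_bd_upto[OF \<alpha> 0])
  obtain C1 where C1: "0 \<le> C1"
    "\<And>u M. holder_bd \<alpha> M u \<Longrightarrow> (\<And>t. t \<notin> cball 0 R \<Longrightarrow> u t = 0) \<Longrightarrow>
      \<exists>g'. (\<forall>z. (comm_int a u has_derivative g' z) (at z)) \<and>
        (\<forall>h. cmod h \<le> 1 \<longrightarrow> holder_bd \<alpha> (C1 * M) (\<lambda>z. g' z h))"
    by (rule a.comm_int_derivative_holder[OF R]) (rule that; blast)
  obtain C2 where C2: "0 \<le> C2"
    "\<And>a A u M. holder_with \<alpha> A a \<Longrightarrow> holder_bd \<alpha> M u \<Longrightarrow> (\<And>t. t \<notin> cball 0 R \<Longrightarrow> u t = 0) \<Longrightarrow>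
      holder_bd \<alpha> (C2 * A * M) (comm_int a u)"
    by (rule comm_int_holder_of_holder[OF \<alpha> \<alpha>, of R]) (rule that; blast)
  let ?C = "C1 + C2 * (2 * A)"
  have A: "0 \<le> 2 * A" by (rule a.A_nonneg)
  show ?case
  proof (intro exI[of _ ?C] conjI allI impI)
    show "0 \<le> ?C" using C1(1) C2(1) A by (intro add_nonneg_nonneg mult_nonneg_nonneg) auto
    fix u M assume u0: "holder_bd_upto 0 \<alpha> M u" and supp: "\<forall>t. t \<notin> cball 0 R \<longrightarrow> u t = 0"
    then have u: "holder_bd \<alpha> M u" by simp
    have M: "0 \<le> M" by (rule holder_bdD(4)[OF u])
    obtain g' where g': "\<And>z. (comm_int a u has_derivative g' z) (at z)"
      "\<And>h. cmod h \<le> 1 \<Longrightarrow> holder_bd \<alpha> (C1 * M) (\<lambda>z. g' z h)"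
      using C1(2)[OF u] supp by blast
    have le: "C1 * M \<le> ?C * M" "C2 * (2 * A) * M \<le> ?C * M"
      using C1(1) C2(1) A M by (intro mult_right_mono; simp)+
    have "holder_bd \<alpha> (C2 * (2 * A) * M) (comm_int a u)"
      using C2(2)[OF a.a_holder u] supp by blast
    moreover have "dx (comm_int a u) = (\<lambda>z. g' z 1)" "dy (comm_int a u) = (\<lambda>z. g' z \<i>)"
      using dx_eq[OF g'(1)] dy_eq[OF g'(1)] by (auto simp: fun_eq_iff)
    moreover have "comm_int a u differentiable (at z)" for z
      using g'(1) differentiable_def by blast
    ultimately show "holder_bd_upto (Suc 0) \<alpha> (?C * M) (comm_int a u)"
      using holder_bd_mono[OF _ le(1)] holder_bd_mono[OF _ le(2)] g'(2)[of 1] g'(2)[of \<i>] by simp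
  qed
next
  case (Suc k)
  have a: "holder_bd_upto (Suc k) \<alpha> A a" "holder_bd_upto (Suc k) \<alpha> A (dx a)" "holder_bd_upto (Suc k) \<alpha> A (dy a)"
    using holder_bd_upto_down[OF Suc.prems] Suc.prems unfolding holder_bd_upto.simps(2)[of "Suc k"] by blast+
  obtain C0 where C0: "0 \<le> C0" "\<And>u M. holder_bd_upto k \<alpha> M u \<Longrightarrow>
    (\<forall>t. t \<notin> cball 0 R \<longrightarrow> u t = 0) \<Longrightarrow> holder_bd_upto (Suc k) \<alpha> (C0 * M) (comm_int a u)"
    using Suc.IH[OF a(1)] by blast
  obtain C1 where C1: "0 \<le> C1" "\<And>u M. holder_bd_upto k \<alpha> M u \<Longrightarrow>
    (\<forall>t. t \<notin> cball 0 R \<longrightarrow> u t = 0) \<Longrightarrow> holder_bd_upto (Suc k) \<alpha> (C1 * M) (comm_int (dx a) u)"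
    using Suc.IH[OF a(2)] by blast
  obtain C2 where C2: "0 \<le> C2" "\<And>u M. holder_bd_upto k \<alpha> M u \<Longrightarrow>
    (\<forall>t. t \<notin> cball 0 R \<longrightarrow> u t = 0) \<Longrightarrow> holder_bd_upto (Suc k) \<alpha> (C2 * M) (comm_int (dy a) u)"
    using Suc.IH[OF a(3)] by blast
  let ?C = "C0 + C1 + C2"
  show ?case
  proof (intro exI[of _ ?C] conjI allI impI)
    show "0 \<le> ?C" using C0(1) C1(1) C2(1) by simp
    fix u M assume u: "holder_bd_upto (Suc k) \<alpha> M u" and supp: "\<forall>t. t \<notin> cball 0 R \<longrightarrow> u t = 0"
    have M: "0 \<le> M" by (rule holder_bdD(4)[OF holder_bd_upto_0D[OF u]])
    have ud: "u differentiable (at z)" for z using u by simp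
    have ux: "holder_bd_upto k \<alpha> M (dx u)" and uy: "holder_bd_upto k \<alpha> M (dy u)"
      using u by auto
    have "dx u t = 0" "dy u t = 0" if "t \<notin> cball 0 R" for t
      using dx_dy_zero_outside[OF ud _ that] supp by blast+
    then have supp': "\<forall>t. t \<notin> cball 0 R \<longrightarrow> dx u t = 0" "\<forall>t. t \<notin> cball 0 R \<longrightarrow> dy u t = 0" by blast+
    have le: "C0 * M \<le> ?C * M" "C0 * M + C1 * M \<le> ?C * M" "C0 * M + C2 * M \<le> ?C * M"
      unfolding distrib_right[symmetric] using C0(1) C1(1) C2(1) M by (intro mult_right_mono; simp)+
    have s: "u t = 0" if "t \<notin> cball 0 R" for t using supp that by blast
    have D: "comm_int a u differentiable (at z)"
      "dx (comm_int a u) = (\<lambda>z. comm_int a (dx u) z + comm_int (dx a) u z)"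
      "dy (comm_int a u) = (\<lambda>z. comm_int a (dy u) z + comm_int (dy a) u z)" for z
      by (rule comm_int_product_rule[OF \<alpha> a(1) u s]; assumption)+
    have "holder_bd_upto (Suc k) \<alpha> (?C * M) (dx (comm_int a u))"
      unfolding D(2)
      by (rule holder_bd_upto_mono[OF holder_bd_upto_add[OF C0(2)[OF ux supp'(1)]
          C1(2)[OF holder_bd_upto_down[OF u] supp]] le(2)])
    moreover have "holder_bd_upto (Suc k) \<alpha> (?C * M) (dy (comm_int a u))"
      unfolding D(3)
      by (rule holder_bd_upto_mono[OF holder_bd_upto_add[OF C0(2)[OF uy supp'(2)]
          C2(2)[OF holder_bd_upto_down[OF u] supp]] le(3)])
    moreover have "holder_bd \<alpha> (?C * M) (comm_int a u)"
      by (rule holder_bd_mono[OF holder_bd_upto_0D[OF C0(2)[OF holder_bd_upto_down[OF u] supp]] le(1)])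
    moreover have "comm_int a u differentiable (at z)" for z
      by (rule D(1))
    ultimately show "holder_bd_upto (Suc (Suc k)) \<alpha> (?C * M) (comm_int a u)"
      unfolding holder_bd_upto.simps(2)[of "Suc k"] by blast
  qed
qed

lemma holder_space_R_zero_outside:
  assumes "u \<in> holder_space_R R k \<alpha>" "t \<notin> cball 0 R"
  shows "u t = 0"
proof -
  have "closure {z. u z \<noteq> 0} \<subseteq> cball 0 R" using assms(1) by (simp add: holder_space_R_def)
  then show ?thesis using assms(2) closure_subset[of "{z. u z \<noteq> 0}"] by blast
qed

lemma bounded_in_ball_Linf_norm:
  assumes u: "u \<in> Linf_space_R R"
  shows "0 \<le> Linf_norm u" "bounded_in_ball R (Linf_norm u) u"
proof -
  obtain C where m: "u \<in> borel_measurable lebesgue" and C: "AE z in lebesgue. cmod (u z) \<le> C"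
    and s: "AE z in lebesgue. z \<notin> cball 0 R \<longrightarrow> u z = 0"
    using u by (auto simp: Linf_space_R_def)
  let ?f = "\<lambda>z. ereal (cmod (u z))" and ?S = "esssup lebesgue (\<lambda>z. ereal (cmod (u z)))"
  have mf: "?f \<in> borel_measurable lebesgue" using m by simp
  have le: "?S \<le> ereal C" by (rule esssup_I[OF mf]) (use C in simp)
  have "emeasure lebesgue (space (lebesgue :: complex measure)) \<noteq> 0" by simp
  then have "0 = esssup lebesgue (\<lambda>z::complex. 0::ereal)" by (simp add: esssup_const)
  also have "\<dots> \<le> ?S" by (rule esssup_mono) auto
  finally have ge: "0 \<le> ?S" .
  have S: "?S = ereal (Linf_norm u)"
    using le ge unfolding Linf_norm_def by (cases ?S) auto
  show "0 \<le> Linf_norm u" using ge unfolding S by simp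
  have "AE z in lebesgue. ?f z \<le> ?S" by (rule esssup_AE)
  then have "AE z in lebesgue. cmod (u z) \<le> Linf_norm u" unfolding S by simp
  with s have "AE t in lebesgue. cmod (u t) \<le> Linf_norm u * indicator (cball 0 R) t"
    by eventually_elim (auto simp: indicator_def)
  with m show "bounded_in_ball R (Linf_norm u) u" by (simp add: bounded_in_ball_def)
qed

lemma CZ_commutator_comm_int:
  "CZ_commutator UNIV a u = (\<lambda>z. - (1 / of_real pi) * comm_int a u z)"
  by (simp add: CZ_commutator_def comm_int_def set_lebesgue_integral_def fun_eq_iff)

lemma CZ_commutator_bounded_operator:
  assumes \<alpha>: "0 < \<alpha>" "\<alpha> < 1" "0 < \<gamma>" and a: "a \<in> holder_space 0 \<alpha>" and X: "X \<subseteq> Linf_space_R R"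
    and bd: "\<And>u. u \<in> X \<Longrightarrow> holder_bd_upto k \<gamma> (C * nX u) (comm_int a u)"
  shows "bounded_operator X nX (holder_space k \<gamma>) (holder_norm k \<gamma>) (CZ_commutator UNIV a)"
proof -
  have I: "integrable lebesgue (\<lambda>t. (a t - a z) / (t - z)\<^sup>2 * u t)" if "u \<in> X" for u z
    using CZ_commutator_integrable[OF \<alpha>(1,2) a subsetD[OF X that], of z] by (simp add: set_integrable_def)
  have add: "comm_int a (\<lambda>z. u z + v z) z = comm_int a u z + comm_int a v z" if "u \<in> X" "v \<in> X" for u v z
    unfolding comm_int_def distrib_left by (rule Bochner_Integration.integral_add[OF I[OF that(1)] I[OF that(2)]])
  have scale: "comm_int a (\<lambda>z. c * u z) z = c * comm_int a u z" for c u z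
    unfolding comm_int_def mult.left_commute[of _ c] by (rule integral_mult_right_zero)
  have T: "holder_bd_upto k \<gamma> (1 / pi * (C * nX u)) (CZ_commutator UNIV a u)" if "u \<in> X" for u
    using holder_bd_upto_cmult[OF bd[OF that], of "- (1 / of_real pi)"]
    unfolding CZ_commutator_comm_int by (simp add: norm_divide)
  show ?thesis
    unfolding bounded_operator_def
  proof (intro conjI ballI allI)
    show "CZ_commutator UNIV a (\<lambda>z. u z + v z) = (\<lambda>z. CZ_commutator UNIV a u z + CZ_commutator UNIV a v z)"
      if "u \<in> X" "v \<in> X" for u v
      using add[OF that] by (simp add: CZ_commutator_comm_int fun_eq_iff algebra_simps add_divide_distrib)
    show "CZ_commutator UNIV a (\<lambda>z. c * u z) = (\<lambda>z. c * CZ_commutator UNIV a u z)" for c u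
      by (simp add: CZ_commutator_comm_int fun_eq_iff scale)
    show "CZ_commutator UNIV a u \<in> holder_space k \<gamma>" if "u \<in> X" for u
      by (rule holder_space_of_holder_bd_upto(1)[OF \<alpha>(3) T[OF that]])
    show "\<exists>C. \<forall>u\<in>X. holder_norm k \<gamma> (CZ_commutator UNIV a u) \<le> C * nX u"
    proof (intro exI ballI)
      fix u assume "u \<in> X"
      from holder_space_of_holder_bd_upto(2)[OF \<alpha>(3) T[OF this]]
      show "holder_norm k \<gamma> (CZ_commutator UNIV a u) \<le> (real (card {(i, j). i + j \<le> k}) * 2 / pi * C) * nX u"
        by (simp add: mult_ac)
    qed
  qed
qed

lemma holder_space_mono:
  assumes "f \<in> holder_space (k + j) \<alpha>"
  shows "f \<in> holder_space k \<alpha>"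
  using assms Ck_mono[of "k + j" f k] by (auto simp: holder_space_def)

theorem theorem2p1:
  fixes \<alpha> \<beta> R :: real
  assumes "0 < \<alpha>" and "\<alpha> < 1" and "0 < \<beta>" and "\<beta> < \<alpha>" and "0 < R"
  shows "(\<forall>a \<in> holder_space 0 \<alpha>.
            bounded_operator (Linf_space_R R) Linf_norm (holder_space 0 \<beta>) (holder_norm 0 \<beta>)
              (CZ_commutator UNIV a) \<and>
            bounded_operator (holder_space_R R 0 \<beta>) (holder_norm 0 \<beta>)
              (holder_space 0 \<alpha>) (holder_norm 0 \<alpha>) (CZ_commutator UNIV a)) \<and>
         (\<forall>k. \<forall>a \<in> holder_space (k + 1) \<alpha>.
            bounded_operator (holder_space_R R k \<alpha>) (holder_norm k \<alpha>)
              (holder_space (k + 1) \<alpha>) (holder_norm (k + 1) \<alpha>) (CZ_commutator UNIV a))"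


proof (intro conjI ballI allI)
  fix a assume a: "a \<in> holder_space 0 \<alpha>"
  have ah: "holder_with \<alpha> (holder_norm 0 \<alpha> a) a"
    using holder_bd_upto_holder_norm[OF a] holder_bdD(2) by auto
  note \<alpha> = \<open>0 < \<alpha>\<close> \<open>\<alpha> < 1\<close>
  have \<beta>: "\<beta> < 1" using assms by simp
  obtain C1 where C1: "0 \<le> C1"
    "\<And>a A u M. holder_with \<alpha> A a \<Longrightarrow> bounded_in_ball R M u \<Longrightarrow> 0 \<le> M \<Longrightarrow> holder_bd \<beta> (C1 * A * M) (comm_int a u)"
    by (rule comm_int_holder_of_bounded[OF assms(3,4,2), of R]) (rule that; blast)
  show "bounded_operator (Linf_space_R R) Linf_norm (holder_space 0 \<beta>) (holder_norm 0 \<beta>) (CZ_commutator UNIV a)"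
    by (rule CZ_commutator_bounded_operator[OF \<alpha> assms(3) a order_refl, where C = "C1 * holder_norm 0 \<alpha> a"])
       (use C1(2)[OF ah] bounded_in_ball_Linf_norm in simp)
  obtain C2 where C2: "0 \<le> C2"
    "\<And>a A u M. holder_with \<alpha> A a \<Longrightarrow> holder_bd \<beta> M u \<Longrightarrow> (\<And>t. t \<notin> cball 0 R \<Longrightarrow> u t = 0) \<Longrightarrow>
      holder_bd \<alpha> (C2 * A * M) (comm_int a u)"
    by (rule comm_int_holder_of_holder[OF \<alpha> assms(3) \<beta>, of R]) (rule that; blast)
  show "bounded_operator (holder_space_R R 0 \<beta>) (holder_norm 0 \<beta>) (holder_space 0 \<alpha>) (holder_norm 0 \<alpha>)
      (CZ_commutator UNIV a)"
  proof (rule CZ_commutator_bounded_operator[OF \<alpha> assms(1) a, where C = "C2 * holder_norm 0 \<alpha> a" and R = R])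
    show "holder_space_R R 0 \<beta> \<subseteq> Linf_space_R R" using holder_space_R_subset_Linf by blast
    fix u assume u: "u \<in> holder_space_R R 0 \<beta>"
    then have "holder_bd \<beta> (holder_norm 0 \<beta> u) u"
      using holder_bd_upto_holder_norm[of u 0 \<beta>] by (simp add: holder_space_R_def)
    from C2(2)[OF ah this holder_space_R_zero_outside[OF u]]
    show "holder_bd_upto 0 \<alpha> (C2 * holder_norm 0 \<alpha> a * holder_norm 0 \<beta> u) (comm_int a u)" by simp
  qed
next
  fix k a assume a: "a \<in> holder_space (k + 1) \<alpha>"
  note \<alpha> = \<open>0 < \<alpha>\<close> \<open>\<alpha> < 1\<close>
  have a0: "a \<in> holder_space 0 \<alpha>" using holder_space_mono[of a 0] a by simp
  have "holder_bd_upto (Suc k) \<alpha> (holder_norm (k + 1) \<alpha> a) a"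
    using holder_bd_upto_holder_norm[OF a] by simp
  from comm_int_gains_derivative[OF \<alpha> \<open>0 < R\<close> this]
  obtain C where C: "\<And>u M. holder_bd_upto k \<alpha> M u \<Longrightarrow>
    (\<forall>t. t \<notin> cball 0 R \<longrightarrow> u t = 0) \<Longrightarrow> holder_bd_upto (Suc k) \<alpha> (C * M) (comm_int a u)" by blast
  show "bounded_operator (holder_space_R R k \<alpha>) (holder_norm k \<alpha>)
      (holder_space (k + 1) \<alpha>) (holder_norm (k + 1) \<alpha>) (CZ_commutator UNIV a)"
  proof (rule CZ_commutator_bounded_operator[OF \<alpha> \<alpha>(1) a0, where C = C and R = R])
    show "holder_space_R R k \<alpha> \<subseteq> Linf_space_R R"
    proof
      fix u assume "u \<in> holder_space_R R k \<alpha>"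
      then have "u \<in> holder_space_R R 0 \<alpha>"
        using holder_space_mono[of u 0 k] by (simp add: holder_space_R_def)
      then show "u \<in> Linf_space_R R" by (rule holder_space_R_subset_Linf)
    qed
    fix u assume u: "u \<in> holder_space_R R k \<alpha>"
    then have "holder_bd_upto k \<alpha> (holder_norm k \<alpha> u) u"
      using holder_bd_upto_holder_norm by (simp add: holder_space_R_def)
    then have "holder_bd_upto (Suc k) \<alpha> (C * holder_norm k \<alpha> u) (comm_int a u)"
      by (rule C) (use holder_space_R_zero_outside[OF u] in blast)
    then show "holder_bd_upto (k + 1) \<alpha> (C * holder_norm k \<alpha> u) (comm_int a u)"
      by simp
  qed
qed

end
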